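(* Let $\lambda,\mu>0$, $\xi\ge 0$, $\alpha\in(0,1]$, and let $\{X^\alpha_t\}_{t\ge 0}$ be the fractional $M/M/1$ queue with catastrophes of parameter $\alpha$ (arrival rate $\lambda$, service rate $\mu$, catastrophe rate $\xi$), with transition probabilities $P^\alpha_{i,n}(t)=P(X^\alpha_t=n\mid X^\alpha_0=i)$. Put $\beta_{\lambda,\mu,\xi}(x):=x^{-1}e^{-(\lambda+\mu+\xi)x}$ for $x>0$. Then for every $t>0$ and every integer $i\ge 0$, $$P^\alpha_{i,0}(t)=\frac{1}{\mu}\int_0^\infty \frac{M_\alpha(yt^{-\alpha})}{t^\alpha}\,\beta_{\lambda,\mu,\xi}(y)\sum_{n=i}^\infty\frac{(n+1)I_{n+1}(2\sqrt{\lambda\mu}\,y)}{(\sqrt{\lambda/\mu})^{n+1}}\,dy+\frac{\xi}{\mu}\int_0^\infty\frac{M_\alpha(yt^{-\alpha})}{t^\alpha}\left\{\int_0^y\beta_{\lambda,\mu,\xi}(u)\sum_{n=1}^\infty\frac{n\,I_{n}(2\sqrt{\lambda\mu}\,u)}{(\sqrt{\lambda/\mu})^{n}}\,du\right\}dy,$$ and, for every integer $n>0$, $$\begin{aligned}P^\alpha_{i,n}(t)=\;&\frac{\xi(\sqrt{\lambda/\mu})^{n+1}}{\sqrt{\lambda\mu}}\int_0^\infty\frac{M_\alpha(yt^{-\alpha})}{t^\alpha}\left\{\int_0^y\beta_{\lambda,\mu,\xi}(u)\sum_{k=0}^\infty\frac{(n+k+1)I_{n+k+1}(2\sqrt{\lambda\mu}\,u)}{(\sqrt{\lambda/\mu})^{k+1}}\,du\right\}dy\\&+\int_0^\infty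 y\,\beta_{\lambda,\mu,\xi}(y)\frac{M_\alpha(yt^{-\alpha})}{t^\alpha}\sum_{m=0}^\infty\left[\frac{I_{m+n+i+1}(2\sqrt{\lambda\mu}\,y)}{(\sqrt{\lambda/\mu})^{m-n+i+1}}-\frac{I_{m+n+i+2}(2\sqrt{\lambda\mu}\,y)}{(\sqrt{\lambda/\mu})^{m-n+i}}\right]dy\\&+\int_0^\infty(\sqrt{\lambda/\mu})^{n-i}I_{n-i}(2\sqrt{\lambda\mu}\,y)\,e^{-(\lambda+\mu+\xi)y}\,\frac{M_\alpha(yt^{-\alpha})}{t^\alpha}\,dy.\end{aligned}$$
   Context: Fractional queue. For $\alpha\in(0,1]$, $\lambda,\mu>0$, $\xi\ge0$, a fractional $M/M/1$ queue with catastrophes of parameter $\alpha$ is a continuous-time stochastic process $\{X^\alpha_t\}_{t\ge0}$ with values in $\{0,1,2,\dots\}$ whose transition probabilities $P^\alpha_{i,n}(t):=P(X^\alpha_t=n\mid X^\alpha_0=i)$ satisfy, for $t>0$ and $i\ge0$, $$D^\alpha_tP^\alpha_{i,0}(t)=-(\lambda+\xi)P^\alpha_{i,0}(t)+\mu P^\alpha_{i,1}(t)+\xi,$$ $$D^\alpha_tP^\alpha_{i,n}(t)=-(\lambda+\mu+\xi)P^\alpha_{i,n}(t)+\lambda P^\alpha_{i,n-1}(t)+\mu P^\alpha_{i,n+1}(t)\quad(n\ge1),$$ $$P^\alpha_{i,n}(0)=\delta_{i,n}\ \text{(Kronecker delta)},$$ where for $\alpha\in(0,1)$ $D^\alpha_t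 f(t)=\frac{1}{\Gamma(1-\alpha)}\int_0^t\frac{f'(s)}{(t-s)^\alpha}ds$ is the Caputo derivative, and for $\alpha=1$ $D^1_t=d/dt$. Special functions. $I_\nu(z)=\sum_{m=0}^\infty\frac{1}{m!\,\Gamma(m+\nu+1)}\left(\frac z2\right)^{2m+\nu}$ is the modified Bessel function of the first kind (with $1/\Gamma=0$ at nonpositive integers). For $\alpha\in(0,1)$, $M_\alpha(x)=W_{-\alpha,1-\alpha}(-x)=\sum_{r=0}^\infty\frac{(-x)^r}{r!\,\Gamma(1-\alpha(1+r))}$ (Wright function). For $\alpha=1$, the measure $M_\alpha(yt^{-\alpha})t^{-\alpha}\,dy$ on $(0,\infty)$ is understood as the Dirac mass at $y=t$.
   Formalization: The transition probabilities are also assumed right-continuous at t=0 and, for α<1, absolutely continuous on each [0,t] (the usual domain of the Caputo derivative); otherwise a process that jumps at time 0 to a stationary law satisfies the equations but not the formulas. *)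

theory Defs
  imports "HOL-Probability.Probability"
begin

text \<open>Real powers are taken by \<open>powr\<close>, so this is the usual function for \<open>z > 0\<close> only.
  \<open>rGamma\<close> is the entire function \<open>1/\<Gamma>\<close>, which is 0 at the poles of \<open>\<Gamma>\<close>; hence
  negative integer orders are covered.\<close>

definition bessel_I :: "real \<Rightarrow> real \<Rightarrow> real" where
  "bessel_I \<nu> z = (\<Sum>m. rGamma (real m + \<nu> + 1) / fact m * (z / 2) powr (2 * real m + \<nu>))"

definition wright_W :: "real \<Rightarrow> real \<Rightarrow> real \<Rightarrow> real" where
  "wright_W a b z = (\<Sum>r. z ^ r / fact r * rGamma (a * real r + b))"

definition wright_M :: "real \<Rightarrow> real \<Rightarrow> real" where
  "wright_M \<alpha> x = wright_W (- \<alpha>) (1 - \<alpha>) (- x)"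

text \<open>Integration of \<open>h\<close> over \<open>(0,\<infinity>)\<close> against \<open>M\<^sub>\<alpha>(y t\<^sup>-\<^sup>\<alpha>) t\<^sup>-\<^sup>\<alpha> dy\<close>;
  for \<open>\<alpha> = 1\<close> this measure is the Dirac mass at \<open>t\<close>.\<close>

definition M_integral :: "real \<Rightarrow> real \<Rightarrow> (real \<Rightarrow> real) \<Rightarrow> real" where
  "M_integral \<alpha> t h =
     (if \<alpha> = 1 then h t
      else (LBINT y:{0<..}. wright_M \<alpha> (y * t powr (- \<alpha>)) / t powr \<alpha> * h y))"

text \<open>Absolute continuity on \<open>[0,t]\<close>, stated as validity of the fundamental theorem of calculus
  with Lebesgue integrable pointwise derivative. By Lebesgue's theorem this is equivalent to the
  epsilon-delta definition; the arbitrary value of \<open>deriv f\<close> at points of non-differentiability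
  is irrelevant, since these form a null set.\<close>

definition abs_continuous_upto :: "(real \<Rightarrow> real) \<Rightarrow> real \<Rightarrow> bool" where
  "abs_continuous_upto f t \<longleftrightarrow>
     set_integrable lborel {0<..<t} (deriv f) \<and>
     (\<forall>s\<in>{0..t}. f s = f 0 + (LBINT u:{0<..<s}. deriv f u))"

text \<open>The Caputo derivative of order \<open>\<alpha> \<in> (0,1]\<close> of \<open>f\<close> at \<open>t > 0\<close> exists and equals \<open>D\<close>.
  For \<open>\<alpha> < 1\<close> this includes the usual standing requirement that \<open>f\<close> is absolutely continuous;
  an almost everywhere defined \<open>f'\<close> alone would not determine \<open>f\<close> from \<open>f 0\<close>.\<close>

definition has_caputo_derivative :: "real \<Rightarrow> (real \<Rightarrow> real) \<Rightarrow> real \<Rightarrow> real \<Rightarrow> bool" where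
  "has_caputo_derivative \<alpha> f D t \<longleftrightarrow>
     (if \<alpha> = 1 then (f has_real_derivative D) (at t)
      else abs_continuous_upto f t \<and>
           set_integrable lborel {0<..<t} (\<lambda>s. deriv f s / (t - s) powr \<alpha>) \<and>
           D = 1 / Gamma (1 - \<alpha>) * (LBINT s:{0<..<t}. deriv f s / (t - s) powr \<alpha>))"

definition transition_prob ::
    "'a measure \<Rightarrow> (real \<Rightarrow> 'a \<Rightarrow> nat) \<Rightarrow> nat \<Rightarrow> nat \<Rightarrow> real \<Rightarrow> real" where
  "transition_prob M X i n t = cond_prob M (\<lambda>\<omega>. X t \<omega> = n) (\<lambda>\<omega>. X 0 \<omega> = i)"

text \<open>The equations are imposed for those initial states \<open>i\<close> for which the conditional
  probabilities given \<open>X\<^sub>0 = i\<close> are defined, so that processes started in a fixed state are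
  included. Right-continuity at 0 ties the values at \<open>t > 0\<close> to the initial condition;
  it is only needed for \<open>\<alpha> = 1\<close>, as it follows from absolute continuity for \<open>\<alpha> < 1\<close>.\<close>

definition fractional_MM1_catastrophes ::
    "real \<Rightarrow> real \<Rightarrow> real \<Rightarrow> real \<Rightarrow> 'a measure \<Rightarrow> (real \<Rightarrow> 'a \<Rightarrow> nat) \<Rightarrow> bool" where
  "fractional_MM1_catastrophes \<alpha> lam \<mu> \<xi> M X \<longleftrightarrow>
     prob_space M \<and>
     (\<forall>t\<ge>0. X t \<in> measurable M (count_space UNIV)) \<and>
     (\<forall>i. \<P>(\<omega> in M. X 0 \<omega> = i) > 0 \<longrightarrow>
        (let P = transition_prob M X i in
          (\<forall>n. P n 0 = (if n = i then 1 else 0)) \<and>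
          (\<forall>n. continuous (at_right 0) (P n)) \<and>
          (\<forall>t>0. has_caputo_derivative \<alpha> (P 0)
                    (- (lam + \<xi>) * P 0 t + \<mu> * P 1 t + \<xi>) t) \<and>
          (\<forall>t>0. \<forall>n\<ge>1. has_caputo_derivative \<alpha> (P n)
                    (- (lam + \<mu> + \<xi>) * P n t + lam * P (n - 1) t + \<mu> * P (n + 1) t) t)))"

definition queue_beta :: "real \<Rightarrow> real \<Rightarrow> real \<Rightarrow> real \<Rightarrow> real" where
  "queue_beta lam \<mu> \<xi> x = inverse x * exp (- (lam + \<mu> + \<xi>) * x)"

end

theory Submission
  imports Defs "HOL-Complex_Analysis.Cauchy_Integral_Theorem" "HOL-Real_Asymp.Real_Asymp"
begin

text \<open>The theorem says that the fractional queue is the ordinary queue (\<open>\<alpha> = 1\<close>) run at a random time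
  with density \<open>M\<^sub>\<alpha>(y t\<^sup>-\<^sup>\<alpha>) t\<^sup>-\<^sup>\<alpha>\<close>. The proof compares power series. Three facts are combined.

  (1) The right-hand side of the Kolmogorov system is a bounded operator on bounded sequences. Abel
  inversion (\<open>abel_inversion\<close>) turns the Caputo equations into a Volterra equation with
  kernel \<open>(t - s)\<^sup>\<alpha>\<^sup>-\<^sup>1 / \<Gamma>(\<alpha>)\<close>, and Picard iteration shows that every solution that is bounded uniformly
  in the state is \<open>\<Sum>k. c k n * t powr (\<alpha> k) / \<Gamma>(\<alpha> k + 1)\<close>
  (\<open>caputo_queue_series\<close>). The coefficients \<open>c k n\<close> do not depend on \<open>\<alpha>\<close> and grow at most
  geometrically in \<open>k\<close>. Transition probabilities are bounded by 1, so the expansion applies to them.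

  (2) The function \<open>M\<^sub>\<alpha>\<close> decays faster than every exponential and has the moments
  \<open>k! / \<Gamma>(\<alpha> k + 1)\<close>, for \<open>0 < \<alpha> < 1\<close> (\<open>wright_W_exp_decay\<close>, \<open>wright_W_moment\<close>). Hence integration
  against the subordination density maps \<open>\<Sum>k. c k * y ^ k / k!\<close> to
  \<open>\<Sum>k. c k * t powr (\<alpha> k) / \<Gamma>(\<alpha> k + 1)\<close> (\<open>M_integral_series\<close>). The decay is invisible in the defining
  series of \<open>M\<^sub>\<alpha>\<close>; it is read off from a Hankel-type contour integral, which rests on
  Hankel's formula for \<open>1/\<Gamma>\<close> (\<open>hankel_integral_eq\<close>).

  (3) For \<open>\<alpha> = 1\<close> the integrands in the theorem add up to an explicit solution of the system
  (\<open>queue_prob_DERIV\<close>). The functions \<open>(\<lambda>/\<mu>)\<^sup>k\<^sup>/\<^sup>2 I\<^sub>k(2\<surd>(\<lambda>\<mu>) y)\<close> are the exponential generating functions of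
  weighted walks on the integers, which replaces the theory of Bessel functions by two recurrences for
  walk weights; the boundary at 0 is treated by reflection, and catastrophes by Duhamel's formula.

  Applying (1) with \<open>\<alpha> = 1\<close> to the solution in (3), and then (2), gives the same series as (1) for the
  fractional queue. The remaining work is to split the integral into the stated pieces, each of
  which is integrable because it grows at most exponentially.\<close>

section \<open>Integrals over half-lines\<close>

lemma set_integral_FTC_atLeast:
  fixes F :: "real \<Rightarrow> 'a::euclidean_space"
  assumes der: "\<And>x. a \<le> x \<Longrightarrow> (F has_vector_derivative f x) (at x within {a..})"
    and cont: "continuous_on {a..} f"
    and int: "set_integrable lborel {a..} f"
    and lim: "(F \<longlongrightarrow> L) at_top"
  shows "(LBINT x:{a..}. f x) = L - F a"
proof -
  have "((\<lambda>b. LBINT x:{a..b}. f x) \<longlongrightarrow> (LBINT x:{a..}. f x)) at_top"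
    by (rule tendsto_set_lebesgue_integral_at_top[OF _ int]) simp
  moreover have "eventually (\<lambda>b. (LBINT x:{a..b}. f x) = F b - F a) at_top"
    using eventually_ge_at_top[of a]
  proof eventually_elim
    case (elim b)
    have "(LBINT x. indicator {a..b} x *\<^sub>R f x) = F b - F a"
      by (rule integral_FTC_Icc)
        (use elim in \<open>auto intro: has_vector_derivative_within_subset[OF der] continuous_on_subset[OF cont]\<close>)
    then show ?case by (simp add: set_lebesgue_integral_def)
  qed
  ultimately have "((\<lambda>b. F b - F a) \<longlongrightarrow> (LBINT x:{a..}. f x)) at_top"
    by (rule Lim_transform_eventually)
  moreover have "((\<lambda>b. F b - F a) \<longlongrightarrow> L - F a) at_top"
    by (intro tendsto_intros lim)
  ultimately show ?thesis
    by (rule tendsto_unique[rotated]) simp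
qed

lemma set_integral_sums_dominated:
  fixes f :: "nat \<Rightarrow> real \<Rightarrow> 'a::{banach, second_countable_topology}"
  assumes S: "S \<in> sets lborel"
    and meas: "\<And>r. set_integrable lborel S (f r)"
    and w: "set_integrable lborel S w"
    and bd: "\<And>n x. x \<in> S \<Longrightarrow> norm (\<Sum>r<n. f r x) \<le> w x"
    and sums: "\<And>x. x \<in> S \<Longrightarrow> (\<lambda>r. f r x) sums g x"
  shows "(\<lambda>r. LBINT x:S. f r x) sums (LBINT x:S. g x)"
    and "set_integrable lborel S g"
proof -
  have *: "set_integrable lborel S (\<lambda>x. \<Sum>r<n. f r x)" for n
    using meas unfolding set_integrable_def scaleR_sum_right by (intro Bochner_Integration.integrable_sum) auto
  have meas1: "(\<lambda>x. indicator S x *\<^sub>R (\<Sum>r<n. f r x)) \<in> borel_measurable lborel" for n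
    using *[of n] unfolding set_integrable_def by auto
  have conv: "(\<lambda>n. indicator S x *\<^sub>R (\<Sum>r<n. f r x)) \<longlonglongrightarrow> indicator S x *\<^sub>R g x" for x
    using sums[of x] unfolding sums_def by (auto split: split_indicator)
  have meas2: "(\<lambda>x. indicator S x *\<^sub>R g x) \<in> borel_measurable lborel"
    by (rule borel_measurable_LIMSEQ_metric[OF meas1 conv])
  have bd': "norm (indicator S x *\<^sub>R (\<Sum>r<n. f r x)) \<le> indicator S x *\<^sub>R w x" for n x
    using bd[of x n] by (auto split: split_indicator)
  show "set_integrable lborel S g" unfolding set_integrable_def
    using w meas1 meas2 unfolding set_integrable_def
    by (intro integrable_dominated_convergence[where s = "\<lambda>n x. indicator S x *\<^sub>R (\<Sum>r<n. f r x)"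
        and w = "\<lambda>x. indicator S x *\<^sub>R w x"] AE_I2 conv bd')
  have "(\<lambda>n. LBINT x:S. (\<Sum>r<n. f r x)) \<longlonglongrightarrow> (LBINT x:S. g x)"
    unfolding set_lebesgue_integral_def using w meas1 meas2 unfolding set_integrable_def
    by (intro integral_dominated_convergence[where s = "\<lambda>n x. indicator S x *\<^sub>R (\<Sum>r<n. f r x)"
        and w = "\<lambda>x. indicator S x *\<^sub>R w x"] AE_I2 conv bd')
  moreover have "(LBINT x:S. (\<Sum>r<n. f r x)) = (\<Sum>r<n. LBINT x:S. f r x)" for n
    using meas unfolding set_lebesgue_integral_def set_integrable_def scaleR_sum_right
    by (intro Bochner_Integration.integral_sum) auto
  ultimately show "(\<lambda>r. LBINT x:S. f r x) sums (LBINT x:S. g x)"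
    unfolding sums_def by simp
qed

text \<open>A double exponential beats every exponential. The constant comes from the tangent of \<open>exp\<close> at \<open>ln (d / k)\<close>.\<close>

lemma exp_minus_exp_bound:
  fixes a c k :: real assumes "0 < k"
  obtains C where "0 < C" "\<And>v. a \<le> v \<Longrightarrow> exp (c * v - k * exp v) \<le> C * exp (- v)"
proof -
  define d where "d = \<bar>c\<bar> + 1"
  define C where "C = d * ln (d / k) - d + (d - c - 1) * \<bar>a\<bar>"
  have d: "d > 0" by (simp add: d_def)
  have "exp (c * v - k * exp v) \<le> exp C * exp (- v)" if v: "a \<le> v" for v
  proof -
    have "1 + (v - ln (d / k)) \<le> exp (v - ln (d / k))" by (rule exp_ge_add_one_self)
    also have "\<dots> = exp v * k / d" using d assms by (simp add: exp_diff field_simps)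
    finally have "d * (1 + (v - ln (d / k))) \<le> d * (exp v * k / d)" using d by (intro mult_left_mono) auto
    then have "d * v \<le> k * exp v + d * ln (d / k) - d" using d by (simp add: algebra_simps)
    moreover have "(d - c - 1) * (- \<bar>a\<bar>) \<le> (d - c - 1) * v"
      using v by (intro mult_left_mono) (auto simp: d_def)
    ultimately have "c * v - k * exp v \<le> C + - v" by (simp add: algebra_simps C_def)
    then show ?thesis by (simp add: exp_add[symmetric])
  qed
  then show ?thesis by (intro that[of "exp C"]) auto
qed

lemma set_integrable_exp_neg: "set_integrable lborel {a..} (\<lambda>v::real. C * exp (- v))" for a C :: real
proof -
  have "set_integrable lborel {a..} (\<lambda>v. exp (- v))"
    using integrable_on_exp_minus_to_infinity[of 1 a] nonnegative_absolutely_integrable_1[of "\<lambda>v. exp (-v)" "{a..}"]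
    by (auto simp: set_integrable_def integrable_completion)
  then show ?thesis by simp
qed

lemma set_integrable_bound_continuous:
  fixes f :: "real \<Rightarrow> 'a::euclidean_space"
  assumes cont: "continuous_on {a..} f"
    and bd: "\<And>v. a \<le> v \<Longrightarrow> norm (f v) \<le> C * exp (- v)"
  shows "set_integrable lborel {a..} f"
  unfolding set_integrable_def
proof (rule Bochner_Integration.integrable_bound[OF set_integrable_exp_neg[of a C, unfolded set_integrable_def]])
  show "(\<lambda>x. indicator {a..} x *\<^sub>R f x) \<in> borel_measurable lborel"
    using borel_measurable_continuous_on_indicator[OF _ cont] by simp
  show "AE x in lborel. norm (indicator {a..} x *\<^sub>R f x) \<le> norm (indicator {a..} x *\<^sub>R (C * exp (- x)))"
    using bd by (intro AE_I2) (auto split: split_indicator intro: order_trans[OF _ abs_ge_self])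
qed

section \<open>Hankel's integral for the reciprocal Gamma function\<close>

text \<open>The integrand \<open>e\<^sup>s s\<^sup>-\<^sup>z ds\<close> of Hankel's integral after the substitution \<open>s = e\<^sup>w\<close>. In the variable \<open>w\<close> it is
  entire, so there is no branch cut, and rays from the origin become horizontal lines.\<close>

definition hankel_integrand :: "real \<Rightarrow> complex \<Rightarrow> complex" where
  "hankel_integrand z w = exp (exp w + of_real (1 - z) * w)"

lemma norm_hankel_integrand:
  "norm (hankel_integrand z (Complex v \<phi>)) = exp (exp v * cos \<phi> + (1 - z) * v)"
  by (simp add: hankel_integrand_def Re_exp)

lemma continuous_on_hankel_integrand:
  "continuous_on S f \<Longrightarrow> continuous_on S (\<lambda>x. hankel_integrand z (f x))"
  unfolding hankel_integrand_def by (intro continuous_intros)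

lemma continuous_on_Complex [continuous_intros]:
  "continuous_on S f \<Longrightarrow> continuous_on S g \<Longrightarrow> continuous_on S (\<lambda>x. Complex (f x) (g x))"
  unfolding Complex_eq by (intro continuous_intros)

lemma hankel_ray_integrable:
  assumes "cos \<theta> < 0"
  shows "set_integrable lborel {a..} (\<lambda>v. hankel_integrand z (Complex v \<theta>))"
proof -
  obtain C where C: "\<And>v. a \<le> v \<Longrightarrow> exp ((1 - z) * v - (- cos \<theta>) * exp v) \<le> C * exp (- v)"
    using exp_minus_exp_bound[of "- cos \<theta>" a "1 - z"] assms by auto
  show ?thesis
    by (rule set_integrable_bound_continuous[where C = C])
      (use C in \<open>auto intro!: continuous_on_hankel_integrand continuous_intros
          simp: norm_hankel_integrand mult.commute add.commute\<close>)
qed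

lemma hankel_primitive:
  obtains g where "\<And>w. (g has_field_derivative hankel_integrand z w) (at w)"
proof -
  have "hankel_integrand z holomorphic_on UNIV"
    unfolding hankel_integrand_def by (intro holomorphic_intros)
  from holomorphic_convex_primitive'[OF convex_UNIV open_UNIV this] show ?thesis
    using that by (metis UNIV_I)
qed

text \<open>A primitive of the integrand has a limit along every horizontal line on which \<open>cos \<theta> < 0\<close>.\<close>

lemma hankel_ray_limit:
  assumes g: "\<And>w. (g has_field_derivative hankel_integrand z w) (at w)" and "cos \<theta> < 0"
  shows "((\<lambda>V. g (Complex V \<theta>)) \<longlongrightarrow> g (Complex a \<theta>) + (LBINT v:{a..}. hankel_integrand z (Complex v \<theta>))) at_top"
proof -
  have der: "((\<lambda>v. g (Complex v \<theta>)) has_vector_derivative hankel_integrand z (Complex v \<theta>)) (at v within S)" for v S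
  proof -
    have "((\<lambda>v. Complex v \<theta>) has_vector_derivative 1) (at v within S)"
      unfolding Complex_eq by (auto intro!: derivative_eq_intros)
    from field_vector_diff_chain_within[OF this DERIV_subset[OF g]] show ?thesis by (simp add: o_def)
  qed
  have "((\<lambda>b. LBINT v:{a..b}. hankel_integrand z (Complex v \<theta>)) \<longlongrightarrow> (LBINT v:{a..}. hankel_integrand z (Complex v \<theta>))) at_top"
    by (rule tendsto_set_lebesgue_integral_at_top[OF _ hankel_ray_integrable[OF assms(2)]]) simp
  moreover have "eventually (\<lambda>b. (LBINT v:{a..b}. hankel_integrand z (Complex v \<theta>)) = g (Complex b \<theta>) - g (Complex a \<theta>)) at_top"
    using eventually_ge_at_top[of a]
  proof eventually_elim
    case (elim b)
    show ?case unfolding set_lebesgue_integral_def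
      by (rule integral_FTC_Icc)
        (use elim in \<open>auto intro!: der continuous_on_hankel_integrand continuous_intros\<close>)
  qed
  ultimately have "((\<lambda>b. g (Complex b \<theta>) - g (Complex a \<theta>)) \<longlongrightarrow> (LBINT v:{a..}. hankel_integrand z (Complex v \<theta>))) at_top"
    by (rule Lim_transform_eventually)
  from tendsto_add[OF tendsto_const[of "g (Complex a \<theta>)"] this] show ?thesis by simp
qed

text \<open>The upper half of Hankel's contour: from \<open>a\<close> vertically to \<open>a + i \<theta>\<close>, then horizontally to infinity. The
  lower half is its mirror image, so the imaginary part of the upper half carries the whole integral.\<close>

definition hankel_integral :: "real \<Rightarrow> real \<Rightarrow> real \<Rightarrow> real" where
  "hankel_integral a \<theta> z =
     Im (\<i> * (LBINT \<phi>:{0..\<theta>}. hankel_integrand z (Complex a \<phi>))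
         + (LBINT v:{a..}. hankel_integrand z (Complex v \<theta>)))"

lemma hankel_segment:
  assumes g: "\<And>w. (g has_field_derivative hankel_integrand z w) (at w)" and "0 \<le> \<theta>"
  shows "\<i> * (LBINT \<phi>:{0..\<theta>}. hankel_integrand z (Complex a \<phi>)) = g (Complex a \<theta>) - g (Complex a 0)"
proof -
  have der: "((\<lambda>\<phi>. g (Complex a \<phi>)) has_vector_derivative \<i> * hankel_integrand z (Complex a \<phi>)) (at \<phi> within S)" for \<phi> S
  proof -
    have "((\<lambda>\<phi>. Complex a \<phi>) has_vector_derivative \<i>) (at \<phi> within S)"
      unfolding Complex_eq by (auto intro!: derivative_eq_intros)
    from field_vector_diff_chain_within[OF this DERIV_subset[OF g]] show ?thesis by (simp add: o_def)
  qed
  have "(LBINT \<phi>:{0..\<theta>}. \<i> * hankel_integrand z (Complex a \<phi>)) = g (Complex a \<theta>) - g (Complex a 0)"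
    unfolding set_lebesgue_integral_def
    by (rule integral_FTC_Icc)
      (use assms in \<open>auto intro!: der continuous_on_hankel_integrand continuous_intros\<close>)
  then show ?thesis by simp
qed

lemma Im_hankel_primitive_real:
  assumes g: "\<And>w. (g has_field_derivative hankel_integrand z w) (at w)"
  shows "Im (g (Complex a 0)) = Im (g (Complex b 0))"
proof -
  have "((\<lambda>v. Im (g (Complex v 0))) has_vector_derivative 0) (at v within UNIV)" for v
  proof -
    have "((\<lambda>v. Complex v 0) has_vector_derivative 1) (at v within UNIV)"
      unfolding Complex_eq by (auto intro!: derivative_eq_intros)
    from field_vector_diff_chain_within[OF this DERIV_subset[OF g]]
    have "((\<lambda>v. g (Complex v 0)) has_vector_derivative hankel_integrand z (Complex v 0)) (at v within UNIV)"
      by (simp add: o_def)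
    then have "((\<lambda>v. Im (g (Complex v 0))) has_vector_derivative Im (hankel_integrand z (Complex v 0))) (at v within UNIV)"
      by (rule bounded_linear.has_vector_derivative[OF bounded_linear_Im])
    moreover have "Im (hankel_integrand z (Complex v 0)) = 0"
      by (simp add: hankel_integrand_def Im_exp complex_eq_iff)
    ultimately show ?thesis by simp
  qed
  from has_vector_derivative_zero_constant[OF convex_UNIV this] show ?thesis
    by (metis UNIV_I)
qed

text \<open>The vertical segment between the heights \<open>\<theta>\<close> and \<open>\<pi>\<close> contributes nothing far to the right.\<close>

lemma hankel_rotate:
  assumes g: "\<And>w. (g has_field_derivative hankel_integrand z w) (at w)"
    and \<theta>: "pi / 2 < \<theta>" "\<theta> < pi"
  shows "((\<lambda>V. g (Complex V \<theta>) - g (Complex V pi)) \<longlongrightarrow> 0) at_top"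
proof (rule Lim_null_comparison)
  have c: "cos \<theta> < 0" using \<theta> cos_lt_zero_pi[of "\<theta>"] by (simp)
  show "eventually (\<lambda>V. norm (g (Complex V \<theta>) - g (Complex V pi)) \<le> exp (exp V * cos \<theta> + (1 - z) * V) * pi) at_top"
  proof (rule eventuallyI)
    fix V
    have "norm (g (Complex V \<theta>) - g (Complex V pi)) \<le> exp (exp V * cos \<theta> + (1 - z) * V) * norm (Complex V \<theta> - Complex V pi)"
    proof (rule field_differentiable_bound[of "closed_segment (Complex V pi) (Complex V \<theta>)"])
      fix w assume w: "w \<in> closed_segment (Complex V pi) (Complex V \<theta>)"
      then obtain \<phi> where "w = Complex V \<phi>" "\<theta> \<le> \<phi>" "\<phi> \<le> pi"
      proof -
        from w obtain u where u: "0 \<le> u" "u \<le> 1" "w = (1 - u) *\<^sub>R Complex V pi + u *\<^sub>R Complex V \<theta>"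
          by (auto simp: closed_segment_def)
        have "w = Complex V (pi - u * (pi - \<theta>))" using u(3) by (simp add: complex_eq_iff algebra_simps)
        moreover have "0 \<le> u * (pi - \<theta>)" "u * (pi - \<theta>) \<le> pi - \<theta>"
          using u \<theta> by (auto intro: mult_left_le_one_le)
        ultimately show ?thesis by (intro that[of "pi - u * (pi - \<theta>)"]) auto
      qed
      moreover from this have "cos \<phi> \<le> cos \<theta>" using \<theta> by (intro cos_monotone_0_pi_le) auto
      ultimately show "norm (hankel_integrand z w) \<le> exp (exp V * cos \<theta> + (1 - z) * V)"
        by (simp add: norm_hankel_integrand)
    qed (use g in \<open>auto intro: DERIV_subset\<close>)
    also have "\<dots> \<le> exp (exp V * cos \<theta> + (1 - z) * V) * pi"
      using \<theta> by (intro mult_left_mono) (auto simp: Complex_eq cmod_def abs_le_iff)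
    finally show "norm (g (Complex V \<theta>) - g (Complex V pi)) \<le> exp (exp V * cos \<theta> + (1 - z) * V) * pi" .
  qed
  obtain C where C: "\<And>v. 0 \<le> v \<Longrightarrow> exp ((1 - z) * v - (- cos \<theta>) * exp v) \<le> C * exp (- v)"
    using exp_minus_exp_bound[of "- cos \<theta>" 0 "1 - z"] c by auto
  have "((\<lambda>V. exp (exp V * cos \<theta> + (1 - z) * V)) \<longlongrightarrow> 0) at_top"
  proof (rule Lim_null_comparison)
    show "eventually (\<lambda>V. norm (exp (exp V * cos \<theta> + (1 - z) * V)) \<le> C * exp (- V)) at_top"
      using eventually_ge_at_top[of 0] by eventually_elim (use C in \<open>auto simp: mult.commute add.commute\<close>)
    show "((\<lambda>V. C * exp (- V)) \<longlongrightarrow> 0) at_top" by real_asymp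
  qed
  then show "((\<lambda>V. exp (exp V * cos \<theta> + (1 - z) * V) * pi) \<longlongrightarrow> 0) at_top"
    by (rule tendsto_mult_left_zero)
qed

text \<open>The contour may be moved to height \<open>\<pi>\<close> and its vertical part to any abscissa \<open>b\<close>: the piece
  of the real axis between \<open>a\<close> and \<open>b\<close> has a real integral and does not affect the imaginary part.\<close>

lemma hankel_integral_collapse:
  assumes \<theta>: "pi / 2 < \<theta>" "\<theta> < pi"
    and g: "\<And>w. (g has_field_derivative hankel_integrand z w) (at w)"
  shows "hankel_integral a \<theta> z = Im (g (Complex b pi) - g (Complex b 0))
           + Im (LBINT v:{b..}. hankel_integrand z (Complex v pi))"
proof -
  have c: "cos \<theta> < 0" using \<theta> cos_lt_zero_pi[of "\<theta>"] by (simp)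
  note l1 = hankel_ray_limit[OF g c, of a] and l2 = hankel_ray_limit[OF g, of pi b]
  have "g (Complex a \<theta>) + (LBINT v:{a..}. hankel_integrand z (Complex v \<theta>)) -
       (g (Complex b pi) + (LBINT v:{b..}. hankel_integrand z (Complex v pi))) = 0"
    by (rule tendsto_unique[OF _ tendsto_diff[OF l1 l2] hankel_rotate[OF g \<theta>]]) auto
  moreover have "0 \<le> \<theta>" using \<theta> pi_gt_zero by linarith
  ultimately show ?thesis
    using hankel_segment[OF g, of \<theta> a] Im_hankel_primitive_real[OF g, of a b]
    unfolding hankel_integral_def by (auto simp: complex_eq_iff)
qed


text \<open>Euler's integral after the substitution \<open>t = e\<^sup>v\<close>.\<close>

lemma Gamma_integral_exp:
  assumes "0 < (s::real)"
  shows "set_integrable lborel UNIV (\<lambda>v. exp (- exp v + s * v))"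
    and "(LBINT v:UNIV. exp (- exp v + s * v)) = Gamma s"
proof -
  define f :: "real \<Rightarrow> real" where "f = (\<lambda>t. t powr (s - 1) / exp t)"
  have hi: "(f has_integral Gamma s) {0<..}"
  proof -
    have "(f has_integral Gamma s) {0..}" unfolding f_def by (rule Gamma_integral_real[OF assms])
    then have "((\<lambda>t. if t \<in> {0<..} then f t else 0) has_integral Gamma s) {0..}"
      by (rule has_integral_spike [of "{0}", rotated 2]) auto
    then show ?thesis by (subst (asm) has_integral_restrict) auto
  qed
  have ai: "f absolutely_integrable_on {0<..}"
    using hi by (intro nonnegative_absolutely_integrable_1) (auto simp: f_def integrable_on_def)
  have img: "range exp = {0::real<..}"
    by (auto simp: image_iff) (metis exp_ln)
  have eq: "\<bar>exp v\<bar> * f (exp v) = exp (- exp v + s * v)" for v :: real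
    by (simp add: f_def powr_def exp_diff exp_add[symmetric] algebra_simps exp_minus field_simps)
  have "(\<lambda>v. \<bar>exp v\<bar> * f (exp v)) absolutely_integrable_on UNIV \<and>
        integral UNIV (\<lambda>v. \<bar>exp v\<bar> * f (exp v)) = Gamma s"
    by (subst has_absolute_integral_change_of_variables_1'[where g = exp])
       (use ai hi in \<open>auto simp: img inj_on_def intro!: derivative_eq_intros integral_unique\<close>)
  then have *: "(\<lambda>v. exp (- exp v + s * v)) absolutely_integrable_on UNIV"
    "integral UNIV (\<lambda>v. exp (- exp v + s * v)) = Gamma s" unfolding eq by auto
  show si: "set_integrable lborel UNIV (\<lambda>v. exp (- exp v + s * v))"
    using *(1) unfolding set_integrable_def by (subst (asm) integrable_completion) auto
  show "(LBINT v:UNIV. exp (- exp v + s * v)) = Gamma s"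
    using set_borel_integral_eq_integral(2)[OF si] *(2) by simp
qed

lemma pi_rGamma_eq: "pi * rGamma z = sin (pi * (1 - z)) * Gamma (1 - z :: real)" if "z < 1"
proof -
  have "rGamma (complex_of_real z) * rGamma (complex_of_real (1 - z)) = complex_of_real (sin (pi * z) / pi)"
    using rGamma_reflection_complex[of "of_real z"] by (simp flip: sin_of_real)
  then have "rGamma z * rGamma (1 - z) = sin (pi * z) / pi"
    unfolding rGamma_complex_of_real of_real_mult[symmetric] of_real_eq_iff .
  moreover have "sin (pi * (1 - z)) = sin (pi * z)"
    by (simp add: algebra_simps sin_diff)
  moreover have "Gamma (1 - z) > 0" using that by (intro Gamma_real_pos) auto
  moreover have "rGamma (1 - z) = inverse (Gamma (1 - z))" by (rule rGamma_inverse_Gamma)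
  ultimately show ?thesis by (simp add: field_simps)
qed

text \<open>For \<open>z < 1\<close> the vertical part vanishes as \<open>b \<rightarrow> -\<infinity>\<close>, and the line at height \<open>\<pi>\<close> gives Euler's integral of
  \<open>\<Gamma>(1 - z)\<close>; the reflection formula concludes.\<close>

lemma hankel_integral_less_one:
  assumes \<theta>: "pi / 2 < \<theta>" "\<theta> < pi" and z: "z < 1"
  shows "hankel_integral a \<theta> z = pi * rGamma z"
proof -
  obtain g where g: "\<And>w. (g has_field_derivative hankel_integrand z w) (at w)"
    using hankel_primitive[of z] by blast
  let ?k = "\<lambda>v. exp (- exp v + (1 - z) * v) :: real"
  have ray: "Im (LBINT v:{b..}. hankel_integrand z (Complex v pi)) = sin (pi * (1 - z)) * (LBINT v:{b..}. ?k v)" for b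
  proof -
    have "hankel_integrand z (Complex v pi) = exp (\<i> * of_real (pi * (1 - z))) * of_real (?k v)" for v
      by (simp add: hankel_integrand_def complex_eq_iff Re_exp Im_exp mult_ac)
    then have "(LBINT v:{b..}. hankel_integrand z (Complex v pi)) =
        exp (\<i> * of_real (pi * (1 - z))) * of_real (LBINT v:{b..}. ?k v)"
      by (simp add: set_integral_complex_of_real)
    then show ?thesis by (simp add: Im_exp)
  qed
  have seg: "norm (g (Complex b pi) - g (Complex b 0)) \<le> exp (exp b + (1 - z) * b) * pi" for b
  proof -
    have "norm (g (Complex b pi) - g (Complex b 0)) \<le> exp (exp b + (1 - z) * b) * norm (Complex b pi - Complex b 0)"
    proof (rule field_differentiable_bound[of "closed_segment (Complex b 0) (Complex b pi)"])
      fix w assume "w \<in> closed_segment (Complex b 0) (Complex b pi)"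
      then obtain u where u: "w = (1 - u) *\<^sub>R Complex b 0 + u *\<^sub>R Complex b pi"
        by (auto simp: closed_segment_def)
      have w: "w = Complex b (u * pi)" using u by (simp add: complex_eq_iff algebra_simps)
      have "exp b * cos (u * pi) \<le> exp b * 1" by (intro mult_left_mono) auto
      then show "norm (hankel_integrand z w) \<le> exp (exp b + (1 - z) * b)"
        by (simp add: w norm_hankel_integrand)
    qed (use g in \<open>auto intro: DERIV_subset\<close>)
    then show ?thesis by (simp add: Complex_eq cmod_def)
  qed
  have "(\<lambda>n. g (Complex (- real n) pi) - g (Complex (- real n) 0)) \<longlonglongrightarrow> 0"
  proof (rule Lim_null_comparison)
    show "\<forall>\<^sub>F n in sequentially. norm (g (Complex (- real n) pi) - g (Complex (- real n) 0))
       \<le> exp (exp (- real n) + (1 - z) * (- real n)) * pi"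
      using seg by (intro always_eventually allI)
    have "(\<lambda>n. exp (exp (- real n) + s * (- real n)) * pi) \<longlonglongrightarrow> 0" if "0 < s" for s :: real
      using that by real_asymp
    from this[of "1 - z"] z show "(\<lambda>n. exp (exp (- real n) + (1 - z) * (- real n)) * pi) \<longlonglongrightarrow> 0"
      by simp
  qed
  then have "(\<lambda>n. Im (g (Complex (- real n) pi) - g (Complex (- real n) 0))) \<longlonglongrightarrow> Im 0"
    by (rule tendsto_Im)
  moreover have U: "(\<Union>n. {- real n..}) = UNIV"
  proof (intro set_eqI iffI UNIV_I)
    fix x :: real
    obtain n where "- x \<le> real n" using real_arch_simple by blast
    then show "x \<in> (\<Union>n. {- real n..})" by (intro UN_I[of n]) auto
  qed
  moreover have "(\<lambda>n. LBINT v:{- real n..}. ?k v) \<longlonglongrightarrow> (LBINT v:(\<Union>n. {- real n..}). ?k v)"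
  proof (rule set_integral_cont_up)
    show "set_integrable lborel (\<Union>n. {- real n..}) ?k"
      unfolding U by (rule Gamma_integral_exp) (use z in simp)
    show "incseq (\<lambda>n. {- real n..})" by (auto simp: incseq_def)
  qed auto
  ultimately have "(\<lambda>n. Im (g (Complex (- real n) pi) - g (Complex (- real n) 0)) +
      sin (pi * (1 - z)) * (LBINT v:{- real n..}. ?k v)) \<longlonglongrightarrow>
      Im 0 + sin (pi * (1 - z)) * (LBINT v:UNIV. ?k v)"
    by (intro tendsto_add tendsto_mult tendsto_const) simp_all
  then have "(\<lambda>n::nat. hankel_integral a \<theta> z) \<longlonglongrightarrow> sin (pi * (1 - z)) * Gamma (1 - z)"
    using hankel_integral_collapse[OF \<theta> g, of a] ray Gamma_integral_exp(2)[of "1 - z"] z by simp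
  then show ?thesis using pi_rGamma_eq[OF z] by (simp add: LIMSEQ_const_iff)
qed

lemma norm_exp_minus_one_le: "norm (exp z - 1) \<le> exp (norm z) * norm z" for z :: complex
proof -
  have "norm (exp z - exp 0) \<le> exp (norm z) * norm (z - 0)"
  proof (rule field_differentiable_bound[of "cball 0 (norm z)"])
    fix y :: complex assume "y \<in> cball 0 (norm z)"
    then have "Re y \<le> norm z" using complex_Re_le_cmod[of y] by simp
    then show "norm (exp y) \<le> exp (norm z)" by simp
  qed (auto intro: DERIV_subset[OF DERIV_exp])
  then show ?thesis by simp
qed

text \<open>For \<open>z = 1\<close> the roles are exchanged: the integrand is real at height \<open>\<pi>\<close>, and the vertical part tends
  to \<open>i \<pi>\<close>.\<close>

lemma hankel_integral_one:
  assumes \<theta>: "pi / 2 < \<theta>" "\<theta> < pi"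
  shows "hankel_integral a \<theta> 1 = pi"
proof -
  obtain g where g: "\<And>w. (g has_field_derivative hankel_integrand 1 w) (at w)"
    using hankel_primitive[of 1] by blast
  have ray: "Im (LBINT v:{b..}. hankel_integrand 1 (Complex v pi)) = 0" for b
  proof -
    have "hankel_integrand 1 (Complex v pi) = of_real (exp (- exp v))" for v
      by (simp add: hankel_integrand_def complex_eq_iff Re_exp Im_exp)
    then show ?thesis by (simp add: set_integral_complex_of_real)
  qed
  have seg: "norm (g (Complex b pi) - g (Complex b 0) - \<i> * pi) \<le> (exp (exp b) * exp b) * pi" for b
  proof -
    have "norm ((g (Complex b pi) - Complex b pi) - (g (Complex b 0) - Complex b 0))
       \<le> (exp (exp b) * exp b) * norm (Complex b pi - Complex b 0)"
    proof (rule field_differentiable_bound[of "closed_segment (Complex b 0) (Complex b pi)"])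
      show "((\<lambda>w. g w - w) has_field_derivative hankel_integrand 1 w - 1) (at w within S)" for w S
        by (intro DERIV_diff DERIV_ident DERIV_subset[OF g]) auto
      fix w assume "w \<in> closed_segment (Complex b 0) (Complex b pi)"
      then obtain u where u: "w = (1 - u) *\<^sub>R Complex b 0 + u *\<^sub>R Complex b pi"
        by (auto simp: closed_segment_def)
      have w: "w = Complex b (u * pi)" using u by (simp add: complex_eq_iff algebra_simps)
      show "norm (hankel_integrand 1 w - 1) \<le> exp (exp b) * exp b"
        using norm_exp_minus_one_le[of "exp w"] by (simp add: hankel_integrand_def w)
    qed auto
    then show ?thesis by (simp add: Complex_eq cmod_def algebra_simps)
  qed
  have "(\<lambda>n. g (Complex (- real n) pi) - g (Complex (- real n) 0) - \<i> * pi) \<longlonglongrightarrow> 0"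
  proof (rule Lim_null_comparison)
    show "\<forall>\<^sub>F n in sequentially. norm (g (Complex (- real n) pi) - g (Complex (- real n) 0) - \<i> * pi)
       \<le> (exp (exp (- real n)) * exp (- real n)) * pi"
      using seg by (intro always_eventually allI)
    show "(\<lambda>n. (exp (exp (- real n)) * exp (- real n)) * pi) \<longlonglongrightarrow> 0" by real_asymp
  qed
  then have "(\<lambda>n. Im (g (Complex (- real n) pi) - g (Complex (- real n) 0) - \<i> * pi)) \<longlonglongrightarrow> Im 0"
    by (rule tendsto_Im)
  moreover have "Im (g (Complex (- real n) pi) - g (Complex (- real n) 0) - \<i> * pi) = hankel_integral a \<theta> 1 - pi" for n
    using hankel_integral_collapse[OF \<theta> g, of a "- real n"] ray[of "- real n"] by simp
  ultimately show ?thesis by (simp add: LIMSEQ_const_iff)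
qed

text \<open>Integration by parts: \<open>exp (e\<^sup>w - z w)\<close> is a primitive of the integrand for \<open>z\<close> minus \<open>z\<close> times the one for \<open>z + 1\<close>; it vanishes at
  infinity and is real at the start of the contour.\<close>

lemma hankel_integral_recurrence:
  assumes \<theta>: "pi / 2 < \<theta>" "\<theta> < pi"
  shows "hankel_integral a \<theta> z = z * hankel_integral a \<theta> (z + 1)"
proof -
  obtain g where g: "\<And>w. (g has_field_derivative hankel_integrand z w) (at w)"
    using hankel_primitive[of z] by blast
  obtain h where h: "\<And>w. (h has_field_derivative hankel_integrand (z + 1) w) (at w)"
    using hankel_primitive[of "z + 1"] by blast
  have c: "cos \<theta> < 0" using \<theta> cos_lt_zero_pi[of "\<theta>"] by (simp)
  \<comment> \<open>the primitives satisfy the same relation up to a constant\<close>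
  define k where "k = (\<lambda>w. g w - of_real z * h w - hankel_integrand (z + 1) w)"
  have "(k has_field_derivative 0) (at w)" for w
    unfolding k_def hankel_integrand_def
    by (rule derivative_eq_intros g h refl)+
      (simp add: hankel_integrand_def algebra_simps exp_diff exp_add exp_minus field_simps)
  then have "\<exists>C. \<forall>w\<in>UNIV. k w = C"
    by (intro has_field_derivative_zero_constant) auto
  then obtain C where k: "\<And>w. g w = of_real z * h w + hankel_integrand (z + 1) w + C"
    unfolding k_def by (auto simp: algebra_simps)
  have hi: "hankel_integral a \<theta> y = Im (Lim at_top (\<lambda>V. f (Complex V \<theta>))) - Im (f (Complex a 0))"
    and lim: "((\<lambda>V. f (Complex V \<theta>)) \<longlongrightarrow> Lim at_top (\<lambda>V. f (Complex V \<theta>))) at_top"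
    if f: "\<And>w. (f has_field_derivative hankel_integrand y w) (at w)" for f y
  proof -
    note l = hankel_ray_limit[OF f c, of a]
    have *: "Lim at_top (\<lambda>V. f (Complex V \<theta>)) = f (Complex a \<theta>) + (LBINT v:{a..}. hankel_integrand y (Complex v \<theta>))"
      by (rule tendsto_Lim[OF _ l]) simp
    have "0 \<le> \<theta>" using \<theta> pi_gt_zero by linarith
    then show "hankel_integral a \<theta> y = Im (Lim at_top (\<lambda>V. f (Complex V \<theta>))) - Im (f (Complex a 0))"
      unfolding * hankel_integral_def using hankel_segment[OF f, of \<theta> a] by simp
    show "((\<lambda>V. f (Complex V \<theta>)) \<longlongrightarrow> Lim at_top (\<lambda>V. f (Complex V \<theta>))) at_top"
      using l * by simp
  qed
  obtain C1 where C1: "\<And>v. 0 \<le> v \<Longrightarrow> exp ((1 - (z + 1)) * v - (- cos \<theta>) * exp v) \<le> C1 * exp (- v)"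
    using exp_minus_exp_bound[of "- cos \<theta>" 0 "1 - (z + 1)"] c by auto
  have e0: "((\<lambda>V. hankel_integrand (z + 1) (Complex V \<theta>)) \<longlongrightarrow> 0) at_top"
  proof (rule Lim_null_comparison)
    show "eventually (\<lambda>V. norm (hankel_integrand (z + 1) (Complex V \<theta>)) \<le> C1 * exp (- V)) at_top"
      using eventually_ge_at_top[of 0] by eventually_elim
        (use C1 in \<open>auto simp: norm_hankel_integrand mult.commute add.commute\<close>)
    show "((\<lambda>V. C1 * exp (- V)) \<longlongrightarrow> 0) at_top" by real_asymp
  qed
  have "((\<lambda>V. g (Complex V \<theta>)) \<longlongrightarrow> of_real z * Lim at_top (\<lambda>V. h (Complex V \<theta>)) + 0 + C) at_top"
    unfolding k by (intro tendsto_intros e0 lim[OF h])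
  from tendsto_unique[OF _ lim[OF g] this]
  have "Lim at_top (\<lambda>V. g (Complex V \<theta>)) = of_real z * Lim at_top (\<lambda>V. h (Complex V \<theta>)) + C" by simp
  moreover have "Im (hankel_integrand (z + 1) (Complex a 0)) = 0"
    by (simp add: hankel_integrand_def Im_exp)
  ultimately show ?thesis
    unfolding hi[OF g] hi[OF h] k by (simp add: algebra_simps)
qed

theorem hankel_integral_eq:
  assumes \<theta>: "pi / 2 < \<theta>" "\<theta> < pi"
  shows "hankel_integral a \<theta> z = pi * rGamma z"
proof -
  have "hankel_integral a \<theta> z = pi * rGamma z" if "z \<le> 1 + real n" for n z
    using that
  proof (induction n arbitrary: z)
    case 0
    then show ?case
      using hankel_integral_less_one[OF \<theta>, of z a] hankel_integral_one[OF \<theta>, of a] by (cases "z = 1") auto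
  next
    case (Suc n)
    show ?case
    proof (cases "z \<le> 1")
      case True
      then show ?thesis
        using hankel_integral_less_one[OF \<theta>, of z a] hankel_integral_one[OF \<theta>, of a] by (cases "z = 1") auto
    next
      case False
      then have "(z - 1) * hankel_integral a \<theta> z = (z - 1) * (pi * rGamma z)"
        using Suc.IH[of "z - 1"] Suc.prems hankel_integral_recurrence[OF \<theta>, of a "z - 1"]
          rGamma_plus1[of "z - 1"] by simp
      then show ?thesis using False by simp
    qed
  qed
  from this[of z "nat \<lceil>z\<rceil>"] show ?thesis by linarith
qed

section \<open>Decay and moments of the Wright function\<close>

lemma exp_subexp_bound:
  fixes x \<epsilon> \<alpha> :: real
  assumes "0 \<le> x" "0 < \<epsilon>" "0 \<le> \<alpha>" "\<alpha> < 1"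
  obtains C where "\<And>v. x * exp (\<alpha> * v) \<le> \<epsilon> * exp v + C"
proof -
  define v1 where "v1 = ln ((x + 1) / \<epsilon>) / (1 - \<alpha>)"
  have "x * exp (\<alpha> * v) \<le> \<epsilon> * exp v + x * exp (\<alpha> * v1)" for v
  proof (cases "v1 \<le> v")
    case True
    have "ln ((x + 1) / \<epsilon>) \<le> (1 - \<alpha>) * v"
      using True assms unfolding v1_def by (simp add: pos_divide_le_eq mult.commute)
    then have "exp (ln ((x + 1) / \<epsilon>)) \<le> exp ((1 - \<alpha>) * v)" by simp
    then have "x + 1 \<le> \<epsilon> * exp ((1 - \<alpha>) * v)"
      using assms by (simp add: pos_divide_le_eq mult.commute)
    then have "x * exp (\<alpha> * v) \<le> \<epsilon> * exp ((1 - \<alpha>) * v) * exp (\<alpha> * v)"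
      by (intro mult_right_mono) auto
    also have "\<dots> = \<epsilon> * exp v" by (simp add: mult.assoc exp_add[symmetric] algebra_simps)
    finally show ?thesis using assms by (simp add: add_increasing2)
  next
    case False
    then have "x * exp (\<alpha> * v) \<le> x * exp (\<alpha> * v1)"
      using assms by (intro mult_left_mono) (auto intro: mult_left_mono)
    then show ?thesis using assms by (simp add: add_increasing)
  qed
  then show ?thesis by (rule that)
qed

lemma norm_set_integral_le:
  fixes f :: "real \<Rightarrow> 'a::{banach, second_countable_topology}"
  assumes "set_integrable lborel S f" "set_integrable lborel S g" "\<And>x. x \<in> S \<Longrightarrow> norm (f x) \<le> g x"
  shows "norm (LBINT x:S. f x) \<le> (LBINT x:S. g x)"
  using assms unfolding set_lebesgue_integral_def set_integrable_def
  by (intro Bochner_Integration.integral_norm_bound_integral) (auto split: split_indicator)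

lemma set_integrable_Icc_continuous:
  fixes f :: "real \<Rightarrow> 'a::euclidean_space"
  shows "continuous_on {a..b} f \<Longrightarrow> set_integrable lborel {a..b} f"
  unfolding set_integrable_def using borel_integrable_compact[of "{a..b}" f] by simp

lemma set_integral_Ioi_eq_Ici:
  fixes f :: "real \<Rightarrow> real"
  assumes "set_integrable lborel {a..} f"
  shows "(LBINT x:{a<..}. f x) = (LBINT x:{a..}. f x)"
  unfolding set_lebesgue_integral_def
proof (rule integral_cong_AE)
  have "set_integrable lborel {a<..} f"
    by (rule set_integrable_subset[OF assms]) auto
  then show "(\<lambda>x. indicator {a<..} x *\<^sub>R f x) \<in> borel_measurable lborel"
    by (simp add: set_integrable_def)
  show "(\<lambda>x. indicator {a..} x *\<^sub>R f x) \<in> borel_measurable lborel"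
    using assms by (simp add: set_integrable_def)
  show "AE x in lborel. indicator {a<..} x *\<^sub>R f x = indicator {a..} x *\<^sub>R f x"
    using AE_lborel_singleton[of a] by eventually_elim (auto split: split_indicator)
qed

text \<open>A height \<open>\<theta>\<close> that suits both exponentials: \<open>\<pi>/2 < \<theta> < \<pi>\<close> makes \<open>e\<^sup>s\<close> decay along the ray, and
  \<open>\<alpha> \<theta> < \<pi>/2\<close> makes the real part of \<open>s\<^sup>\<alpha>\<close> positive on the whole contour.\<close>

definition hankel_angle :: "real \<Rightarrow> real" where
  "hankel_angle \<alpha> = pi / 2 * (2 - \<alpha>)"

lemma hankel_angle:
  assumes "0 < \<alpha>" "\<alpha> < 1"
  shows "pi / 2 < hankel_angle \<alpha>" "hankel_angle \<alpha> < pi" "0 < cos (\<alpha> * hankel_angle \<alpha>)" "cos (hankel_angle \<alpha>) < 0"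
    and "0 < \<alpha> * hankel_angle \<alpha>" "\<alpha> * hankel_angle \<alpha> < pi / 2"
proof -
  show *: "pi / 2 < hankel_angle \<alpha>" "hankel_angle \<alpha> < pi"
    using assms by (simp_all add: hankel_angle_def field_simps)
  show p: "0 < \<alpha> * hankel_angle \<alpha>" using assms * pi_gt_zero by (intro mult_pos_pos) linarith+
  have "0 < (1 - \<alpha>)\<^sup>2" using assms by simp
  then have "\<alpha> * (2 - \<alpha>) < 1" by (simp add: power2_eq_square algebra_simps)
  then have "pi / 2 * (\<alpha> * (2 - \<alpha>)) < pi / 2 * 1" by (intro mult_strict_left_mono) auto
  then show l: "\<alpha> * hankel_angle \<alpha> < pi / 2" by (simp add: hankel_angle_def mult_ac)
  show "0 < cos (\<alpha> * hankel_angle \<alpha>)" using p l by (intro cos_gt_zero_pi) auto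
  show "cos (hankel_angle \<alpha>) < 0" using * cos_lt_zero_pi[of "hankel_angle \<alpha>"] by simp
qed

text \<open>The integrand \<open>e\<^sup>s s\<^sup>-\<^sup>b exp (- x s\<^sup>\<alpha>) ds\<close>, again with \<open>s = e\<^sup>w\<close>, and the terms of its expansion in
  powers of \<open>x\<close>.\<close>

definition wright_integrand :: "real \<Rightarrow> real \<Rightarrow> real \<Rightarrow> complex \<Rightarrow> complex" where
  "wright_integrand \<alpha> b x w = hankel_integrand b w * exp (- (of_real x * exp (of_real \<alpha> * w)))"

definition wright_term :: "real \<Rightarrow> real \<Rightarrow> real \<Rightarrow> nat \<Rightarrow> complex \<Rightarrow> complex" where
  "wright_term \<alpha> b x r w = of_real ((- x) ^ r / fact r) * hankel_integrand (- \<alpha> * real r + b) w"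

lemma wright_term_eq:
  "wright_term \<alpha> b x r w = hankel_integrand b w * ((- (of_real x * exp (of_real \<alpha> * w))) ^ r /\<^sub>R fact r)"
proof -
  have "hankel_integrand (- \<alpha> * real r + b) w = hankel_integrand b w * exp (of_real \<alpha> * w) ^ r"
    by (simp add: hankel_integrand_def exp_of_nat_mult[symmetric] exp_add[symmetric] algebra_simps)
  then show ?thesis
    by (simp add: wright_term_def scaleR_conv_of_real power_minus' power_mult_distrib field_simps)
qed

lemma wright_term_sums: "(\<lambda>r. wright_term \<alpha> b x r w) sums wright_integrand \<alpha> b x w"
  unfolding wright_term_eq wright_integrand_def
  by (intro sums_mult exp_converges)

lemma exp_partial_sum_le: "(\<Sum>r<n. y ^ r /\<^sub>R fact r) \<le> exp y" if "0 \<le> (y::real)"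
  unfolding exp_def using summable_exp_generic[of y] that by (intro sum_le_suminf) auto

lemma norm_wright_term_sum:
  "norm (\<Sum>r<n. wright_term \<alpha> b x r w) \<le> norm (hankel_integrand b w) * exp (\<bar>x\<bar> * exp (\<alpha> * Re w))"
proof -
  let ?y = "\<bar>x\<bar> * exp (\<alpha> * Re w)"
  have "norm (\<Sum>r<n. wright_term \<alpha> b x r w) \<le> (\<Sum>r<n. norm (wright_term \<alpha> b x r w))"
    by (rule norm_sum)
  also have "\<dots> = (\<Sum>r<n. norm (hankel_integrand b w) * (?y ^ r /\<^sub>R fact r))"
    by (intro sum.cong refl) (simp add: wright_term_eq norm_mult norm_power mult_ac)
  also have "\<dots> = norm (hankel_integrand b w) * (\<Sum>r<n. ?y ^ r /\<^sub>R fact r)"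
    by (simp add: sum_distrib_left mult_ac)
  also have "(\<Sum>r<n. ?y ^ r /\<^sub>R fact r) \<le> exp ?y"
    by (rule exp_partial_sum_le) simp
  finally show ?thesis by (simp add: mult_left_mono)
qed

lemma continuous_on_wright_term:
  "continuous_on S f \<Longrightarrow> continuous_on S (\<lambda>x. wright_term \<alpha> b y r (f x))"
  unfolding wright_term_def by (intro continuous_intros continuous_on_hankel_integrand)

lemma wright_segment_sums:
  shows "(\<lambda>r. LBINT \<phi>:{0..\<theta>}. wright_term \<alpha> b x r (Complex a \<phi>)) sums
          (LBINT \<phi>:{0..\<theta>}. wright_integrand \<alpha> b x (Complex a \<phi>))"
    and "set_integrable lborel {0..\<theta>} (\<lambda>\<phi>. wright_integrand \<alpha> b x (Complex a \<phi>))"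
proof -
  show "set_integrable lborel {0..\<theta>} (\<lambda>\<phi>. wright_integrand \<alpha> b x (Complex a \<phi>))"
    unfolding wright_integrand_def
    by (intro set_integrable_Icc_continuous continuous_intros continuous_on_hankel_integrand)
  show "(\<lambda>r. LBINT \<phi>:{0..\<theta>}. wright_term \<alpha> b x r (Complex a \<phi>)) sums
          (LBINT \<phi>:{0..\<theta>}. wright_integrand \<alpha> b x (Complex a \<phi>))"
  by (rule set_integral_sums_dominated[where w = "\<lambda>\<phi>. norm (hankel_integrand b (Complex a \<phi>)) * exp (\<bar>x\<bar> * exp (\<alpha> * a))"],
      auto intro!: set_integrable_Icc_continuous continuous_intros continuous_on_wright_term continuous_on_hankel_integrand
        wright_term_sums order_trans[OF norm_wright_term_sum])
qed

lemma wright_ray_sums: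
  assumes "0 < \<alpha>" "\<alpha> < 1" and c: "cos \<theta> < 0"
  shows "(\<lambda>r. LBINT v:{a..}. wright_term \<alpha> b x r (Complex v \<theta>)) sums
          (LBINT v:{a..}. wright_integrand \<alpha> b x (Complex v \<theta>))"
    and "set_integrable lborel {a..} (\<lambda>v. wright_integrand \<alpha> b x (Complex v \<theta>))"
proof -
  let ?w = "\<lambda>v. norm (hankel_integrand b (Complex v \<theta>)) * exp (\<bar>x\<bar> * exp (\<alpha> * v))"
  obtain C1 where C1: "\<And>v. \<bar>x\<bar> * exp (\<alpha> * v) \<le> (- cos \<theta> / 2) * exp v + C1"
    using exp_subexp_bound[of "\<bar>x\<bar>" "- cos \<theta> / 2" \<alpha>] assms by auto
  obtain C2 where C2: "\<And>v. a \<le> v \<Longrightarrow> exp ((1 - b) * v - (- cos \<theta> / 2) * exp v) \<le> C2 * exp (- v)"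
    using exp_minus_exp_bound[of "- cos \<theta> / 2" a "1 - b"] c by auto
  have bd: "norm (?w v) \<le> exp C1 * C2 * exp (- v)" if "a \<le> v" for v
  proof -
    have "norm (?w v) = exp (exp v * cos \<theta> + (1 - b) * v + \<bar>x\<bar> * exp (\<alpha> * v))"
      by (simp add: norm_hankel_integrand exp_add)
    also have "\<dots> \<le> exp (C1 + ((1 - b) * v - (- cos \<theta> / 2) * exp v))"
      using C1[of v] by (simp add: algebra_simps)
    also have "\<dots> \<le> exp C1 * (C2 * exp (- v))"
      unfolding exp_add using C2[OF that] by (intro mult_left_mono) auto
    finally show ?thesis by (simp add: mult.assoc)
  qed
  have w: "set_integrable lborel {a..} ?w"
    by (rule set_integrable_bound_continuous[OF _ bd]) (auto intro!: continuous_intros continuous_on_hankel_integrand)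
  have int: "set_integrable lborel {a..} (\<lambda>v. wright_term \<alpha> b x r (Complex v \<theta>))" for r
    unfolding wright_term_def using hankel_ray_integrable[OF c] by simp
  show "(\<lambda>r. LBINT v:{a..}. wright_term \<alpha> b x r (Complex v \<theta>)) sums
          (LBINT v:{a..}. wright_integrand \<alpha> b x (Complex v \<theta>))"
    and "set_integrable lborel {a..} (\<lambda>v. wright_integrand \<alpha> b x (Complex v \<theta>))"
    by (rule set_integral_sums_dominated[OF _ int w],
        auto intro!: wright_term_sums order_trans[OF norm_wright_term_sum])+
qed

text \<open>Integrating the expansion term by term along Hankel's contour gives the defining series of the Wright
  function at \<open>- x\<close>.\<close>

lemma wright_sums_hankel:
  assumes \<alpha>: "0 < \<alpha>" "\<alpha> < 1"
  shows "(\<lambda>r. (- x) ^ r / fact r * rGamma (- \<alpha> * real r + b)) sums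
    (Im (\<i> * (LBINT \<phi>:{0..hankel_angle \<alpha>}. wright_integrand \<alpha> b x (Complex a \<phi>))
         + (LBINT v:{a..}. wright_integrand \<alpha> b x (Complex v (hankel_angle \<alpha>)))) / pi)"
proof -
  let ?\<theta> = "hankel_angle \<alpha>"
  note \<theta> = hankel_angle[OF \<alpha>]
  have "(\<lambda>r. Im (\<i> * (LBINT \<phi>:{0..?\<theta>}. wright_term \<alpha> b x r (Complex a \<phi>))
         + (LBINT v:{a..}. wright_term \<alpha> b x r (Complex v ?\<theta>))) / pi) sums
    (Im (\<i> * (LBINT \<phi>:{0..?\<theta>}. wright_integrand \<alpha> b x (Complex a \<phi>))
         + (LBINT v:{a..}. wright_integrand \<alpha> b x (Complex v ?\<theta>))) / pi)"
    by (intro sums_divide sums_Im sums_add sums_mult wright_segment_sums wright_ray_sums \<alpha> \<theta>(4))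
  moreover have "Im (\<i> * (LBINT \<phi>:{0..?\<theta>}. wright_term \<alpha> b x r (Complex a \<phi>))
         + (LBINT v:{a..}. wright_term \<alpha> b x r (Complex v ?\<theta>))) / pi
      = (- x) ^ r / fact r * rGamma (- \<alpha> * real r + b)" for r
  proof -
    let ?z = "- \<alpha> * real r + b" and ?c = "(- x) ^ r / fact r"
    have "\<i> * (LBINT \<phi>:{0..?\<theta>}. wright_term \<alpha> b x r (Complex a \<phi>))
         + (LBINT v:{a..}. wright_term \<alpha> b x r (Complex v ?\<theta>)) =
       of_real ?c * (\<i> * (LBINT \<phi>:{0..?\<theta>}. hankel_integrand ?z (Complex a \<phi>))
         + (LBINT v:{a..}. hankel_integrand ?z (Complex v ?\<theta>)))"
      unfolding wright_term_def set_integral_mult_right by (simp only: algebra_simps)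
    then have "Im (\<i> * (LBINT \<phi>:{0..?\<theta>}. wright_term \<alpha> b x r (Complex a \<phi>))
         + (LBINT v:{a..}. wright_term \<alpha> b x r (Complex v ?\<theta>))) = ?c * hankel_integral a ?\<theta> ?z"
      unfolding hankel_integral_def by (simp only: Im_complex_of_real Re_complex_of_real times_complex.sel)
    then show ?thesis using hankel_integral_eq[OF \<theta>(1,2)] by simp
  qed
  ultimately show ?thesis by simp
qed

lemma wright_summable:
  assumes "0 < \<alpha>" "\<alpha> < 1"
  shows "summable (\<lambda>r. x ^ r / fact r * rGamma (- \<alpha> * real r + b))"
  using sums_summable[OF wright_sums_hankel[OF assms, of "- x" b 0]] by simp

lemma wright_W_DERIV:
  assumes "0 < \<alpha>" "\<alpha> < 1"
  shows "(wright_W (- \<alpha>) b has_field_derivative wright_W (- \<alpha>) (b - \<alpha>) x) (at x)"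
proof -
  define c where "c = (\<lambda>r. rGamma (- \<alpha> * real r + b) / fact r)"
  have "summable (\<lambda>r. c r * y ^ r)" for y
    using wright_summable[OF assms, of y b] by (simp add: c_def mult_ac divide_inverse)
  from termdiffs_strong_converges_everywhere[OF this]
  have "((\<lambda>x. \<Sum>r. c r * x ^ r) has_field_derivative (\<Sum>r. diffs c r * x ^ r)) (at x)" .
  moreover have "(\<lambda>x. \<Sum>r. c r * x ^ r) = wright_W (- \<alpha>) b"
    by (simp add: fun_eq_iff wright_W_def c_def mult_ac divide_inverse)
  moreover have "diffs c r * x ^ r = x ^ r / fact r * rGamma (- \<alpha> * real r + (b - \<alpha>))" for r
  proof -
    have e: "- \<alpha> * real (Suc r) + b = - \<alpha> * real r + (b - \<alpha>)" by (simp add: algebra_simps)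
    show ?thesis unfolding diffs_def c_def e by (simp add: field_simps del: of_nat_Suc)
  qed
  ultimately show ?thesis by (simp add: wright_W_def)
qed

lemma wright_W_0 [simp]: "wright_W a b 0 = rGamma b"
  unfolding wright_W_def using powser_zero[of "\<lambda>r. rGamma (a * real r + b) / fact r"]
  by (simp add: mult_ac divide_inverse)

lemma abs_Im_add_le: "\<bar>Im (\<i> * s + r)\<bar> \<le> norm s + norm r"
  using abs_Im_le_cmod[of "\<i> * s + r"] norm_triangle_ineq[of "\<i> * s" r] by (simp add: norm_mult)

text \<open>On the contour the real part of \<open>s\<^sup>\<alpha>\<close> is at least \<open>e\<^sup>\<alpha>\<^sup>a cos (\<alpha> \<theta>)\<close>, where the starting point \<open>a\<close> is free. Taking
  \<open>a\<close> large gives any exponential rate.\<close>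

lemma wright_W_exp_decay:
  assumes \<alpha>: "0 < \<alpha>" "\<alpha> < 1"
  obtains C where "0 \<le> C" "\<And>x. 0 \<le> x \<Longrightarrow> \<bar>wright_W (- \<alpha>) b (- x)\<bar> \<le> C * exp (- K * x)"
proof -
  let ?\<theta> = "hankel_angle \<alpha>"
  note \<theta> = hankel_angle[OF \<alpha>]
  have \<theta>0: "0 \<le> ?\<theta>" using \<theta>(1) pi_gt_zero by linarith
  define c where "c = cos (\<alpha> * ?\<theta>)"
  have c: "c > 0" using \<theta> by (simp add: c_def)
  \<comment> \<open>chosen such that \<open>e\<^sup>\<alpha>\<^sup>a cos (\<alpha> \<theta>) \<ge> K\<close>\<close>
  define a where "a = ln ((\<bar>K\<bar> + 1) / c) / \<alpha>"
  have "exp (\<alpha> * a) * c = \<bar>K\<bar> + 1" using c \<alpha> by (simp add: a_def)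
  then have aK: "K \<le> exp (\<alpha> * a) * c" by simp
  define I where "I = (LBINT \<phi>:{0..?\<theta>}. norm (hankel_integrand b (Complex a \<phi>)))"
  define J where "J = (LBINT v:{a..}. norm (hankel_integrand b (Complex v ?\<theta>)))"
  have i1: "set_integrable lborel {0..?\<theta>} (\<lambda>\<phi>. norm (hankel_integrand b (Complex a \<phi>)))"
    by (auto intro!: set_integrable_Icc_continuous continuous_intros continuous_on_hankel_integrand)
  have i2: "set_integrable lborel {a..} (\<lambda>v. norm (hankel_integrand b (Complex v ?\<theta>)))"
    using hankel_ray_integrable[OF \<theta>(4)] by (rule set_integrable_norm)
  have bd: "norm (wright_integrand \<alpha> b x (Complex v \<phi>)) \<le> norm (hankel_integrand b (Complex v \<phi>)) * exp (- K * x)"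
    if "0 \<le> x" "a \<le> v" "0 \<le> \<phi>" "\<phi> \<le> ?\<theta>" for x v \<phi>
  proof -
    have "exp (\<alpha> * a) * c \<le> exp (\<alpha> * v) * cos (\<alpha> * \<phi>)"
      using that \<alpha> c \<theta> pi_gt_zero unfolding c_def
      by (intro mult_mono cos_monotone_0_pi_le) (auto intro: mult_left_mono)
    then have "K * x \<le> exp (\<alpha> * v) * cos (\<alpha> * \<phi>) * x" using aK that by (intro mult_right_mono) auto
    moreover have "norm (exp (- (of_real x * exp (of_real \<alpha> * Complex v \<phi>)))) = exp (- (exp (\<alpha> * v) * cos (\<alpha> * \<phi>) * x))"
      by (simp add: Re_exp mult_ac)
    ultimately show ?thesis
      unfolding wright_integrand_def norm_mult by (intro mult_left_mono) (auto simp: mult_ac)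
  qed
  have "\<bar>wright_W (- \<alpha>) b (- x)\<bar> \<le> (I + J) / pi * exp (- K * x)" if x: "0 \<le> x" for x
  proof -
    let ?s = "LBINT \<phi>:{0..?\<theta>}. wright_integrand \<alpha> b x (Complex a \<phi>)"
    let ?r = "LBINT v:{a..}. wright_integrand \<alpha> b x (Complex v ?\<theta>)"
    have "norm ?s \<le> (LBINT \<phi>:{0..?\<theta>}. norm (hankel_integrand b (Complex a \<phi>)) * exp (- K * x))"
      by (rule norm_set_integral_le) (use i1 bd x in \<open>auto intro: wright_segment_sums(2)\<close>)
    then have s: "norm ?s \<le> I * exp (- K * x)" by (simp add: I_def)
    have "norm ?r \<le> (LBINT v:{a..}. norm (hankel_integrand b (Complex v ?\<theta>)) * exp (- K * x))"
      by (rule norm_set_integral_le) (use i2 bd x \<theta>0 in \<open>auto intro: wright_ray_sums(2)[OF \<alpha> \<theta>(4)]\<close>)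
    then have r: "norm ?r \<le> J * exp (- K * x)" by (simp add: J_def)
    have "\<bar>wright_W (- \<alpha>) b (- x)\<bar> = \<bar>Im (\<i> * ?s + ?r)\<bar> / pi"
      by (simp only: wright_W_def sums_unique[OF wright_sums_hankel[OF \<alpha>, of x b a], symmetric] abs_divide) simp
    also have "\<dots> \<le> (norm ?s + norm ?r) / pi"
      by (intro divide_right_mono abs_Im_add_le) simp
    also have "\<dots> \<le> (I * exp (- K * x) + J * exp (- K * x)) / pi"
      by (intro divide_right_mono add_mono s r) simp
    also have "\<dots> = (I + J) / pi * exp (- K * x)" by (simp add: field_simps)
    finally show ?thesis .
  qed
  moreover have "0 \<le> I" "0 \<le> J" unfolding I_def J_def set_lebesgue_integral_def
    by (intro Bochner_Integration.integral_nonneg; simp)+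
  ultimately show ?thesis by (intro that[of "(I + J) / pi"]) auto
qed


lemma power_le_fact_exp: "(x::real) ^ k \<le> fact k * exp x" if "0 \<le> x"
proof -
  have "x ^ k /\<^sub>R fact k = (\<Sum>j\<in>{k}. x ^ j /\<^sub>R fact j)" by simp
  also have "\<dots> \<le> exp x"
    unfolding exp_def using summable_exp_generic[of x] that by (intro sum_le_suminf) auto
  finally show ?thesis by (simp add: field_simps)
qed

lemma continuous_on_wright_W:
  assumes "0 < \<alpha>" "\<alpha> < 1" "continuous_on S f"
  shows "continuous_on S (\<lambda>x. wright_W (- \<alpha>) b (f x))"
proof -
  have "continuous_on UNIV (wright_W (- \<alpha>) b)"
    using wright_W_DERIV[OF assms(1,2)] by (intro DERIV_continuous_on) (auto intro: DERIV_subset)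
  from continuous_on_compose2[OF this assms(3)] show ?thesis by auto
qed

lemma wright_W_power_decay:
  assumes \<alpha>: "0 < \<alpha>" "\<alpha> < 1"
  obtains C where "\<And>x. 0 \<le> x \<Longrightarrow> \<bar>x ^ k * wright_W (- \<alpha>) b (- x)\<bar> \<le> C * exp (- x)"
proof -
  obtain C where C: "0 \<le> C" "\<And>x. 0 \<le> x \<Longrightarrow> \<bar>wright_W (- \<alpha>) b (- x)\<bar> \<le> C * exp (- 2 * x)"
    using wright_W_exp_decay[OF \<alpha>] by metis
  have "\<bar>x ^ k * wright_W (- \<alpha>) b (- x)\<bar> \<le> (fact k * C) * exp (- x)" if x: "0 \<le> x" for x
  proof -
    have "\<bar>x ^ k * wright_W (- \<alpha>) b (- x)\<bar> = x ^ k * \<bar>wright_W (- \<alpha>) b (- x)\<bar>"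
      using x by (simp add: abs_mult)
    also have "\<dots> \<le> (fact k * exp x) * (C * exp (- 2 * x))"
      using C x power_le_fact_exp[OF x, of k] by (intro mult_mono) auto
    also have "\<dots> = (fact k * C) * exp (- x)"
      by (simp add: mult_ac exp_add[symmetric])
    finally show ?thesis .
  qed
  then show ?thesis by (rule that)
qed

lemma wright_W_moment_integrable:
  assumes \<alpha>: "0 < \<alpha>" "\<alpha> < 1"
  shows "set_integrable lborel {0..} (\<lambda>x. x ^ k * wright_W (- \<alpha>) b (- x))"
proof -
  obtain C where C: "\<And>x. 0 \<le> x \<Longrightarrow> \<bar>x ^ k * wright_W (- \<alpha>) b (- x)\<bar> \<le> C * exp (- x)"
    using wright_W_power_decay[OF \<alpha>] by blast
  show ?thesis
    by (rule set_integrable_bound_continuous[where C = C])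
      (use C in \<open>auto intro!: continuous_intros continuous_on_wright_W \<alpha>\<close>)
qed

text \<open>By parts, since \<open>- W\<^sub>-\<^sub>\<alpha>\<^sub>,\<^sub>b\<^sub>+\<^sub>\<alpha>(- x)\<close> is a primitive of \<open>W\<^sub>-\<^sub>\<alpha>\<^sub>,\<^sub>b(- x)\<close> that vanishes at infinity.\<close>

lemma wright_W_moment:
  assumes \<alpha>: "0 < \<alpha>" "\<alpha> < 1"
  shows "(LBINT x:{0..}. x ^ k * wright_W (- \<alpha>) b (- x)) = fact k * rGamma (b + (real k + 1) * \<alpha>)"
proof (induction k arbitrary: b)
  have lim: "((\<lambda>x. - (x ^ k * wright_W (- \<alpha>) b (- x))) \<longlongrightarrow> 0) at_top" for k b
  proof -
    obtain C where C: "\<And>x. 0 \<le> x \<Longrightarrow> \<bar>x ^ k * wright_W (- \<alpha>) b (- x)\<bar> \<le> C * exp (- x)"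
      using wright_W_power_decay[OF \<alpha>] by blast
    show ?thesis
    proof (rule Lim_null_comparison)
      show "\<forall>\<^sub>F x in at_top. norm (- (x ^ k * wright_W (- \<alpha>) b (- x))) \<le> C * exp (- x)"
        using eventually_ge_at_top[of 0] by eventually_elim (use C in auto)
      show "((\<lambda>x. C * exp (- x)) \<longlongrightarrow> 0) at_top" by real_asymp
    qed
  qed
  have der: "((\<lambda>x. - wright_W (- \<alpha>) (b + \<alpha>) (- x)) has_real_derivative wright_W (- \<alpha>) b (- x)) (at x within S)" for b x S
  proof -
    have "((\<lambda>x. wright_W (- \<alpha>) (b + \<alpha>) (- x)) has_real_derivative wright_W (- \<alpha>) (b + \<alpha> - \<alpha>) (- x) * (- 1)) (at x within S)"
      by (rule DERIV_chain2[OF wright_W_DERIV[OF \<alpha>]]) (auto intro!: derivative_eq_intros)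
    from DERIV_minus[OF this] show ?thesis by simp
  qed
  {
    case 0
    have "(LBINT x:{0..}. wright_W (- \<alpha>) b (- x)) = 0 - (- wright_W (- \<alpha>) (b + \<alpha>) (- 0))"
    proof (rule set_integral_FTC_atLeast)
      show "((\<lambda>x. - wright_W (- \<alpha>) (b + \<alpha>) (- x)) has_vector_derivative wright_W (- \<alpha>) b (- x)) (at x within {0..})" for x
        using der by (simp add: has_real_derivative_iff_has_vector_derivative)
      show "continuous_on {0..} (\<lambda>x. wright_W (- \<alpha>) b (- x))"
        by (intro continuous_on_wright_W continuous_intros \<alpha>)
      show "set_integrable lborel {0..} (\<lambda>x. wright_W (- \<alpha>) b (- x))"
        using wright_W_moment_integrable[OF \<alpha>, of 0 b] by simp
      show "((\<lambda>x. - wright_W (- \<alpha>) (b + \<alpha>) (- x)) \<longlongrightarrow> 0) at_top"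
        using lim[of 0] by simp
    qed
    then show ?case by simp
  next
    case (Suc k)
    have i: "set_integrable lborel {0..} (\<lambda>x. x ^ Suc k * wright_W (- \<alpha>) b (- x))"
      "set_integrable lborel {0..} (\<lambda>x. real (Suc k) * (x ^ k * wright_W (- \<alpha>) (b + \<alpha>) (- x)))"
      using wright_W_moment_integrable[OF \<alpha>, of "Suc k" b] wright_W_moment_integrable[OF \<alpha>, of k "b + \<alpha>"] by auto
    have "(LBINT x:{0..}. x ^ Suc k * wright_W (- \<alpha>) b (- x) - real (Suc k) * (x ^ k * wright_W (- \<alpha>) (b + \<alpha>) (- x)))
       = 0 - (- (0 ^ Suc k * wright_W (- \<alpha>) (b + \<alpha>) (- 0)))"
    proof (rule set_integral_FTC_atLeast)
      show "((\<lambda>x. - (x ^ Suc k * wright_W (- \<alpha>) (b + \<alpha>) (- x))) has_vector_derivative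
         x ^ Suc k * wright_W (- \<alpha>) b (- x) - real (Suc k) * (x ^ k * wright_W (- \<alpha>) (b + \<alpha>) (- x))) (at x within {0..})" for x
      proof -
        have "((\<lambda>x. x ^ Suc k) has_real_derivative real (Suc k) * x ^ k) (at x within {0..})"
          using DERIV_pow[of "Suc k" x "{0..}"] by simp
        from DERIV_mult[OF this der[of b x "{0..}"]] show ?thesis
          unfolding has_real_derivative_iff_has_vector_derivative[symmetric] by (simp add: algebra_simps)
      qed
      show "continuous_on {0..} (\<lambda>x. x ^ Suc k * wright_W (- \<alpha>) b (- x) - real (Suc k) * (x ^ k * wright_W (- \<alpha>) (b + \<alpha>) (- x)))"
        by (intro continuous_on_wright_W continuous_intros \<alpha>)
      show "set_integrable lborel {0..} (\<lambda>x. x ^ Suc k * wright_W (- \<alpha>) b (- x) - real (Suc k) * (x ^ k * wright_W (- \<alpha>) (b + \<alpha>) (- x)))"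
        by (rule set_integral_diff(1)[OF i])
      show "((\<lambda>x. - (x ^ Suc k * wright_W (- \<alpha>) (b + \<alpha>) (- x))) \<longlongrightarrow> 0) at_top"
        by (rule lim)
    qed
    then have "(LBINT x:{0..}. x ^ Suc k * wright_W (- \<alpha>) b (- x)) =
       real (Suc k) * (LBINT x:{0..}. x ^ k * wright_W (- \<alpha>) (b + \<alpha>) (- x))"
      unfolding set_integral_diff(2)[OF i] by simp
    then show ?case using Suc.IH[of "b + \<alpha>"] by (simp add: algebra_simps)
  }
qed

section \<open>Integration against the subordination density\<close>

text \<open>Continuous on \<open>(0,\<infinity>)\<close> with at most exponential growth; this suffices for integrability against \<open>M\<^sub>\<alpha>\<close>.\<close>

definition exp_bounded :: "(real \<Rightarrow> real) \<Rightarrow> bool" where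
  "exp_bounded h \<longleftrightarrow> continuous_on {0<..} h \<and> (\<exists>C K. \<forall>y>0. \<bar>h y\<bar> \<le> C * exp (K * y))"

lemma wright_M_exp_bounded_integrable:
  assumes \<alpha>: "0 < \<alpha>" "\<alpha> < 1" and h: "exp_bounded h"
  shows "set_integrable lborel {0<..} (\<lambda>x. wright_M \<alpha> x * h x)"
proof -
  obtain C K where CK: "\<And>y. 0 < y \<Longrightarrow> \<bar>h y\<bar> \<le> C * exp (K * y)" and cont: "continuous_on {0<..} h"
    using h by (auto simp: exp_bounded_def)
  obtain D where D: "0 \<le> D" "\<And>x. 0 \<le> x \<Longrightarrow> \<bar>wright_M \<alpha> x\<bar> \<le> D * exp (- (K + 1) * x)"
    using wright_W_exp_decay[OF \<alpha>, of "1 - \<alpha>" "K + 1"] unfolding wright_M_def by metis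
  have "set_integrable lborel {0<..} (\<lambda>x. D * C * exp (- x))"
    by (rule set_integrable_subset[OF set_integrable_exp_neg[of 0]]) auto
  then show ?thesis unfolding set_integrable_def
  proof (rule Bochner_Integration.integrable_bound)
    have "continuous_on {0<..} (\<lambda>x. wright_M \<alpha> x * h x)"
      unfolding wright_M_def by (intro continuous_on_mult cont continuous_on_wright_W \<alpha> continuous_intros)
    then show "(\<lambda>x. indicator {0<..} x *\<^sub>R (wright_M \<alpha> x * h x)) \<in> borel_measurable lborel"
      using borel_measurable_continuous_on_indicator[of "{0<..}" "\<lambda>x. wright_M \<alpha> x * h x"] by simp
    have "\<bar>wright_M \<alpha> x * h x\<bar> \<le> D * C * exp (- x)" if "0 < x" for x
    proof -
      have "\<bar>wright_M \<alpha> x * h x\<bar> \<le> (D * exp (- (K + 1) * x)) * (C * exp (K * x))"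
        unfolding abs_mult using that D CK by (intro mult_mono) auto
      also have "\<dots> = D * C * exp (- x)" by (simp add: mult_ac exp_add[symmetric]) (simp add: algebra_simps)
      finally show ?thesis .
    qed
    then show "AE x in lborel. norm (indicator {0<..} x *\<^sub>R (wright_M \<alpha> x * h x)) \<le> norm (indicator {0<..} x *\<^sub>R (D * C * exp (- x)))"
      by (intro AE_I2) (auto split: split_indicator intro: order_trans[OF _ abs_ge_self])
  qed
qed

lemma M_integral_rescale:
  assumes "\<alpha> \<noteq> 1" "0 < t"
  shows "M_integral \<alpha> t h = (LBINT x:{0<..}. wright_M \<alpha> x * h (t powr \<alpha> * x))"
proof -
  have p: "t powr \<alpha> > 0" using assms by simp
  have "M_integral \<alpha> t h = (LBINT y. indicator {0<..} y *\<^sub>R (wright_M \<alpha> (y * t powr (- \<alpha>)) / t powr \<alpha> * h y))"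
    using assms by (simp add: M_integral_def set_lebesgue_integral_def)
  also have "\<dots> = t powr \<alpha> * (LBINT x. indicator {0<..} (t powr \<alpha> * x) *\<^sub>R
      (wright_M \<alpha> ((t powr \<alpha> * x) * t powr (- \<alpha>)) / t powr \<alpha> * h (t powr \<alpha> * x)))"
    using p by (subst lborel_integral_real_affine[where c = "t powr \<alpha>" and t = 0]) auto
  also have "\<dots> = (LBINT x. t powr \<alpha> * (indicator {0<..} (t powr \<alpha> * x) *\<^sub>R
      (wright_M \<alpha> ((t powr \<alpha> * x) * t powr (- \<alpha>)) / t powr \<alpha> * h (t powr \<alpha> * x))))"
    by simp
  also have "\<dots> = (LBINT x:{0<..}. wright_M \<alpha> x * h (t powr \<alpha> * x))"
    unfolding set_lebesgue_integral_def
  proof (rule Bochner_Integration.integral_cong)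
    fix x :: real
    have e: "(t powr \<alpha> * x) * t powr (- \<alpha>) = x" using p by (simp add: powr_minus field_simps)
    then show "t powr \<alpha> * (indicator {0<..} (t powr \<alpha> * x) *\<^sub>R
      (wright_M \<alpha> ((t powr \<alpha> * x) * t powr (- \<alpha>)) / t powr \<alpha> * h (t powr \<alpha> * x))) =
      indicator {0<..} x *\<^sub>R (wright_M \<alpha> x * h (t powr \<alpha> * x))"
      unfolding e using p by (simp add: indicator_def zero_less_mult_iff)
  qed simp
  finally show ?thesis .
qed

lemma exp_bounded_scale:
  assumes h: "exp_bounded h" and c: "0 < c"
  shows "exp_bounded (\<lambda>x. h (c * x))"
proof -
  obtain C K where "continuous_on {0<..} h" "\<And>y. 0 < y \<Longrightarrow> \<bar>h y\<bar> \<le> C * exp (K * y)"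
    using h by (auto simp: exp_bounded_def)
  moreover from this c have "\<bar>h (c * y)\<bar> \<le> C * exp ((K * c) * y)" if "0 < y" for y
    using that by (metis mult.assoc mult_pos_pos)
  ultimately show ?thesis
    using c unfolding exp_bounded_def by (auto intro!: continuous_on_compose2[of "{0<..}" h] continuous_intros)
qed

lemma exp_bounded_diff:
  assumes "exp_bounded h" "exp_bounded k"
  shows "exp_bounded (\<lambda>y. h y - k y)"
proof -
  obtain C K where h: "continuous_on {0<..} h" "\<And>y. 0 < y \<Longrightarrow> \<bar>h y\<bar> \<le> C * exp (K * y)"
    using assms(1) by (auto simp: exp_bounded_def)
  obtain D L where k: "continuous_on {0<..} k" "\<And>y. 0 < y \<Longrightarrow> \<bar>k y\<bar> \<le> D * exp (L * y)"
    using assms(2) by (auto simp: exp_bounded_def)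
  have "\<bar>h y - k y\<bar> \<le> (\<bar>C\<bar> + \<bar>D\<bar>) * exp (max K L * y)" if "0 < y" for y
  proof -
    have "C * exp (K * y) \<le> \<bar>C\<bar> * exp (max K L * y)" "D * exp (L * y) \<le> \<bar>D\<bar> * exp (max K L * y)"
      using that by (auto intro!: mult_mono mult_right_mono)
    then show ?thesis
      using h(2)[OF that] k(2)[OF that] abs_triangle_ineq4[of "h y" "k y"] unfolding distrib_right by linarith
  qed
  then show ?thesis unfolding exp_bounded_def using h(1) k(1) by (auto intro!: continuous_intros)
qed

lemma exp_bounded_cmult:
  assumes "exp_bounded h" shows "exp_bounded (\<lambda>y. c * h y)"
proof -
  obtain C K where h: "continuous_on {0<..} h" "\<And>y. 0 < y \<Longrightarrow> \<bar>h y\<bar> \<le> C * exp (K * y)"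
    using assms by (auto simp: exp_bounded_def)
  have "\<bar>c * h y\<bar> \<le> (\<bar>c\<bar> * C) * exp (K * y)" if "0 < y" for y
    using mult_left_mono[OF h(2)[OF that], of "\<bar>c\<bar>"] by (simp add: abs_mult mult_ac)
  then show ?thesis unfolding exp_bounded_def using h(1) by (auto intro!: continuous_intros)
qed

lemma M_integral_add:
  assumes \<alpha>: "0 < \<alpha>" "\<alpha> \<le> 1" and t: "0 < t" and h: "exp_bounded h" "exp_bounded k"
  shows "M_integral \<alpha> t (\<lambda>y. h y + k y) = M_integral \<alpha> t h + M_integral \<alpha> t k"
proof (cases "\<alpha> = 1")
  case False
  then have \<alpha>': "0 < \<alpha>" "\<alpha> < 1" using \<alpha> by auto
  show ?thesis
    unfolding M_integral_rescale[OF False t] distrib_left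
    by (intro set_integral_add wright_M_exp_bounded_integrable \<alpha>' exp_bounded_scale h) (use t in auto)
qed (simp add: M_integral_def)

lemma M_integral_cmult: "M_integral \<alpha> t (\<lambda>y. c * h y) = c * M_integral \<alpha> t h"
  by (simp add: M_integral_def mult.left_commute)

lemma M_integral_cong:
  assumes "\<And>y. 0 < y \<Longrightarrow> h y = k y" "0 < t"
  shows "M_integral \<alpha> t h = M_integral \<alpha> t k"
  using assms by (auto simp: M_integral_def intro!: set_lebesgue_integral_cong)

text \<open>The subordination formula for exponential generating functions of geometrically bounded sequences.\<close>

lemma M_integral_series:
  assumes \<alpha>: "0 < \<alpha>" "\<alpha> \<le> 1" and t: "0 < t"
    and c: "\<And>k. \<bar>c k\<bar> \<le> K ^ k" and K: "0 \<le> K"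
    and h: "\<And>y. 0 < y \<Longrightarrow> (\<lambda>k. c k * y ^ k / fact k) sums h y"
  shows "(\<lambda>k. c k * t powr (\<alpha> * real k) * rGamma (\<alpha> * real k + 1)) sums M_integral \<alpha> t h"
proof (cases "\<alpha> = 1")
  case True
  have "c k * t powr (\<alpha> * real k) * rGamma (\<alpha> * real k + 1) = c k * t ^ k / fact k" for k
    using True t by (simp add: powr_realpow rGamma_inverse_Gamma divide_inverse Gamma_fact add.commute)
  then show ?thesis using h[OF t] True by (simp add: M_integral_def)
next
  case False
  then have \<alpha>': "0 < \<alpha>" "\<alpha> < 1" using \<alpha> by auto
  define s where "s = t powr \<alpha>"
  have s: "s > 0" using t by (simp add: s_def)
  let ?f = "\<lambda>k x. c k * s ^ k / fact k * (x ^ k * wright_M \<alpha> x)"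
  have i: "set_integrable lborel {0..} (\<lambda>x. x ^ k * wright_M \<alpha> x)" for k
    unfolding wright_M_def by (rule wright_W_moment_integrable[OF \<alpha>'])
  have i': "set_integrable lborel {0<..} (?f k)" for k
    by (rule set_integrable_mult_right, rule set_integrable_subset[OF i]) auto
  have "(\<lambda>k. LBINT x:{0<..}. ?f k x) sums (LBINT x:{0<..}. wright_M \<alpha> x * h (s * x))"
  proof (rule set_integral_sums_dominated(1)[OF _ i'])
    have "exp_bounded (\<lambda>x. exp (K * (s * x)))"
      unfolding exp_bounded_def
      by (intro conjI continuous_intros exI[of _ 1] exI[of _ "K * s"]) (auto simp: mult.assoc)
    then have "set_integrable lborel {0<..} (\<lambda>x. \<bar>wright_M \<alpha> x * exp (K * (s * x))\<bar>)"
      by (intro set_integrable_abs wright_M_exp_bounded_integrable[OF \<alpha>'])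
    then show "set_integrable lborel {0<..} (\<lambda>x. \<bar>wright_M \<alpha> x\<bar> * exp (K * (s * x)))"
      by (simp add: abs_mult)
    fix x :: real assume x: "x \<in> {0<..}"
    show "(\<lambda>k. ?f k x) sums (wright_M \<alpha> x * h (s * x))"
      using sums_mult[OF h[of "s * x"], of "wright_M \<alpha> x"] x s by (simp add: power_mult_distrib mult_ac)
    fix n
    have "norm (\<Sum>k<n. ?f k x) \<le> (\<Sum>k<n. norm (?f k x))" by (rule norm_sum)
    also have "\<dots> \<le> (\<Sum>k<n. \<bar>wright_M \<alpha> x\<bar> * ((K * (s * x)) ^ k /\<^sub>R fact k))"
    proof (rule sum_mono)
      fix k
      have "\<bar>c k\<bar> * (s ^ k * x ^ k * \<bar>wright_M \<alpha> x\<bar> / fact k) \<le> K ^ k * (s ^ k * x ^ k * \<bar>wright_M \<alpha> x\<bar> / fact k)"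
        using x s c by (intro mult_right_mono) auto
      then show "norm (?f k x) \<le> \<bar>wright_M \<alpha> x\<bar> * ((K * (s * x)) ^ k /\<^sub>R fact k)"
        using x s by (simp add: abs_mult power_mult_distrib field_simps)
    qed
    also have "\<dots> = \<bar>wright_M \<alpha> x\<bar> * (\<Sum>k<n. (K * (s * x)) ^ k /\<^sub>R fact k)" by (simp add: sum_distrib_left)
    also have "\<dots> \<le> \<bar>wright_M \<alpha> x\<bar> * exp (K * (s * x))"
      using x s K by (intro mult_left_mono exp_partial_sum_le) auto
    finally show "norm (\<Sum>k<n. ?f k x) \<le> \<bar>wright_M \<alpha> x\<bar> * exp (K * (s * x))" .
  qed simp
  moreover have "(LBINT x:{0<..}. ?f k x) = c k * t powr (\<alpha> * real k) * rGamma (\<alpha> * real k + 1)" for k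
  proof -
    have "(LBINT x:{0<..}. ?f k x) = c k * s ^ k / fact k * (LBINT x:{0<..}. x ^ k * wright_M \<alpha> x)"
      by (rule set_integral_mult_right)
    also have "(LBINT x:{0<..}. x ^ k * wright_M \<alpha> x) = fact k * rGamma (1 - \<alpha> + (real k + 1) * \<alpha>)"
      using wright_W_moment[OF \<alpha>', of k "1 - \<alpha>"] set_integral_Ioi_eq_Ici[OF i] by (simp add: wright_M_def)
    also have "1 - \<alpha> + (real k + 1) * \<alpha> = \<alpha> * real k + 1" by (simp add: algebra_simps)
    also have "c k * s ^ k / fact k * (fact k * rGamma (\<alpha> * real k + 1)) = c k * s ^ k * rGamma (\<alpha> * real k + 1)"
      by simp
    also have "\<dots> = c k * t powr (\<alpha> * real k) * rGamma (\<alpha> * real k + 1)"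
      using s by (simp add: s_def powr_realpow[symmetric] powr_powr)
    finally show ?thesis .
  qed
  ultimately show ?thesis unfolding M_integral_rescale[OF False t] s_def by simp
qed

section \<open>Abel inversion and the Volterra equation\<close>

lemma beta_kernel:
  assumes "0 < a" "0 < b" "u < (t::real)"
  shows "has_bochner_integral lborel
     (\<lambda>s. indicator {u<..<t} s * ((t - s) powr (a - 1) * (s - u) powr (b - 1)))
     ((t - u) powr (a + b - 1) * Beta a b)"
proof -
  have 1: "has_bochner_integral lborel (\<lambda>x. indicator {0<..<1} x * ((1 - x) powr (a - 1) * x powr (b - 1))) (Beta a b)"
  proof -
    have i: "set_integrable lborel {0..1} (\<lambda>x. x powr (b - 1) * (1 - x) powr (a - 1))"
      by (rule integrable_Beta[OF assms(2,1)])
    have "(LBINT x:{0..1}. x powr (b - 1) * (1 - x) powr (a - 1)) = Beta b a"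
      using set_borel_integral_eq_integral(2)[OF i] has_integral_Beta_real[OF assms(2,1)]
      by (simp add: integral_unique)
    then have "has_bochner_integral lborel (\<lambda>x. indicator {0..1} x *\<^sub>R (x powr (b - 1) * (1 - x) powr (a - 1))) (Beta b a)"
      using i by (simp add: has_bochner_integral_iff set_integrable_def set_lebesgue_integral_def)
    moreover have "(\<lambda>x. indicator {0..1} x *\<^sub>R (x powr (b - 1) * (1 - x) powr (a - 1))) =
       (\<lambda>x. indicator {0<..<1} x * ((1 - x) powr (a - 1) * x powr (b - 1)))"
      by (rule ext) (auto simp: indicator_def)
    ultimately show ?thesis by (simp add: Beta_commute)
  qed
  have "has_bochner_integral lborel (\<lambda>x. (t - u) powr (a + b - 2) * (indicator {0<..<1} x * ((1 - x) powr (a - 1) * x powr (b - 1))))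
      ((t - u) powr (a + b - 2) * Beta a b)"
    by (rule has_bochner_integral_mult_right) (rule 1)
  also have "(\<lambda>x. (t - u) powr (a + b - 2) * (indicator {0<..<1} x * ((1 - x) powr (a - 1) * x powr (b - 1)))) =
     (\<lambda>x. indicator {u<..<t} (u + (t - u) * x) * ((t - (u + (t - u) * x)) powr (a - 1) * ((u + (t - u) * x) - u) powr (b - 1)))"
  proof (rule ext)
    fix x
    have m: "u + (t - u) * x \<in> {u<..<t} \<longleftrightarrow> x \<in> {0<..<1}"
      using assms mult_less_cancel_left_pos[of "t - u" x 1] zero_less_mult_iff[of "t - u" x]
      by (auto simp: less_diff_eq diff_less_eq add.commute)
    have "t - (u + (t - u) * x) = (t - u) * (1 - x)" by (simp add: algebra_simps)
    then show "(t - u) powr (a + b - 2) * (indicator {0<..<1} x * ((1 - x) powr (a - 1) * x powr (b - 1))) =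
      indicator {u<..<t} (u + (t - u) * x) * ((t - (u + (t - u) * x)) powr (a - 1) * ((u + (t - u) * x) - u) powr (b - 1))"
      using assms m by (auto simp: indicator_def powr_mult powr_add[symmetric])
  qed
  finally have "has_bochner_integral lborel (\<lambda>s. indicator {u<..<t} s * ((t - s) powr (a - 1) * (s - u) powr (b - 1)))
      (\<bar>t - u\<bar> *\<^sub>R ((t - u) powr (a + b - 2) * Beta a b))"
    using assms by (subst lborel_has_bochner_integral_real_affine_iff[of "t - u" _ _ u])
      (simp_all add: mult.assoc[symmetric])
  moreover have "\<bar>t - u\<bar> * (t - u) powr (a + b - 2) = (t - u) powr (a + b - 1)"
    using assms powr_add[of "t - u" 1 "a + b - 2"] by simp
  ultimately show ?thesis by (simp add: mult.assoc[symmetric])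
qed

lemma Gamma_real_neq_0: "0 < (x::real) \<Longrightarrow> Gamma x \<noteq> 0"
  by (metis Gamma_real_pos less_irrefl)

text \<open>The Riemann-Liouville integral of order \<open>a\<close>, and the condition that its integrand is Lebesgue integrable.\<close>

definition frac_int :: "real \<Rightarrow> (real \<Rightarrow> real) \<Rightarrow> real \<Rightarrow> real" where
  "frac_int a f t = rGamma a * (LBINT s:{0<..<t}. (t - s) powr (a - 1) * f s)"

definition frac_integrable :: "real \<Rightarrow> (real \<Rightarrow> real) \<Rightarrow> real \<Rightarrow> bool" where
  "frac_integrable a f t \<longleftrightarrow> set_integrable lborel {0<..<t} (\<lambda>s. (t - s) powr (a - 1) * f s)"

lemma frac_int_add:
  assumes "frac_integrable a f t" "frac_integrable a g t"
  shows "frac_integrable a (\<lambda>s. f s + g s) t" "frac_int a (\<lambda>s. f s + g s) t = frac_int a f t + frac_int a g t"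
  using set_integral_add[OF assms[unfolded frac_integrable_def]]
  by (simp_all add: frac_integrable_def frac_int_def distrib_left)

lemma frac_int_diff:
  assumes "frac_integrable a f t" "frac_integrable a g t"
  shows "frac_integrable a (\<lambda>s. f s - g s) t" "frac_int a (\<lambda>s. f s - g s) t = frac_int a f t - frac_int a g t"
  using set_integral_diff[OF assms[unfolded frac_integrable_def]]
  by (simp_all add: frac_integrable_def frac_int_def right_diff_distrib)

lemma frac_int_cmult:
  assumes "frac_integrable a f t"
  shows "frac_integrable a (\<lambda>s. c * f s) t" "frac_int a (\<lambda>s. c * f s) t = c * frac_int a f t"
  using set_integrable_mult_right[of c lborel "{0<..<t}" "\<lambda>s. (t - s) powr (a - 1) * f s"]
    set_integral_mult_right[of lborel "{0<..<t}" c "\<lambda>s. (t - s) powr (a - 1) * f s"] assms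
  by (simp_all add: frac_integrable_def frac_int_def mult.left_commute)

lemma frac_int_sum:
  assumes "\<And>k. k < K \<Longrightarrow> frac_integrable a (f k) t"
  shows "frac_integrable a (\<lambda>s. \<Sum>k<(K::nat). f k s) t \<and> frac_int a (\<lambda>s. \<Sum>k<K. f k s) t = (\<Sum>k<K. frac_int a (f k) t)"
  using assms
proof (induction K)
  case 0 then show ?case by (simp add: frac_integrable_def frac_int_def set_integrable_def)
next
  case (Suc K) then show ?case using frac_int_add[of a "\<lambda>s. \<Sum>k<K. f k s" t "f K"] by simp
qed

lemma frac_int_abs_le:
  assumes a: "0 < a" and f: "frac_integrable a f t" and g: "frac_integrable a g t"
    and le: "\<And>s. 0 < s \<Longrightarrow> s < t \<Longrightarrow> \<bar>f s\<bar> \<le> g s"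
  shows "\<bar>frac_int a f t\<bar> \<le> frac_int a g t"
proof -
  have "norm (LBINT s:{0<..<t}. (t - s) powr (a - 1) * f s) \<le> (LBINT s:{0<..<t}. (t - s) powr (a - 1) * g s)"
    using f g le unfolding frac_integrable_def set_integrable_def set_lebesgue_integral_def
    by (intro Bochner_Integration.integral_norm_bound_integral)
      (auto simp: abs_mult intro!: mult_left_mono split: split_indicator)
  moreover have "0 < rGamma a" using a Gamma_real_pos[OF a] by (simp add: rGamma_inverse_Gamma)
  ultimately show ?thesis by (simp add: frac_int_def abs_mult mult_left_mono)
qed

lemma frac_int_powr:
  assumes "0 < a" "0 \<le> p" "0 < t"
  shows "frac_integrable a (\<lambda>s. s powr p) t"
    and "frac_int a (\<lambda>s. s powr p * rGamma (p + 1)) t = t powr (p + a) * rGamma (p + a + 1)"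
proof -
  have *: "has_bochner_integral lborel (\<lambda>s. indicator {0<..<t} s * ((t - s) powr (a - 1) * (s - 0) powr (p + 1 - 1)))
     ((t - 0) powr (a + (p + 1) - 1) * Beta a (p + 1))"
    using assms by (intro beta_kernel) auto
  then show i: "frac_integrable a (\<lambda>s. s powr p) t"
    by (simp add: frac_integrable_def set_integrable_def has_bochner_integral_iff)
  have "frac_int a (\<lambda>s. s powr p) t = rGamma a * (t powr (a + p) * Beta a (p + 1))"
    using * by (simp add: frac_int_def set_lebesgue_integral_def has_bochner_integral_iff)
  moreover have "rGamma (p + 1) * (rGamma a * Beta a (p + 1)) = rGamma (p + a + 1)"
  proof -
    have "Gamma a \<noteq> 0" "Gamma (p + 1) \<noteq> 0"
      using assms by (auto intro!: Gamma_real_neq_0)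
    then show ?thesis by (simp add: Beta_altdef rGamma_inverse_Gamma add_ac field_simps)
  qed
  ultimately show "frac_int a (\<lambda>s. s powr p * rGamma (p + 1)) t = t powr (p + a) * rGamma (p + a + 1)"
    using frac_int_cmult(2)[OF i, of "rGamma (p + 1)"] by (simp add: mult_ac add_ac)
qed

lemma frac_integrable_continuous:
  assumes a: "0 < a" and t: "0 < t" and f: "continuous_on {0..t} f"
  shows "frac_integrable a f t"
proof -
  have "compact (f ` {0..t})" by (intro compact_continuous_image f compact_Icc)
  then have "bounded (f ` {0..t})" by (rule compact_imp_bounded)
  then obtain B where B: "\<And>s. s \<in> {0..t} \<Longrightarrow> \<bar>f s\<bar> \<le> B"
    unfolding bounded_iff by (metis imageI real_norm_def)
  have "frac_integrable a (\<lambda>s. s powr 0) t" using a t by (intro frac_int_powr) auto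
  then have "integrable lborel (\<lambda>s. B * (indicator {0<..<t} s * ((t - s) powr (a - 1) * s powr 0)))"
    unfolding frac_integrable_def set_integrable_def by (intro integrable_mult_right) simp
  then show ?thesis
    unfolding frac_integrable_def set_integrable_def
  proof (rule Bochner_Integration.integrable_bound)
    have "continuous_on {0<..<t} (\<lambda>s. (t - s) powr (a - 1) * f s)"
      by (intro continuous_intros continuous_on_subset[OF f]) auto
    then show "(\<lambda>s. indicator {0<..<t} s *\<^sub>R ((t - s) powr (a - 1) * f s)) \<in> borel_measurable lborel"
      using borel_measurable_continuous_on_indicator[of "{0<..<t}" "\<lambda>s. (t - s) powr (a - 1) * f s"] by simp
    have "norm (indicator {0<..<t} s *\<^sub>R ((t - s) powr (a - 1) * f s)) \<le>
         norm (B * (indicator {0<..<t} s * ((t - s) powr (a - 1) * s powr 0)))" for s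
    proof (cases "s \<in> {0<..<t}")
      case True
      then have "\<bar>f s\<bar> \<le> \<bar>B\<bar>" using B[of s] by simp
      then show ?thesis using True by (simp add: abs_mult mult.commute mult_right_mono)
    qed simp
    then show "AE s in lborel. norm (indicator {0<..<t} s *\<^sub>R ((t - s) powr (a - 1) * f s)) \<le>
         norm (B * (indicator {0<..<t} s * ((t - s) powr (a - 1) * s powr 0)))" by simp
  qed
qed

text \<open>The Caputo derivative is the Riemann-Liouville integral of order \<open>1 - \<alpha>\<close> of the derivative. Applying the
  integral of order \<open>\<alpha>\<close> and exchanging the order of integration, the inner integral is a constant Beta integral.\<close>

lemma abel_inversion:
  assumes \<alpha>: "0 < \<alpha>" "\<alpha> < 1" and t: "0 < t"
    and cap: "\<And>s. 0 < s \<Longrightarrow> has_caputo_derivative \<alpha> f (D s) s"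
  shows "f t = f 0 + frac_int \<alpha> D t"
proof -
  define \<phi> where "\<phi> = (\<lambda>u. indicator {0<..<t} u * deriv f u)"
  define K where "K = (\<lambda>u s. indicator {u<..<t} s * ((t - s) powr (\<alpha> - 1) * (s - u) powr (- \<alpha>)))"
  have ac: "abs_continuous_upto f t"
    using cap[OF t] \<alpha> by (simp add: has_caputo_derivative_def)
  then have \<phi>: "integrable lborel \<phi>"
    by (simp add: abs_continuous_upto_def set_integrable_def \<phi>_def)
  have int\<phi>: "(LBINT u. \<phi> u) = f t - f 0"
  proof -
    have "f t = f 0 + (LBINT u:{0<..<t}. deriv f u)"
      using ac t unfolding abs_continuous_upto_def by (meson atLeastAtMost_iff less_imp_le order_refl)
    moreover have "(LBINT u:{0<..<t}. deriv f u) = (LBINT u. \<phi> u)"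
      by (simp add: set_lebesgue_integral_def \<phi>_def)
    ultimately show ?thesis by linarith
  qed
  have KB: "has_bochner_integral lborel (K u) (Beta \<alpha> (1 - \<alpha>))" if "u < t" for u
    using beta_kernel[of \<alpha> "1 - \<alpha>" u t] that \<alpha> by (simp add: K_def)
  have K0: "K u s \<ge> 0" for u s by (simp add: K_def)
  have Kint: "(LBINT s. \<phi> u * K u s) = \<phi> u * Beta \<alpha> (1 - \<alpha>)" for u
    using KB[of u] by (cases "u < t") (auto simp: \<phi>_def has_bochner_integral_iff)
  have Knorm: "(LBINT s. norm (\<phi> u * K u s)) = \<bar>\<phi> u\<bar> * Beta \<alpha> (1 - \<alpha>)" for u
    using KB[of u] K0 by (cases "u < t") (auto simp: \<phi>_def has_bochner_integral_iff abs_mult)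
  have [measurable]: "\<phi> \<in> borel_measurable borel" using \<phi> by auto
  have Kmeas: "(\<lambda>(u, s). K u s) \<in> borel_measurable (lborel \<Otimes>\<^sub>M lborel)"
  proof -
    have "(\<lambda>(u, s). K u s) = (\<lambda>x. (if fst x < snd x \<and> snd x < t then 1 else 0) *
        ((t - snd x) powr (\<alpha> - 1) * (snd x - fst x) powr (- \<alpha>)))"
      by (auto simp: K_def indicator_def fun_eq_iff)
    also have "\<dots> \<in> borel_measurable (lborel \<Otimes>\<^sub>M lborel)" by measurable
    finally show ?thesis .
  qed
  have Fint: "integrable (lborel \<Otimes>\<^sub>M lborel) (\<lambda>(u, s). \<phi> u * K u s)"
  proof (rule lborel_pair.Fubini_integrable)
    have "(\<lambda>x. \<phi> (fst x) * (\<lambda>(u, s). K u s) x) \<in> borel_measurable (lborel \<Otimes>\<^sub>M lborel)"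
      using Kmeas by measurable
    then show "(\<lambda>(u, s). \<phi> u * K u s) \<in> borel_measurable (lborel \<Otimes>\<^sub>M lborel)"
      by (simp add: case_prod_unfold)
    show "integrable lborel (\<lambda>u. LBINT s. norm (case (u, s) of (u, s) \<Rightarrow> \<phi> u * K u s))"
      using \<phi> Knorm by simp
    have "integrable lborel (\<lambda>s. \<phi> u * K u s)" for u
      using KB[of u] by (cases "u < t") (auto simp: \<phi>_def has_bochner_integral_iff)
    then show "AE u in lborel. integrable lborel (\<lambda>s. case (u, s) of (u, s) \<Rightarrow> \<phi> u * K u s)" by simp
  qed
  have inner: "(LBINT u. \<phi> u * K u s) = Gamma (1 - \<alpha>) * (indicator {0<..<t} s * ((t - s) powr (\<alpha> - 1) * D s))" for s
  proof (cases "0 < s \<and> s < t")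
    case True
    have "(\<lambda>u. \<phi> u * K u s) = (\<lambda>u. (t - s) powr (\<alpha> - 1) * (indicator {0<..<s} u * (deriv f u / (s - u) powr \<alpha>)))"
      using True by (auto simp: \<phi>_def K_def indicator_def fun_eq_iff powr_minus divide_inverse)
    then have "(LBINT u. \<phi> u * K u s) = (t - s) powr (\<alpha> - 1) * (LBINT u:{0<..<s}. deriv f u / (s - u) powr \<alpha>)"
      by (simp only: integral_mult_right_zero set_lebesgue_integral_def real_scaleR_def)
    also have "(LBINT u:{0<..<s}. deriv f u / (s - u) powr \<alpha>) = Gamma (1 - \<alpha>) * D s"
      using cap[of s] True \<alpha> Gamma_real_neq_0[of "1 - \<alpha>"] by (auto simp: has_caputo_derivative_def)
    finally show ?thesis using True by simp
  next
    case False
    then have "(\<lambda>u. \<phi> u * K u s) = (\<lambda>u. 0)" by (auto simp: \<phi>_def K_def indicator_def fun_eq_iff)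
    then show ?thesis using False by (auto simp: indicator_def)
  qed
  have "(LBINT s. LBINT u. \<phi> u * K u s) = (LBINT u. LBINT s. \<phi> u * K u s)"
    by (rule lborel_pair.Fubini_integral[OF Fint])
  then have "Gamma (1 - \<alpha>) * (LBINT s:{0<..<t}. (t - s) powr (\<alpha> - 1) * D s) = (f t - f 0) * Beta \<alpha> (1 - \<alpha>)"
    unfolding inner Kint using int\<phi> by (simp add: set_lebesgue_integral_def)
  moreover have "Beta \<alpha> (1 - \<alpha>) = Gamma \<alpha> * Gamma (1 - \<alpha>)" by (simp add: Beta_def)
  ultimately have "Gamma (1 - \<alpha>) * (LBINT s:{0<..<t}. (t - s) powr (\<alpha> - 1) * D s) = Gamma (1 - \<alpha>) * (Gamma \<alpha> * (f t - f 0))"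
    by (simp only: mult_ac)
  then have "(LBINT s:{0<..<t}. (t - s) powr (\<alpha> - 1) * D s) = Gamma \<alpha> * (f t - f 0)"
    using \<alpha> Gamma_real_neq_0[of "1 - \<alpha>"] by (simp only: mult_cancel_left) simp
  then show ?thesis using Gamma_real_neq_0[OF \<alpha>(1)] by (simp add: frac_int_def rGamma_inverse_Gamma field_simps)
qed

lemma caputo_continuous:
  assumes \<alpha>: "0 < \<alpha>" "\<alpha> \<le> 1" and t: "0 < t"
    and cap: "\<And>s. 0 < s \<Longrightarrow> has_caputo_derivative \<alpha> f (D s) s"
    and cont: "continuous (at_right 0) f"
  shows "continuous_on {0..t} f"
proof (cases "\<alpha> = 1")
  case True
  show ?thesis unfolding continuous_on_eq_continuous_within
  proof
    fix x assume x: "x \<in> {0..t}"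
    show "continuous (at x within {0..t}) f"
    proof (cases "x = 0")
      case True
      then show ?thesis using cont t by (simp add: at_within_Icc_at_right)
    next
      case False
      then have "(f has_real_derivative D x) (at x)"
        using cap[of x] x \<open>\<alpha> = 1\<close> by (simp add: has_caputo_derivative_def)
      then show ?thesis using DERIV_isCont continuous_at_imp_continuous_at_within by blast
    qed
  qed
next
  case False
  then have ac: "abs_continuous_upto f t"
    using cap[OF t] by (simp add: has_caputo_derivative_def)
  let ?g = "deriv f"
  have i: "set_integrable lborel {0<..<t} ?g" using ac by (simp add: abs_continuous_upto_def)
  then have "?g integrable_on {0..t}"
    using set_borel_integral_eq_integral(1)[OF i] by (simp add: integrable_on_Icc_iff_Ioo)
  then have c: "continuous_on {0..t} (\<lambda>s. f 0 + integral {0..s} ?g)"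
    by (intro continuous_intros indefinite_integral_continuous_1)
  have eq: "f s = f 0 + integral {0..s} ?g" if "s \<in> {0..t}" for s
  proof -
    have "set_integrable lborel {0<..<s} ?g" by (rule set_integrable_subset[OF i]) (use that in auto)
    then have "(LBINT u:{0<..<s}. ?g u) = integral {0<..<s} ?g" by (rule set_borel_integral_eq_integral(2))
    also have "\<dots> = integral {0..s} ?g" by (simp add: integral_open_interval_real)
    finally have "(LBINT u:{0<..<s}. ?g u) = integral {0..s} ?g" .
    moreover have "f s = f 0 + (LBINT u:{0<..<s}. ?g u)"
      using ac that unfolding abs_continuous_upto_def by blast
    ultimately show ?thesis by simp
  qed
  show ?thesis by (subst continuous_on_cong[OF refl eq]) (use c in auto)
qed

lemma caputo_volterra:
  assumes \<alpha>: "0 < \<alpha>" "\<alpha> \<le> 1" and t: "0 < t"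
    and cap: "\<And>s. 0 < s \<Longrightarrow> has_caputo_derivative \<alpha> f (D s) s"
    and cont: "continuous (at_right 0) f" and D: "continuous_on {0..t} D"
  shows "f t = f 0 + frac_int \<alpha> D t"
proof (cases "\<alpha> = 1")
  case False
  then show ?thesis using abel_inversion[OF _ _ t cap] \<alpha> by auto
next
  case True
  have "(D has_integral f t - f 0) {0..t}"
  proof (rule fundamental_theorem_of_calculus_interior)
    show "continuous_on {0..t} f" by (rule caputo_continuous[OF \<alpha> t cap cont])
    show "(f has_vector_derivative D x) (at x)" if "x \<in> {0<..<t}" for x
      using cap[of x] that True by (simp add: has_caputo_derivative_def has_real_derivative_iff_has_vector_derivative)
  qed (use t in simp)
  then have "(D has_integral f t - f 0) {0<..<t}" by (simp add: has_integral_Icc_iff_Ioo)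
  moreover have i: "set_integrable lborel {0<..<t} D"
  proof (rule set_integrable_subset)
    show "set_integrable lborel {0..t} D"
      unfolding set_integrable_def using borel_integrable_compact[of "{0..t}" D] D by simp
  qed auto
  ultimately have "(LBINT s:{0<..<t}. D s) = f t - f 0"
    using set_borel_integral_eq_integral(2)[OF i] by (simp add: integral_unique)
  moreover have "(LBINT s:{0<..<t}. (t - s) powr (\<alpha> - 1) * D s) = (LBINT s:{0<..<t}. D s)"
    using True by (intro set_lebesgue_integral_cong) auto
  ultimately show ?thesis using True by (simp add: frac_int_def)
qed

section \<open>Series expansion of solutions of the fractional system\<close>

lemma Gamma_lower_bound:
  assumes "0 \<le> (p::real)" "0 < A"
  shows "A powr p * exp (- A) \<le> Gamma (p + 1)"
proof -
  have "((\<lambda>t. exp (- 1 * t)) has_integral exp (- 1 * A) / 1) {A..}"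
    by (rule has_integral_exp_minus_to_infinity) simp
  then have "((\<lambda>t. A powr p * exp (- t)) has_integral A powr p * exp (- A)) {A..}"
    by (intro has_integral_mult_right) simp
  then have "((\<lambda>t. if t \<in> {A..} then A powr p * exp (- t) else 0) has_integral A powr p * exp (- A)) {0..}"
    using assms by (subst has_integral_restrict) auto
  moreover have "((\<lambda>t. t powr (p + 1 - 1) / exp t) has_integral Gamma (p + 1)) {0..}"
    using assms by (intro Gamma_integral_real) auto
  ultimately show ?thesis
  proof (rule has_integral_le)
    fix t :: real assume "t \<in> {0..}"
    then show "(if t \<in> {A..} then A powr p * exp (- t) else 0) \<le> t powr (p + 1 - 1) / exp t"
      using assms by (auto simp: exp_minus divide_inverse intro!: mult_right_mono powr_mono2)
  qed
qed

text \<open>\<open>\<Gamma>(\<alpha> k + 1)\<close> grows faster than every geometric sequence.\<close>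

lemma mittag_leffler_tendsto_0:
  assumes "0 < \<alpha>" "0 < x"
  shows "(\<lambda>k. x ^ k * rGamma (\<alpha> * real k + 1)) \<longlonglongrightarrow> 0"
proof (rule Lim_null_comparison)
  \<comment> \<open>then \<open>\<Gamma>(\<alpha> k + 1) \<ge> e\<^sup>-\<^sup>A A\<^sup>\<alpha>\<^sup>k = e\<^sup>-\<^sup>A (2 x)\<^sup>k\<close>\<close>
  define A where "A = (2 * x) powr (1 / \<alpha>)"
  have A: "A > 0" "A powr \<alpha> = 2 * x" using assms by (auto simp: A_def powr_powr)
  have "norm (x ^ k * rGamma (\<alpha> * real k + 1)) \<le> exp A * (1 / 2) ^ k" for k
  proof -
    have G: "A powr (\<alpha> * real k) * exp (- A) \<le> Gamma (\<alpha> * real k + 1)"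
      using assms A by (intro Gamma_lower_bound) auto
    have "A powr (\<alpha> * real k) = (2 * x) ^ k"
      using A assms by (simp add: powr_powr[symmetric] powr_realpow)
    with G have "(2 * x) ^ k * exp (- A) \<le> Gamma (\<alpha> * real k + 1)" by simp
    then have "inverse (Gamma (\<alpha> * real k + 1)) \<le> inverse ((2 * x) ^ k * exp (- A))"
      using assms by (intro le_imp_inverse_le) auto
    then have "x ^ k * rGamma (\<alpha> * real k + 1) \<le> x ^ k * inverse ((2 * x) ^ k * exp (- A))"
      unfolding rGamma_inverse_Gamma using assms by (intro mult_left_mono) auto
    also have "\<dots> = exp A * (1 / 2) ^ k"
      using assms by (simp add: power_mult_distrib exp_minus field_simps)
    finally have "x ^ k * rGamma (\<alpha> * real k + 1) \<le> exp A * (1 / 2) ^ k" .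
    moreover have "0 < Gamma (\<alpha> * real k + 1)" using assms by (intro Gamma_real_pos) (simp add: add_nonneg_pos)
    ultimately show ?thesis using assms by (simp add: rGamma_inverse_Gamma)
  qed
  then show "\<forall>\<^sub>F k in sequentially. norm (x ^ k * rGamma (\<alpha> * real k + 1)) \<le> exp A * (1 / 2) ^ k" by simp
  show "(\<lambda>k. exp A * (1 / 2) ^ k) \<longlonglongrightarrow> 0"
    by (intro tendsto_mult_right_zero LIMSEQ_realpow_zero) auto
qed

text \<open>The generator of the queue with catastrophes acting on \<open>q\<close>, without the constant inflow \<open>\<xi>\<close> into state 0, which is
  kept separately: in the forward equations the total mass 1 has already been inserted.\<close>

definition queue_gen :: "real \<Rightarrow> real \<Rightarrow> real \<Rightarrow> (nat \<Rightarrow> real) \<Rightarrow> nat \<Rightarrow> real" where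
  "queue_gen lam \<mu> \<xi> q n =
     (if n = 0 then - (lam + \<xi>) * q 0 + \<mu> * q 1
      else - (lam + \<mu> + \<xi>) * q n + lam * q (n - 1) + \<mu> * q (n + 1))"

text \<open>The constant inflow \<open>\<xi>\<close> into state 0.\<close>

definition catastrophe_source :: "real \<Rightarrow> nat \<Rightarrow> real" where
  "catastrophe_source \<xi> n = (if n = 0 then \<xi> else 0)"

text \<open>The Taylor coefficients at 0 (times \<open>k!\<close>) of the solution for \<open>\<alpha> = 1\<close> with initial value \<open>q\<close>. The inflow is constant in time,
  hence enters only the coefficient of index 1.\<close>

primrec queue_coef :: "real \<Rightarrow> real \<Rightarrow> real \<Rightarrow> (nat \<Rightarrow> real) \<Rightarrow> nat \<Rightarrow> nat \<Rightarrow> real" where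
  "queue_coef lam \<mu> \<xi> q 0 = q"
| "queue_coef lam \<mu> \<xi> q (Suc k) =
     (\<lambda>n. queue_gen lam \<mu> \<xi> (queue_coef lam \<mu> \<xi> q k) n + (if k = 0 then catastrophe_source \<xi> n else 0))"

lemma queue_gen_bound:
  assumes "0 \<le> lam" "0 \<le> \<mu>" "0 \<le> \<xi>" and q: "\<And>n. \<bar>q n\<bar> \<le> B"
  shows "\<bar>queue_gen lam \<mu> \<xi> q n\<bar> \<le> 2 * (lam + \<mu> + \<xi>) * B"
proof -
  have B: "0 \<le> B" using q[of 0] by linarith
  have m: "\<bar>c * q k\<bar> \<le> c * B" if "0 \<le> c" for c k
    using that q[of k] by (simp add: abs_mult mult_left_mono)
  show ?thesis
  proof (cases "n = 0")
    case True
    have "\<bar>(lam + \<xi>) * q 0\<bar> \<le> (lam + \<xi>) * B" "\<bar>\<mu> * q 1\<bar> \<le> \<mu> * B"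
      using assms by (auto intro!: m)
    moreover have "0 \<le> (lam + \<mu> + \<xi>) * B" using assms B by simp
    ultimately show ?thesis using True by (simp add: queue_gen_def algebra_simps)
  next
    case False
    have "\<bar>(lam + \<mu> + \<xi>) * q n\<bar> \<le> (lam + \<mu> + \<xi>) * B" "\<bar>\<mu> * q (n + 1)\<bar> \<le> \<mu> * B" "\<bar>lam * q (n - 1)\<bar> \<le> lam * B"
      using assms by (auto intro!: m)
    moreover have "0 \<le> \<xi> * B" using assms B by simp
    ultimately show ?thesis using False by (simp add: queue_gen_def algebra_simps)
  qed
qed

lemma queue_gen_source_bound:
  assumes "0 \<le> lam" "0 \<le> \<mu>" "0 \<le> \<xi>" and q: "\<And>n. \<bar>q n\<bar> \<le> B" and "1 \<le> B"
  shows "\<bar>queue_gen lam \<mu> \<xi> q n + catastrophe_source \<xi> n\<bar> \<le> (2 * (lam + \<mu> + \<xi>) + \<xi>) * B"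
proof -
  have "\<xi> \<le> \<xi> * B" using assms mult_left_mono[of 1 B \<xi>] by simp
  moreover have "0 \<le> \<xi>" by fact
  moreover have "\<bar>queue_gen lam \<mu> \<xi> q n\<bar> \<le> 2 * (lam + \<mu> + \<xi>) * B"
    by (rule queue_gen_bound[OF assms(1-4)])
  moreover have "\<bar>queue_gen lam \<mu> \<xi> q n + catastrophe_source \<xi> n\<bar> \<le> \<bar>queue_gen lam \<mu> \<xi> q n\<bar> + \<xi>"
    using \<open>0 \<le> \<xi>\<close> by (simp add: catastrophe_source_def) linarith
  ultimately show ?thesis by (simp add: distrib_right)
qed

lemma queue_coef_bound:
  assumes "0 \<le> lam" "0 \<le> \<mu>" "0 \<le> \<xi>" and q: "\<And>n. \<bar>q n\<bar> \<le> 1"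
  shows "\<bar>queue_coef lam \<mu> \<xi> q k n\<bar> \<le> (2 * (lam + \<mu> + \<xi>) + \<xi>) ^ k"
proof (induction k arbitrary: n)
  case (Suc k)
  let ?L = "2 * (lam + \<mu> + \<xi>) + \<xi>"
  show ?case
  proof (cases "k = 0")
    case True
    then show ?thesis using queue_gen_source_bound[OF assms(1-3) q, where n = n] by simp
  next
    case False
    have "\<bar>queue_gen lam \<mu> \<xi> (queue_coef lam \<mu> \<xi> q k) n\<bar> \<le> 2 * (lam + \<mu> + \<xi>) * ?L ^ k"
      by (rule queue_gen_bound[OF assms(1-3) Suc.IH])
    also have "\<dots> \<le> ?L * ?L ^ k" using assms by (intro mult_right_mono) auto
    finally show ?thesis using False by simp
  qed
qed (use q in simp)

lemma queue_gen_diff_sum: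
  "queue_gen lam \<mu> \<xi> (\<lambda>m. f m - (\<Sum>k<K. c k m * w k)) n
    = queue_gen lam \<mu> \<xi> f n - (\<Sum>k<(K::nat). queue_gen lam \<mu> \<xi> (c k) n * w k)"
  by (simp add: queue_gen_def algebra_simps sum_distrib_left sum.distrib sum_subtractf sum_negf)

text \<open>The error after \<open>K + 1\<close> terms is the fractional integral of the generator applied to the error after \<open>K\<close> terms (for
  \<open>K = 0\<close> with the inflow added), so the error after \<open>K\<close> terms is at most a constant times \<open>L\<^sup>K t\<^sup>\<alpha>\<^sup>K / \<Gamma>(\<alpha> K + 1)\<close>. In particular the solution is unique.\<close>

theorem caputo_queue_series:
  assumes \<alpha>: "0 < \<alpha>" "\<alpha> \<le> 1" and par: "0 \<le> lam" "0 \<le> \<mu>" "0 \<le> \<xi>"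
    and init: "\<And>n. p n 0 = q n"
    and cont: "\<And>n. continuous (at_right 0) (p n)"
    and cap: "\<And>n t. 0 < t \<Longrightarrow>
        has_caputo_derivative \<alpha> (p n) (queue_gen lam \<mu> \<xi> (\<lambda>m. p m t) n + catastrophe_source \<xi> n) t"
    and bound: "\<And>n t. 0 < t \<Longrightarrow> t \<le> T \<Longrightarrow> \<bar>p n t\<bar> \<le> B"
    and t: "0 < t" "t \<le> T"
  shows "(\<lambda>k. queue_coef lam \<mu> \<xi> q k n * t powr (\<alpha> * real k) * rGamma (\<alpha> * real k + 1)) sums p n t"
proof -
  define c where "c = queue_coef lam \<mu> \<xi> q"
  define w where "w = (\<lambda>k s. s powr (\<alpha> * real k) * rGamma (\<alpha> * real k + 1))"
  define e where "e = (\<lambda>K n s. p n s - (\<Sum>k<K. c k n * w k s))"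
  \<comment> \<open>a bound for the norm of the generator, enlarged by \<open>\<xi>\<close> to absorb the inflow in the first step\<close>
  define L where "L = 2 * (lam + \<mu> + \<xi>) + \<xi>"
  define B' where "B' = max B 1"
  have B': "1 \<le> B'" "\<And>n t. 0 < t \<Longrightarrow> t \<le> T \<Longrightarrow> \<bar>p n t\<bar> \<le> B'"
    using bound by (auto simp: B'_def le_max_iff_disj)
  have L0: "0 \<le> L" using par by (simp add: L_def)
  have w0: "0 \<le> w k s" for k s
  proof -
    have "0 < Gamma (\<alpha> * real k + 1)" using \<alpha> by (intro Gamma_real_pos) (simp add: add_nonneg_pos)
    then show ?thesis by (simp add: w_def rGamma_inverse_Gamma)
  qed
  have w_int: "frac_integrable \<alpha> (w k) s" and w_J: "frac_int \<alpha> (w k) s = w (Suc k) s" if "0 < s" for k s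
  proof -
    have i: "frac_integrable \<alpha> (\<lambda>s. s powr (\<alpha> * real k)) s"
      using \<alpha> that by (intro frac_int_powr) auto
    from frac_int_cmult(1)[OF i, of "rGamma (\<alpha> * real k + 1)"]
    show "frac_integrable \<alpha> (w k) s" by (simp add: w_def mult.commute)
    show "frac_int \<alpha> (w k) s = w (Suc k) s"
      using frac_int_powr(2)[of \<alpha> "\<alpha> * real k" s] \<alpha> that unfolding w_def
      by (simp add: algebra_simps)
  qed
  define D where "D = (\<lambda>n s. queue_gen lam \<mu> \<xi> (\<lambda>m. p m s) n + catastrophe_source \<xi> n)"
  have pc: "continuous_on {0..s} (p n)" if "0 < s" for n s
    by (rule caputo_continuous[OF \<alpha> that cap cont])
  have Dc: "continuous_on {0..s} (D n)" if "0 < s" for n s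
    unfolding D_def queue_gen_def using pc[OF that]
    by (cases "n = 0") (auto intro!: continuous_intros)
  have volt: "p n s = q n + frac_int \<alpha> (D n) s" if "0 < s" for n s
    using caputo_volterra[OF \<alpha> that _ cont Dc[OF that], of n] cap init unfolding D_def by simp
  have err: "\<bar>e K n s\<bar> \<le> B' * L ^ K * w K s" if "0 < s" "s \<le> T" for K n s
    using that
  proof (induction K arbitrary: n s)
    case 0
    then show ?case using B' by (simp add: e_def w_def)
  next
    case (Suc K)
    define \<psi> where "\<psi> = (\<lambda>s. D n s - (\<Sum>k<K. c (Suc k) n * w k s))"
    have iD: "frac_integrable \<alpha> (D n) s" by (rule frac_integrable_continuous[OF \<alpha>(1) Suc.prems(1) Dc[OF Suc.prems(1)]])
    have ik: "frac_integrable \<alpha> (\<lambda>s. c (Suc k) n * w k s) s" for k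
      by (rule frac_int_cmult(1)[OF w_int[OF Suc.prems(1)]])
    note sum = frac_int_sum[of K \<alpha> "\<lambda>k s. c (Suc k) n * w k s" s, OF ik]
    have \<psi>i: "frac_integrable \<alpha> \<psi> s"
      unfolding \<psi>_def by (rule frac_int_diff(1)[OF iD conjunct1[OF sum]])
    have "frac_int \<alpha> \<psi> s = frac_int \<alpha> (D n) s - (\<Sum>k<K. c (Suc k) n * w (Suc k) s)"
      unfolding \<psi>_def frac_int_diff(2)[OF iD conjunct1[OF sum]] conjunct2[OF sum]
      using frac_int_cmult(2)[OF w_int[OF Suc.prems(1)]] w_J[OF Suc.prems(1)] by simp
    moreover have "w 0 s = 1" using Suc.prems by (simp add: w_def)
    moreover have "c 0 n = q n" by (simp add: c_def)
    ultimately have e\<psi>: "e (Suc K) n s = frac_int \<alpha> \<psi> s"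
      unfolding e_def sum.lessThan_Suc_shift volt[OF Suc.prems(1)] by simp
    have \<psi>b: "\<bar>\<psi> r\<bar> \<le> (B' * L ^ Suc K) * w K r" if r: "0 < r" "r < s" for r
    proof -
      have rT: "r \<le> T" using r Suc.prems by simp
      show ?thesis
      proof (cases "K = 0")
        case True
        have "\<bar>D n r\<bar> \<le> L * B'"
          unfolding D_def L_def by (rule queue_gen_source_bound[OF par B'(2)[OF r(1) rT] B'(1)])
        then show ?thesis using True r by (simp add: \<psi>_def w_def mult.commute)
      next
        case False
        \<comment> \<open>for \<open>K > 0\<close> the inflow is cancelled by the coefficient of index 1\<close>
        have "(\<Sum>k<K. c (Suc k) n * w k r) = (\<Sum>k<K. queue_gen lam \<mu> \<xi> (c k) n * w k r + (if k = 0 then catastrophe_source \<xi> n else 0))"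
          using r by (intro sum.cong refl) (auto simp: c_def algebra_simps w_def)
        also have "\<dots> = (\<Sum>k<K. queue_gen lam \<mu> \<xi> (c k) n * w k r) + catastrophe_source \<xi> n"
          using False by (simp add: sum.distrib sum.delta)
        finally have "\<psi> r = queue_gen lam \<mu> \<xi> (\<lambda>m. e K m r) n"
          by (simp add: \<psi>_def D_def e_def queue_gen_diff_sum)
        then have "\<bar>\<psi> r\<bar> \<le> 2 * (lam + \<mu> + \<xi>) * (B' * L ^ K * w K r)"
          using queue_gen_bound[OF par Suc.IH[OF r(1) rT]] by simp
        also have "\<dots> \<le> L * (B' * L ^ K * w K r)"
          using par B' L0 w0 by (intro mult_right_mono) (auto simp: L_def)
        finally show ?thesis by (simp add: mult_ac)
      qed
    qed
    have "\<bar>frac_int \<alpha> \<psi> s\<bar> \<le> frac_int \<alpha> (\<lambda>r. (B' * L ^ Suc K) * w K r) s"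
      by (rule frac_int_abs_le[OF \<alpha>(1) \<psi>i frac_int_cmult(1)[OF w_int[OF Suc.prems(1)]] \<psi>b])
    then show ?case
      unfolding e\<psi> frac_int_cmult(2)[OF w_int[OF Suc.prems(1)]] w_J[OF Suc.prems(1)] .
  qed
  have "(\<lambda>K. p n t - (\<Sum>k<K. c k n * w k t)) \<longlonglongrightarrow> 0"
  proof (rule Lim_null_comparison)
    show "\<forall>\<^sub>F K in sequentially. norm (p n t - (\<Sum>k<K. c k n * w k t)) \<le> B' * (((L + 1) * t powr \<alpha>) ^ K * rGamma (\<alpha> * real K + 1))"
    proof (rule always_eventually, rule allI)
      fix K
      have "\<bar>e K n t\<bar> \<le> B' * L ^ K * w K t" by (rule err[OF t])
      also have "\<dots> \<le> B' * (L + 1) ^ K * w K t"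
        using B' L0 w0 by (intro mult_right_mono mult_left_mono power_mono) auto
      also have "w K t = (t powr \<alpha>) ^ K * rGamma (\<alpha> * real K + 1)"
        using t by (simp add: w_def powr_realpow[symmetric] powr_powr)
      finally show "norm (p n t - (\<Sum>k<K. c k n * w k t)) \<le> B' * (((L + 1) * t powr \<alpha>) ^ K * rGamma (\<alpha> * real K + 1))"
        by (simp add: e_def power_mult_distrib mult_ac)
    qed
    show "(\<lambda>K. B' * (((L + 1) * t powr \<alpha>) ^ K * rGamma (\<alpha> * real K + 1))) \<longlonglongrightarrow> 0"
      using L0 t \<alpha> by (intro tendsto_mult_right_zero mittag_leffler_tendsto_0) auto
  qed
  from tendsto_diff[OF tendsto_const[of "p n t"] this]
  have "(\<lambda>k. c k n * w k t) sums p n t" by (simp add: sums_def)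
  then show ?thesis by (simp add: c_def w_def mult.assoc)
qed

section \<open>Weighted walks on the integers and Bessel functions\<close>

lemma egf_summable:
  assumes "\<And>N. \<bar>c N\<bar> \<le> (K::real) ^ N"
  shows "summable (\<lambda>N. c N * y ^ N / fact N)"
proof (rule summable_comparison_test)
  have "norm (c N * y ^ N / fact N) \<le> (K * \<bar>y\<bar>) ^ N /\<^sub>R fact N" for N
    using assms[of N] by (simp add: abs_mult power_abs power_mult_distrib divide_inverse mult_ac mult_left_mono mult_right_mono)
  then show "\<exists>N0. \<forall>N\<ge>N0. norm (c N * y ^ N / fact N) \<le> (K * \<bar>y\<bar>) ^ N /\<^sub>R fact N" by blast
  show "summable (\<lambda>N. (K * \<bar>y\<bar>) ^ N /\<^sub>R fact N)" by (rule summable_exp_generic)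
qed

lemma egf_DERIV:
  assumes "\<And>N. \<bar>c N\<bar> \<le> (K::real) ^ N"
  shows "((\<lambda>y. \<Sum>N. c N * y ^ N / fact N) has_real_derivative (\<Sum>N. c (Suc N) * y ^ N / fact N)) (at y)"
proof -
  let ?d = "\<lambda>N. c N / fact N"
  have "summable (\<lambda>N. ?d N * x ^ N)" for x
    using egf_summable[OF assms, of x] by (simp add: mult_ac)
  from termdiffs_strong_converges_everywhere[OF this]
  have "((\<lambda>y. \<Sum>N. ?d N * y ^ N) has_real_derivative (\<Sum>N. diffs ?d N * y ^ N)) (at y)" .
  moreover have "diffs ?d N = c (Suc N) / fact N" for N
    by (simp add: diffs_def del: of_nat_Suc)
  ultimately show ?thesis by (simp add: mult_ac)
qed

context
  fixes lam \<mu> :: real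
  assumes lam: "0 < lam" and mu: "0 < \<mu>"
begin

text \<open>The total weight of the walks of length \<open>N\<close> from 0 to \<open>k\<close> on the integers, with weight \<open>\<lambda>\<close> for a step up and
  \<open>\<mu>\<close> for a step down.\<close>

primrec walk :: "nat \<Rightarrow> int \<Rightarrow> real" where
  "walk 0 = (\<lambda>k. if k = 0 then 1 else 0)"
| "walk (Suc N) = (\<lambda>k. lam * walk N (k - 1) + \<mu> * walk N (k + 1))"

lemma walk_nonneg: "0 \<le> walk N k"
  using lam mu by (induction N arbitrary: k) auto

lemma walk_sum_le: "finite A \<Longrightarrow> (\<Sum>k\<in>A. walk N k) \<le> (lam + \<mu>) ^ N"
proof (induction N arbitrary: A)
  case 0
  then show ?case by (simp add: sum.delta')
next
  case (Suc N)
  have "(\<Sum>k\<in>A. walk (Suc N) k) = lam * (\<Sum>k\<in>A. walk N (k - 1)) + \<mu> * (\<Sum>k\<in>A. walk N (k + 1))"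
    by (simp add: sum.distrib sum_distrib_left)
  also have "(\<Sum>k\<in>A. walk N (k - 1)) = (\<Sum>k\<in>(\<lambda>k. k - 1) ` A. walk N k)"
    by (subst sum.reindex) (auto simp: inj_on_def)
  also have "(\<Sum>k\<in>A. walk N (k + 1)) = (\<Sum>k\<in>(\<lambda>k. k + 1) ` A. walk N k)"
    by (subst sum.reindex) (auto simp: inj_on_def)
  also have "lam * (\<Sum>k\<in>(\<lambda>k. k - 1) ` A. walk N k) + \<mu> * (\<Sum>k\<in>(\<lambda>k. k + 1) ` A. walk N k)
     \<le> lam * (lam + \<mu>) ^ N + \<mu> * (lam + \<mu>) ^ N"
    using lam mu Suc by (intro add_mono mult_left_mono Suc.IH) auto
  finally show ?case by (simp add: algebra_simps)
qed

lemma walk_abs_le: "\<bar>walk N k\<bar> \<le> (lam + \<mu>) ^ N"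
  using walk_sum_le[of "{k}" N] walk_nonneg[of N k] by simp

text \<open>Reversing all steps multiplies the weight of a walk from 0 to \<open>k\<close> by \<open>(\<mu>/\<lambda>)\<^sup>k\<close>.\<close>

lemma walk_symmetric: "walk N k = (lam / \<mu>) powi k * walk N (- k)"
proof (induction N arbitrary: k)
  case (Suc N)
  have r: "lam / \<mu> \<noteq> 0" using lam mu by simp
  have e: "- (k - 1) = - k + 1" "- (k + 1) = - k - 1" by simp_all
  have "walk (Suc N) k = lam * ((lam / \<mu>) powi (k - 1) * walk N (- k + 1)) + \<mu> * ((lam / \<mu>) powi (k + 1) * walk N (- k - 1))"
    using Suc.IH[of "k - 1", unfolded e] Suc.IH[of "k + 1", unfolded e] by simp
  also have "(lam / \<mu>) powi (k - 1) = (lam / \<mu>) powi k * (\<mu> / lam)"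
    using r lam mu by (simp add: power_int_diff)
  also have "(lam / \<mu>) powi (k + 1) = (lam / \<mu>) powi k * (lam / \<mu>)"
    using r lam mu by (simp add: power_int_add)
  finally show ?case using lam mu by (simp add: distrib_left mult_ac add_ac)
qed simp

text \<open>The walk-weight form of the Bessel recurrence \<open>I\<^sub>k\<^sub>-\<^sub>1(z) - I\<^sub>k\<^sub>+\<^sub>1(z) = (2 k / z) I\<^sub>k(z)\<close>.\<close>

lemma walk_index: "real_of_int k * walk (Suc N) k = real (Suc N) * (lam * walk N (k - 1) - \<mu> * walk N (k + 1))"
proof (induction N arbitrary: k)
  case 0
  then show ?case by (cases "k = - 1") auto
next
  case (Suc N)
  have e: "k - 1 - 1 = k - 2" "k - 1 + 1 = k" "k + 1 - 1 = k" "k + 1 + 1 = k + 2" by simp_all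
  have w: "walk (Suc N) (k - 1) = lam * walk N (k - 2) + \<mu> * walk N k"
    "walk (Suc N) (k + 1) = lam * walk N k + \<mu> * walk N (k + 2)"
    unfolding walk.simps(2) e by (rule refl)+
  have "real_of_int k * walk (Suc (Suc N)) k =
      lam * (real_of_int (k - 1) * walk (Suc N) (k - 1)) + lam * walk (Suc N) (k - 1)
      + \<mu> * (real_of_int (k + 1) * walk (Suc N) (k + 1)) - \<mu> * walk (Suc N) (k + 1)"
    unfolding walk.simps(2)[of "Suc N"] by (simp add: algebra_simps del: walk.simps)
  also have "\<dots> = lam * (real (Suc N) * (lam * walk N (k - 2) - \<mu> * walk N k)) + lam * walk (Suc N) (k - 1)
      + \<mu> * (real (Suc N) * (lam * walk N k - \<mu> * walk N (k + 2))) - \<mu> * walk (Suc N) (k + 1)"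
    unfolding Suc.IH e ..
  also have "\<dots> = real (Suc (Suc N)) * (lam * walk (Suc N) (k - 1) - \<mu> * walk (Suc N) (k + 1))"
    unfolding w by (simp add: algebra_simps del: walk.simps)
  finally show ?case .
qed

lemma walk_explicit:
  "walk N (int N - 2 * int m) = real (N choose m) * lam ^ (N - m) * \<mu> ^ m"
  and walk_eq_0: "(\<And>m. k \<noteq> int N - 2 * int m) \<Longrightarrow> walk N k = 0"
proof (induction N arbitrary: m k)
  case 0
  { case 1 show ?case by (cases m) auto }
  { case 2 show ?case using 2[of 0] by auto }
next
  case (Suc N)
  { case 1
    have "walk (Suc N) (int (Suc N) - 2 * int m) = lam * walk N (int N - 2 * int m) + \<mu> * walk N (int N + 2 - 2 * int m)"
      by (simp add: algebra_simps)
    also have "\<dots> = real (Suc N choose m) * lam ^ (Suc N - m) * \<mu> ^ m"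
    proof (cases m)
      case 0
      have "walk N (int N + 2 - 2 * int m) = 0" using 0 by (intro Suc.IH(2)) auto
      then show ?thesis using 0 Suc.IH(1)[of 0] by simp
    next
      case (Suc m')
      have "walk N (int N + 2 - 2 * int m) = real (N choose m') * lam ^ (N - m') * \<mu> ^ m'"
        using Suc.IH(1)[of m'] Suc by simp
      moreover have "real (N choose m) * lam * lam ^ (N - m) = real (N choose m) * lam ^ (N - m')"
      proof (cases "m \<le> N")
        case True
        then have "N - m' = Suc (N - m)" using \<open>m = Suc m'\<close> by simp
        then show ?thesis by simp
      qed (simp add: binomial_eq_0)
      ultimately show ?thesis using Suc.IH(1)[of m] Suc by (simp add: algebra_simps)
    qed
    finally show ?case . }
  { case 2
    have "walk N (k - 1) = 0"
    proof (rule Suc.IH(2))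
      fix m show "k - 1 \<noteq> int N - 2 * int m" using 2[of m] by auto
    qed
    moreover have "walk N (k + 1) = 0"
    proof (rule Suc.IH(2))
      fix m show "k + 1 \<noteq> int N - 2 * int m" using 2[of "Suc m"] by auto
    qed
    ultimately show ?case by simp }
qed

text \<open>The exponential generating function of the walk weights. Multiplied by \<open>exp (- (\<lambda> + \<mu>) y)\<close> it is the transition
  function of the continuous-time random walk on the integers.\<close>

definition walk_egf :: "int \<Rightarrow> real \<Rightarrow> real" where
  "walk_egf k y = (\<Sum>N. walk N k * y ^ N / fact N)"

lemma walk_egf_sums: "(\<lambda>N. walk N k * y ^ N / fact N) sums walk_egf k y"
  unfolding walk_egf_def by (rule summable_sums[OF egf_summable[OF walk_abs_le]])

lemma walk_egf_DERIV:
  "(walk_egf k has_real_derivative lam * walk_egf (k - 1) y + \<mu> * walk_egf (k + 1) y) (at y)"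
proof -
  have "((\<lambda>y. \<Sum>N. walk N k * y ^ N / fact N) has_real_derivative (\<Sum>N. walk (Suc N) k * y ^ N / fact N)) (at y)"
    by (rule egf_DERIV[OF walk_abs_le])
  moreover have "(\<lambda>N. lam * (walk N (k - 1) * y ^ N / fact N) + \<mu> * (walk N (k + 1) * y ^ N / fact N)) sums
      (lam * walk_egf (k - 1) y + \<mu> * walk_egf (k + 1) y)"
    by (intro sums_add sums_mult walk_egf_sums)
  then have "(\<Sum>N. walk (Suc N) k * y ^ N / fact N) = lam * walk_egf (k - 1) y + \<mu> * walk_egf (k + 1) y"
    by (simp add: sums_iff field_simps)
  ultimately show ?thesis by (simp add: walk_egf_def[abs_def])
qed

lemma walk_egf_index: "real_of_int k * walk_egf k y = y * (lam * walk_egf (k - 1) y - \<mu> * walk_egf (k + 1) y)"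
proof -
  have s1: "(\<lambda>N. y * (lam * (walk N (k - 1) * y ^ N / fact N) - \<mu> * (walk N (k + 1) * y ^ N / fact N))) sums
      (y * (lam * walk_egf (k - 1) y - \<mu> * walk_egf (k + 1) y))"
    by (intro sums_diff sums_mult walk_egf_sums)
  have eq: "y * (lam * (walk N (k - 1) * y ^ N / fact N) - \<mu> * (walk N (k + 1) * y ^ N / fact N)) =
      real_of_int k * (walk (Suc N) k * y ^ Suc N / fact (Suc N))" for N
  proof -
    have "real_of_int k * (walk (Suc N) k * y ^ Suc N / fact (Suc N)) =
        (real_of_int k * walk (Suc N) k) * y ^ Suc N / (real (Suc N) * fact N)" by simp
    also have "\<dots> = y * (lam * (walk N (k - 1) * y ^ N / fact N) - \<mu> * (walk N (k + 1) * y ^ N / fact N))"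
      unfolding walk_index by (simp add: field_simps del: of_nat_Suc)
    finally show ?thesis by simp
  qed
  have s2: "(\<lambda>N. real_of_int k * (walk (Suc N) k * y ^ Suc N / fact (Suc N))) sums
      (real_of_int k * walk_egf k y)"
  proof -
    have "real_of_int k * walk 0 k = 0" by simp
    moreover have "(\<lambda>N. real_of_int k * (walk N k * y ^ N / fact N)) sums (real_of_int k * walk_egf k y)"
      by (intro sums_mult walk_egf_sums)
    ultimately show ?thesis by (subst sums_Suc_iff) auto
  qed
  show ?thesis by (rule sums_unique2[OF s2 s1[unfolded eq]])
qed

lemma walk_egf_symmetric: "walk_egf k y = (lam / \<mu>) powi k * walk_egf (- k) y"
proof -
  have "(\<lambda>N. (lam / \<mu>) powi k * (walk N (- k) * y ^ N / fact N)) sums ((lam / \<mu>) powi k * walk_egf (- k) y)"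
    by (intro sums_mult walk_egf_sums)
  moreover have "(lam / \<mu>) powi k * (walk N (- k) * y ^ N / fact N) = walk N k * y ^ N / fact N" for N
    using walk_symmetric[of N k] by simp
  ultimately show ?thesis using walk_egf_sums[of k y] by (metis (no_types, lifting) sums_cong sums_unique2)
qed

lemma walk_egf_0: "walk_egf k 0 = (if k = 0 then 1 else 0)"
  unfolding walk_egf_def using powser_zero[of "\<lambda>N. walk N k / fact N"] by (simp add: mult_ac)

lemma walk_egf_nonneg: "0 \<le> y \<Longrightarrow> 0 \<le> walk_egf k y"
  unfolding walk_egf_def by (intro suminf_nonneg egf_summable[OF walk_abs_le] divide_nonneg_pos mult_nonneg_nonneg walk_nonneg) auto

lemma walk_egf_abs_le: assumes "\<bar>y\<bar> \<le> Y" shows "\<bar>walk_egf k y\<bar> \<le> walk_egf k Y"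
proof -
  have "\<bar>walk_egf k y\<bar> \<le> (\<Sum>N. walk N k * Y ^ N / fact N)"
    unfolding walk_egf_def real_norm_def[symmetric]
  proof (rule norm_suminf_le)
    fix N
    have "\<bar>y\<bar> ^ N \<le> Y ^ N" using assms by (intro power_mono) auto
    then show "norm (walk N k * y ^ N / fact N) \<le> walk N k * Y ^ N / fact N"
      using walk_nonneg[of N k] by (simp add: abs_mult power_abs divide_right_mono mult_left_mono)
  qed (rule egf_summable[OF walk_abs_le])
  then show ?thesis by (simp add: walk_egf_def)
qed

lemma walk_egf_sum_le:
  assumes "finite A" "0 \<le> y"
  shows "(\<Sum>k\<in>A. walk_egf k y) \<le> exp ((lam + \<mu>) * y)"
proof -
  have "(\<lambda>N. \<Sum>k\<in>A. walk N k * y ^ N / fact N) sums (\<Sum>k\<in>A. walk_egf k y)"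
    by (intro sums_sum walk_egf_sums)
  moreover have "(\<lambda>N. ((lam + \<mu>) * y) ^ N /\<^sub>R fact N) sums exp ((lam + \<mu>) * y)"
    by (rule exp_converges)
  moreover have "(\<Sum>k\<in>A. walk N k * y ^ N / fact N) \<le> ((lam + \<mu>) * y) ^ N /\<^sub>R fact N" for N
  proof -
    have "(\<Sum>k\<in>A. walk N k * y ^ N / fact N) = (\<Sum>k\<in>A. walk N k) * (y ^ N / fact N)"
      unfolding sum_distrib_right by simp
    also have "\<dots> \<le> (lam + \<mu>) ^ N * (y ^ N / fact N)"
      using assms walk_sum_le[OF assms(1)] by (intro mult_right_mono) auto
    finally show ?thesis by (simp add: power_mult_distrib divide_inverse mult_ac)
  qed
  ultimately show ?thesis by (rule sums_le[rotated])
qed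

lemma walk_egf_summable:
  assumes "inj h" "0 \<le> y"
  shows "summable (\<lambda>m. walk_egf (h m) y)" "(\<Sum>m::nat. walk_egf (h m) y) \<le> exp ((lam + \<mu>) * y)"
proof -
  have b: "(\<Sum>m<n. walk_egf (h m) y) \<le> exp ((lam + \<mu>) * y)" for n
    using walk_egf_sum_le[of "h ` {..<n}" y] assms by (simp add: sum.reindex inj_on_subset)
  show s: "summable (\<lambda>m. walk_egf (h m) y)"
    by (rule summableI_nonneg_bounded[OF walk_egf_nonneg[OF assms(2)] b])
  show "(\<Sum>m::nat. walk_egf (h m) y) \<le> exp ((lam + \<mu>) * y)"
    by (rule suminf_le_const[OF s b])
qed

text \<open>The first \<open>j\<close> terms of the series on the left vanish because \<open>1/\<Gamma>\<close> has zeros at the nonpositive integers.\<close>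

lemma bessel_I_minus_nat: "bessel_I (- real j) z = bessel_I (real j) z"
proof -
  let ?f = "\<lambda>m. rGamma (real m + - real j + 1) / fact m * (z / 2) powr (2 * real m + - real j)"
  have "(\<Sum>m. ?f (m + j)) = (\<Sum>m. ?f m)"
  proof (rule suminf_mono_reindex)
    show "strict_mono (\<lambda>m. m + j)" by (auto simp: strict_mono_def)
    fix m assume "m \<notin> range (\<lambda>m. m + j)"
    then have "m < j" by (metis le_add_diff_inverse2 linorder_not_less rangeI)
    then have "real m + - real j + 1 = - real (j - m - 1)" by (simp add: of_nat_diff)
    also have "\<dots> \<in> \<int>\<^sub>\<le>\<^sub>0" by simp
    finally show "?f m = 0" by (simp add: rGamma_eq_zero_iff del: of_nat_diff)
  qed
  moreover have "?f (m + j) = rGamma (real m + real j + 1) / fact m * (z / 2) powr (2 * real m + real j)" for m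
  proof -
    have G: "rGamma (real n + 1) = inverse (fact n)" for n
      using Gamma_fact[of n, where 'a = real] by (simp add: rGamma_inverse_Gamma add.commute)
    have "rGamma (real (m + j) + - real j + 1) = inverse (fact m)" using G[of m] by simp
    moreover have "rGamma (real m + real j + 1) = inverse (fact (m + j))" using G[of "m + j"] by simp
    moreover have "2 * real (m + j) + - real j = 2 * real m + real j" by simp
    ultimately show ?thesis by (simp only: divide_inverse mult_ac)
  qed
  ultimately show ?thesis unfolding bessel_I_def by simp
qed

lemma bessel_I_walk_nat:
  assumes y: "0 < y"
  shows "sqrt (lam / \<mu>) ^ j * bessel_I (real j) (2 * sqrt (lam * \<mu>) * y) = walk_egf (int j) y"
proof -
  let ?\<rho> = "sqrt (lam / \<mu>)" and ?s = "sqrt (lam * \<mu>)"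
  let ?f = "\<lambda>N. walk N (int j) * y ^ N / fact N"
  have \<rho>s: "?\<rho> * ?s = lam" using lam mu by (simp add: real_sqrt_mult[symmetric] power2_eq_square[symmetric])
  have s2: "?s ^ 2 = lam * \<mu>" using lam mu by simp
  have sm: "strict_mono (\<lambda>m. 2 * m + j)" by (auto simp: strict_mono_def)
  have zero: "?f N = 0" if N: "N \<notin> range (\<lambda>m. 2 * m + j)" for N
  proof -
    have "walk N (int j) = 0"
    proof (rule walk_eq_0)
      fix m show "int j \<noteq> int N - 2 * int m"
      proof
        assume "int j = int N - 2 * int m"
        then have "N = 2 * m + j" by linarith
        with N show False by auto
      qed
    qed
    then show ?thesis by simp
  qed
  have bterm: "?f (2 * m + j) = ?\<rho> ^ j * (rGamma (real m + real j + 1) / fact m * (2 * ?s * y / 2) powr (2 * real m + real j))" for m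
  proof -
    have e: "int (2 * m + j) - 2 * int m = int j" "2 * m + j - m = m + j" by simp_all
    have w: "walk (2 * m + j) (int j) = real (2 * m + j choose m) * lam ^ (m + j) * \<mu> ^ m"
      using walk_explicit[of "2 * m + j" m] unfolding e .
    have b: "real (2 * m + j choose m) = fact (2 * m + j) / (fact m * fact (m + j))"
      using binomial_fact[of m "2 * m + j", where 'a = real] unfolding e by simp
    have G: "rGamma (real m + real j + 1) = inverse (fact (m + j))"
      using Gamma_fact[of "m + j", where 'a = real] by (simp add: rGamma_inverse_Gamma add_ac)
    have "(2 * ?s * y / 2) powr (2 * real m + real j) = (?s * y) ^ (2 * m + j)"
      using lam mu y powr_realpow[of "?s * y" "2 * m + j"] by simp
    also have "\<dots> = (lam * \<mu>) ^ m * ?s ^ j * y ^ (2 * m + j)"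
      by (simp add: power_mult_distrib power_add power_mult s2)
    finally have p0: "(2 * ?s * y / 2) powr (2 * real m + real j) = (lam * \<mu>) ^ m * ?s ^ j * y ^ (2 * m + j)" .
    have "?\<rho> ^ j * ((lam * \<mu>) ^ m * ?s ^ j * y ^ (2 * m + j)) = (?\<rho> * ?s) ^ j * (lam * \<mu>) ^ m * y ^ (2 * m + j)"
      by (simp only: power_mult_distrib mult_ac)
    also have "\<dots> = lam ^ (m + j) * \<mu> ^ m * y ^ (2 * m + j)"
      unfolding \<rho>s by (simp only: power_mult_distrib power_add mult_ac)
    finally have p: "?\<rho> ^ j * (2 * ?s * y / 2) powr (2 * real m + real j) = lam ^ (m + j) * \<mu> ^ m * y ^ (2 * m + j)"
      unfolding p0 .
    have "?\<rho> ^ j * (rGamma (real m + real j + 1) / fact m * (2 * ?s * y / 2) powr (2 * real m + real j)) =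
       rGamma (real m + real j + 1) / fact m * (?\<rho> ^ j * (2 * ?s * y / 2) powr (2 * real m + real j))"
      by (simp only: mult_ac)
    also have "\<dots> = ?f (2 * m + j)" unfolding p w b G by (simp add: field_simps)
    finally show ?thesis by simp
  qed
  let ?b = "\<lambda>m. rGamma (real m + real j + 1) / fact m * (2 * ?s * y / 2) powr (2 * real m + real j)"
  have \<rho>0: "?\<rho> ^ j \<noteq> 0" using lam mu by simp
  have "(\<lambda>m. ?f (2 * m + j)) sums walk_egf (int j) y"
    using sums_mono_reindex[of "\<lambda>m. 2 * m + j" ?f, OF sm zero] walk_egf_sums[of "int j" y] by blast
  then have "(\<lambda>m. ?\<rho> ^ j * ?b m) sums walk_egf (int j) y" unfolding bterm .
  then have "(\<lambda>m. inverse (?\<rho> ^ j) * (?\<rho> ^ j * ?b m)) sums (inverse (?\<rho> ^ j) * walk_egf (int j) y)"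
    by (rule sums_mult)
  then have "?b sums (inverse (?\<rho> ^ j) * walk_egf (int j) y)"
    unfolding mult.assoc[symmetric] left_inverse[OF \<rho>0] mult_1_left .
  then have "bessel_I (real j) (2 * ?s * y) = inverse (?\<rho> ^ j) * walk_egf (int j) y"
    unfolding bessel_I_def by (rule sums_unique[symmetric])
  then show ?thesis using \<rho>0 by (simp add: field_simps del: real_sqrt_divide)
qed

text \<open>The Bessel functions of the theorem, with their powers of \<open>\<rho>\<close>, are the generating functions of the walks.\<close>

lemma bessel_I_walk:
  assumes y: "0 < y"
  shows "sqrt (lam / \<mu>) powi k * bessel_I (real_of_int k) (2 * sqrt (lam * \<mu>) * y) = walk_egf k y"
proof (cases "0 \<le> k")
  case True
  then obtain j where "k = int j" by (metis nonneg_int_cases)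
  then show ?thesis using bessel_I_walk_nat[OF y, of j] by simp
next
  case False
  then obtain j where k: "k = - int j" by (metis int_cases2 of_nat_0_le_iff)
  let ?\<rho> = "sqrt (lam / \<mu>)"
  have \<rho>: "?\<rho> > 0" using lam mu by simp
  have inv: "inverse x * (x * b) = b" if "x \<noteq> 0" for x b :: real using that by simp
  have "walk_egf k y = (lam / \<mu>) powi k * walk_egf (int j) y"
    using walk_egf_symmetric[of k y] k by simp
  also have "lam / \<mu> = ?\<rho> ^ 2" using lam mu by simp
  also have "(?\<rho> ^ 2) powi k * walk_egf (int j) y = ?\<rho> powi k * (inverse (?\<rho> ^ j) * walk_egf (int j) y)"
    unfolding k by (simp only: power_int_minus power_int_of_nat power2_eq_square power_mult_distrib inverse_mult_distrib mult.assoc)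
  also have "inverse (?\<rho> ^ j) * walk_egf (int j) y = bessel_I (real j) (2 * sqrt (lam * \<mu>) * y)"
    unfolding bessel_I_walk_nat[OF y, symmetric] by (rule inv) (use lam mu in simp)
  finally show ?thesis using k bessel_I_minus_nat[of j] by simp
qed

lemma bessel_I_div_walk:
  assumes "0 < y"
  shows "bessel_I (real j) (2 * sqrt (lam * \<mu>) * y) / sqrt (lam / \<mu>) ^ j = walk_egf (- int j) y"
  using bessel_I_walk[OF assms, of "- int j"] bessel_I_minus_nat[of j]
  by (simp add: power_int_minus divide_inverse mult.commute)


text \<open>The sum of the generating functions over all end points at most \<open>- j\<close>.\<close>

definition walk_tail :: "int \<Rightarrow> real \<Rightarrow> real" where
  "walk_tail j y = (\<Sum>m. walk_egf (- (j + int m)) y)"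

lemma walk_tail_summable: "summable (\<lambda>m. walk_egf (- (j + int m)) y)"
proof (rule summable_comparison_test)
  show "\<exists>N. \<forall>m\<ge>N. norm (walk_egf (- (j + int m)) y) \<le> walk_egf (- (j + int m)) \<bar>y\<bar>"
    using walk_egf_abs_le[of y "\<bar>y\<bar>"] by auto
  show "summable (\<lambda>m. walk_egf (- (j + int m)) \<bar>y\<bar>)"
    by (rule walk_egf_summable) (auto simp: inj_def)
qed

lemma walk_tail_sums: "(\<lambda>m. walk_egf (- (j + int m)) y) sums walk_tail j y"
  unfolding walk_tail_def by (rule summable_sums[OF walk_tail_summable])

lemma walk_tail_Suc: "walk_tail j y = walk_egf (- j) y + walk_tail (j + 1) y"
proof -
  have e: "- (j + int (Suc m)) = - (j + 1 + int m)" for m by simp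
  have "(\<lambda>m. walk_egf (- (j + int (Suc m))) y) sums (walk_tail j y - walk_egf (- (j + int 0)) y)"
    using walk_tail_sums[of j y] by (subst sums_Suc_iff) simp
  from sums_unique2[OF walk_tail_sums this[unfolded e]] show ?thesis by simp
qed

lemma walk_tail_nonneg: "0 \<le> y \<Longrightarrow> 0 \<le> walk_tail j y"
  unfolding walk_tail_def by (intro suminf_nonneg walk_tail_summable walk_egf_nonneg)

lemma walk_tail_le: "0 \<le> y \<Longrightarrow> walk_tail j y \<le> exp ((lam + \<mu>) * y)"
  unfolding walk_tail_def by (rule walk_egf_summable) (auto simp: inj_def)

lemma walk_tail_0: "0 < j \<Longrightarrow> walk_tail j 0 = 0"
  unfolding walk_tail_def by (simp add: walk_egf_0)

lemma walk_tail_DERIV: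
  "(walk_tail j has_real_derivative lam * walk_tail (j + 1) y + \<mu> * walk_tail (j - 1) y) (at y)"
proof -
  \<comment> \<open>termwise differentiation on \<open>[-Y, Y]\<close>, dominated by the values at \<open>Y\<close>\<close>
  define Y where "Y = \<bar>y\<bar> + 1"
  let ?f = "\<lambda>m y. walk_egf (- (j + int m)) y"
  let ?f' = "\<lambda>m y. lam * walk_egf (- (j + int m) - 1) y + \<mu> * walk_egf (- (j + int m) + 1) y"
  have e: "- (j + int m) - 1 = - (j + 1 + int m)" "- (j + int m) + 1 = - (j - 1 + int m)" for m by simp_all
  have s': "(\<lambda>m. ?f' m x) sums (lam * walk_tail (j + 1) x + \<mu> * walk_tail (j - 1) x)" for x
    unfolding e by (intro sums_add sums_mult walk_tail_sums)
  have uc: "uniformly_convergent_on {-Y..Y} (\<lambda>n x. \<Sum>m<n. ?f' m x)"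
  proof (rule Weierstrass_m_test')
    fix m x assume "x \<in> {-Y..Y}"
    then have x: "\<bar>x\<bar> \<le> Y" by auto
    have "norm (?f' m x) \<le> lam * \<bar>walk_egf (- (j + int m) - 1) x\<bar> + \<mu> * \<bar>walk_egf (- (j + int m) + 1) x\<bar>"
      using lam mu by (intro order_trans[OF norm_triangle_ineq]) (simp add: abs_mult)
    also have "\<dots> \<le> ?f' m Y"
      using lam mu walk_egf_abs_le[OF x] by (intro add_mono mult_left_mono) auto
    finally show "norm (?f' m x) \<le> ?f' m Y" .
  next
    show "summable (\<lambda>m. ?f' m Y)" by (rule sums_summable[OF s'])
  qed
  have "((\<lambda>y. \<Sum>m. ?f m y) has_real_derivative (\<Sum>m. ?f' m y)) (at y)"
    by (rule has_field_derivative_series'(2)[of "{-Y..Y}" ?f ?f' 0])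
      (use uc walk_tail_summable[of j 0] in \<open>auto intro: DERIV_subset[OF walk_egf_DERIV] simp: Y_def\<close>)
  moreover have "(\<Sum>m. ?f' m y) = lam * walk_tail (j + 1) y + \<mu> * walk_tail (j - 1) y"
    by (rule sums_unique[OF s', symmetric])
  ultimately show ?thesis by (simp add: walk_tail_def[abs_def])
qed

lemma walk_tail_index: "(\<lambda>m. real_of_int (j + int m) * walk_egf (- (j + int m)) y) sums
   (y * (\<mu> * walk_tail (j - 1) y - lam * walk_tail (j + 1) y))"
proof -
  have "(\<lambda>m. y * (\<mu> * walk_egf (- (j - 1 + int m)) y - lam * walk_egf (- (j + 1 + int m)) y)) sums
     (y * (\<mu> * walk_tail (j - 1) y - lam * walk_tail (j + 1) y))"
    by (intro sums_mult sums_diff walk_tail_sums)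
  moreover have "y * (\<mu> * walk_egf (- (j - 1 + int m)) y - lam * walk_egf (- (j + 1 + int m)) y) =
     real_of_int (j + int m) * walk_egf (- (j + int m)) y" for m
  proof -
    have e: "- (j + int m) - 1 = - (j + 1 + int m)" "- (j + int m) + 1 = - (j - 1 + int m)" by simp_all
    show ?thesis using walk_egf_index[of "- (j + int m)" y] unfolding e by (simp add: algebra_simps)
  qed
  ultimately show ?thesis by simp
qed

text \<open>The factor \<open>(\<lambda>/\<mu>)\<^sup>n\<close> is harmless uniformly in \<open>n\<close>: if \<open>\<lambda> > \<mu>\<close>, symmetry turns it into the passage from the
  lower to the upper tail.\<close>

lemma walk_tail_weighted_bound:
  assumes y: "0 \<le> y" and s: "0 \<le> s"
  shows "(lam / \<mu>) ^ n * walk_tail (int n + s) y \<le> exp ((lam + \<mu>) * y)"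
proof (cases "lam / \<mu> \<le> 1")
  case True
  have "(lam / \<mu>) ^ n * walk_tail (int n + s) y \<le> 1 * walk_tail (int n + s) y"
    using True lam mu by (intro mult_right_mono walk_tail_nonneg y power_le_one) auto
  also have "\<dots> \<le> exp ((lam + \<mu>) * y)" using walk_tail_le[OF y] by simp
  finally show ?thesis .
next
  case False
  let ?r = "lam / \<mu>"
  have "(\<lambda>m. ?r ^ n * walk_egf (- (int n + s + int m)) y) sums (?r ^ n * walk_tail (int n + s) y)"
    by (intro sums_mult walk_tail_sums)
  moreover have i: "inj (\<lambda>m. int n + s + int m)" by (auto simp: inj_def)
  have "(\<lambda>m. walk_egf (int n + s + int m) y) sums (\<Sum>m. walk_egf (int n + s + int m) y)"
    by (rule summable_sums[OF walk_egf_summable(1)[OF i y]])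
  moreover have "?r ^ n * walk_egf (- (int n + s + int m)) y \<le> walk_egf (int n + s + int m) y" for m
  proof -
    obtain k where k: "int n + s + int m = int k" "n \<le> k"
      using s by (intro that[of "nat (int n + s + int m)"]) auto
    have "?r ^ n * walk_egf (- int k) y \<le> ?r ^ k * walk_egf (- int k) y"
      using False k(2) by (intro mult_right_mono power_increasing walk_egf_nonneg y) auto
    also have "\<dots> = walk_egf (int k) y" using walk_egf_symmetric[of "int k" y] by simp
    finally show ?thesis using k by simp
  qed
  ultimately have "?r ^ n * walk_tail (int n + s) y \<le> (\<Sum>m. walk_egf (int n + s + int m) y)"
    by (rule sums_le[rotated])
  also have "\<dots> \<le> exp ((lam + \<mu>) * y)" by (rule walk_egf_summable(2)[OF i y])
  finally show ?thesis .
qed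

section \<open>The explicit solution for the ordinary queue\<close>

text \<open>The transition function of the M/M/1 queue times \<open>exp ((\<lambda> + \<mu>) y)\<close>: the free walk plus the correction
  for reflection at 0.\<close>

definition queue_kernel :: "nat \<Rightarrow> nat \<Rightarrow> real \<Rightarrow> real" where
  "queue_kernel i n y = walk_egf (int n - int i) y
     + (lam / \<mu>) ^ n * (walk_tail (int n + int i + 1) y - lam / \<mu> * walk_tail (int n + int i + 2) y)"

text \<open>Each of the two summands satisfies the free recurrence, at every level.\<close>

lemma queue_kernel_DERIV_Suc:
  "(queue_kernel i (Suc n) has_real_derivative lam * queue_kernel i n y + \<mu> * queue_kernel i (Suc (Suc n)) y) (at y)"
proof -
  let ?r = "lam / \<mu>"
  have alg: "(l * g0 + m * g2) + r ^ Suc n * ((l * t3 + m * t1) - r * (l * t4 + m * t2)) =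
      l * (g0 + r ^ n * (t1 - r * t2)) + m * (g2 + r ^ Suc (Suc n) * (t3 - r * t4))"
    if "l = m * r" for l m r g0 g2 t1 t2 t3 t4 :: real
    unfolding that by (simp add: algebra_simps)
  have e: "int (Suc n) + int i + 1 + 1 = int n + int i + 3" "int (Suc n) + int i + 1 - 1 = int n + int i + 1"
    "int (Suc n) + int i + 2 + 1 = int n + int i + 4" "int (Suc n) + int i + 2 - 1 = int n + int i + 2"
    "int (Suc n) - int i - 1 = int n - int i" "int (Suc n) - int i + 1 = int (Suc (Suc n)) - int i"
    "int (Suc (Suc n)) + int i + 1 = int n + int i + 3" "int (Suc (Suc n)) + int i + 2 = int n + int i + 4" by simp_all
  have "(queue_kernel i (Suc n) has_real_derivative
     (lam * walk_egf (int (Suc n) - int i - 1) y + \<mu> * walk_egf (int (Suc n) - int i + 1) y)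
     + ?r ^ Suc n * ((lam * walk_tail (int (Suc n) + int i + 1 + 1) y + \<mu> * walk_tail (int (Suc n) + int i + 1 - 1) y)
        - ?r * (lam * walk_tail (int (Suc n) + int i + 2 + 1) y + \<mu> * walk_tail (int (Suc n) + int i + 2 - 1) y))) (at y)"
    unfolding queue_kernel_def[abs_def]
    by (intro DERIV_add DERIV_diff DERIV_cmult walk_egf_DERIV walk_tail_DERIV)
  then show ?thesis
  proof (rule DERIV_cong)
    show "(lam * walk_egf (int (Suc n) - int i - 1) y + \<mu> * walk_egf (int (Suc n) - int i + 1) y)
     + ?r ^ Suc n * ((lam * walk_tail (int (Suc n) + int i + 1 + 1) y + \<mu> * walk_tail (int (Suc n) + int i + 1 - 1) y)
        - ?r * (lam * walk_tail (int (Suc n) + int i + 2 + 1) y + \<mu> * walk_tail (int (Suc n) + int i + 2 - 1) y))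
      = lam * queue_kernel i n y + \<mu> * queue_kernel i (Suc (Suc n)) y"
      unfolding queue_kernel_def e by (rule alg) (use mu in simp)
  qed
qed

text \<open>The boundary equation amounts to \<open>\<lambda> q\<^sub>-\<^sub>1 = \<mu> q\<^sub>0\<close> for the extension of the formula to \<open>n = -1\<close>; it holds because
  consecutive tails differ by one term.\<close>

lemma queue_kernel_DERIV_0:
  "(queue_kernel i 0 has_real_derivative \<mu> * queue_kernel i 0 y + \<mu> * queue_kernel i 1 y) (at y)"
proof -
  let ?r = "lam / \<mu>"
  have alg: "(l * gm + m * g1) + r ^ 0 * ((l * t2 + m * t0) - r * (l * t3 + m * t1)) =
      m * (g0 + r ^ 0 * (t1 - r * t2)) + m * (g1 + r ^ 1 * (t2 - r * t3))"
    if "l = m * r" "t0 = g0 + t1" "t1 = gm + t2" for l m r g0 g1 gm t0 t1 t2 t3 :: real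
    unfolding that by (simp add: algebra_simps)
  have e: "int 0 + int i + 1 + 1 = int i + 2" "int 0 + int i + 1 - 1 = int i"
    "int 0 + int i + 2 + 1 = int i + 3" "int 0 + int i + 2 - 1 = int i + 1"
    "int 0 - int i - 1 = - (int i + 1)" "int 0 - int i + 1 = int 1 - int i"
    "int 0 + int i + 1 = int i + 1" "int 0 + int i + 2 = int i + 2"
    "int 1 + int i + 1 = int i + 2" "int 1 + int i + 2 = int i + 3" "int 0 - int i = - int i"
    "- int i - 1 = - (int i + 1)" "- int i + 1 = int 1 - int i" "int i + 1 + 1 = int i + 2" "int i + 1 - 1 = int i"
    "int i + 2 + 1 = int i + 3" "int i + 2 - 1 = int i + 1" by simp_all
  have t0: "walk_tail (int i) y = walk_egf (- int i) y + walk_tail (int i + 1) y" by (rule walk_tail_Suc)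
  have t1: "walk_tail (int i + 1) y = walk_egf (- (int i + 1)) y + walk_tail (int i + 2) y"
    using walk_tail_Suc[of "int i + 1" y] by (simp add: add.assoc)
  have "(queue_kernel i 0 has_real_derivative
     (lam * walk_egf (int 0 - int i - 1) y + \<mu> * walk_egf (int 0 - int i + 1) y)
     + ?r ^ 0 * ((lam * walk_tail (int 0 + int i + 1 + 1) y + \<mu> * walk_tail (int 0 + int i + 1 - 1) y)
       - ?r * (lam * walk_tail (int 0 + int i + 2 + 1) y + \<mu> * walk_tail (int 0 + int i + 2 - 1) y))) (at y)"
    unfolding queue_kernel_def[abs_def]
    by (intro DERIV_add DERIV_diff DERIV_cmult walk_egf_DERIV walk_tail_DERIV)
  then show ?thesis
  proof (rule DERIV_cong)
    show "(lam * walk_egf (int 0 - int i - 1) y + \<mu> * walk_egf (int 0 - int i + 1) y)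
     + ?r ^ 0 * ((lam * walk_tail (int 0 + int i + 1 + 1) y + \<mu> * walk_tail (int 0 + int i + 1 - 1) y)
       - ?r * (lam * walk_tail (int 0 + int i + 2 + 1) y + \<mu> * walk_tail (int 0 + int i + 2 - 1) y))
       = \<mu> * queue_kernel i 0 y + \<mu> * queue_kernel i 1 y"
      unfolding queue_kernel_def e by (rule alg[OF _ t0 t1]) (use mu in simp)
  qed
qed

lemma queue_kernel_at_0: "queue_kernel i n 0 = (if n = i then 1 else 0)"
  by (simp add: queue_kernel_def walk_tail_0 walk_egf_0)

lemma queue_kernel_bound:
  assumes y: "0 \<le> y"
  shows "\<bar>queue_kernel i n y\<bar> \<le> (2 + lam / \<mu>) * exp ((lam + \<mu>) * y)"
proof -
  let ?r = "lam / \<mu>" and ?E = "exp ((lam + \<mu>) * y)"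
  let ?A = "?r ^ n * walk_tail (int n + int i + 1) y" and ?B = "?r ^ n * walk_tail (int n + int i + 2) y"
  have r: "0 \<le> ?r" using lam mu by simp
  have "walk_egf (int n - int i) y \<le> ?E"
    using walk_egf_sum_le[of "{int n - int i}" y] y by simp
  moreover have "0 \<le> walk_egf (int n - int i) y" by (rule walk_egf_nonneg[OF y])
  moreover have A: "?A \<le> ?E" "?B \<le> ?E"
    using walk_tail_weighted_bound[OF y, of "int i + 1" n] walk_tail_weighted_bound[OF y, of "int i + 2" n]
    by (simp_all add: add.assoc)
  moreover have B: "0 \<le> ?A" "0 \<le> ?B" using r by (intro mult_nonneg_nonneg walk_tail_nonneg y; simp)+
  moreover have "?r * ?B \<le> ?r * ?E" by (intro mult_left_mono A r)
  moreover have "0 \<le> ?r * ?B" by (rule mult_nonneg_nonneg[OF r B(2)])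
  moreover have "queue_kernel i n y = walk_egf (int n - int i) y + ?A - ?r * ?B"
    by (simp add: queue_kernel_def algebra_simps)
  moreover have "(2 + ?r) * ?E = 2 * ?E + ?r * ?E" by (simp add: algebra_simps)
  ultimately show ?thesis by linarith
qed

context
  fixes \<xi> :: real
  assumes xi: "0 \<le> \<xi>"
begin

text \<open>The probability of being in state \<open>n\<close> at time \<open>y\<close> with no catastrophe before, starting from \<open>i\<close>.\<close>

definition killed_prob :: "nat \<Rightarrow> nat \<Rightarrow> real \<Rightarrow> real" where
  "killed_prob i n y = exp (- (lam + \<mu> + \<xi>) * y) * queue_kernel i n y"

lemma killed_prob_DERIV:
  "(killed_prob i n has_real_derivative queue_gen lam \<mu> \<xi> (\<lambda>m. killed_prob i m y) n) (at y)"
proof -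
  have ex: "((\<lambda>y. exp (- (lam + \<mu> + \<xi>) * y)) has_real_derivative - (lam + \<mu> + \<xi>) * exp (- (lam + \<mu> + \<xi>) * y)) (at y)"
    by (auto intro!: derivative_eq_intros)
  show ?thesis
  proof (cases n)
    case 0
    show ?thesis using DERIV_mult[OF ex queue_kernel_DERIV_0[of i y]]
      unfolding 0 killed_prob_def[abs_def] queue_gen_def by (simp add: algebra_simps)
  next
    case (Suc k)
    show ?thesis using DERIV_mult[OF ex queue_kernel_DERIV_Suc[of i k y]]
      unfolding Suc killed_prob_def[abs_def] queue_gen_def by (simp add: algebra_simps)
  qed
qed

lemma killed_prob_at_0: "killed_prob i n 0 = (if n = i then 1 else 0)"
  by (simp add: killed_prob_def queue_kernel_at_0)

lemma killed_prob_bound: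
  assumes "0 \<le> y" shows "\<bar>killed_prob i n y\<bar> \<le> 2 + lam / \<mu>"
proof -
  have "\<bar>killed_prob i n y\<bar> \<le> exp (- (lam + \<mu> + \<xi>) * y) * ((2 + lam / \<mu>) * exp ((lam + \<mu>) * y))"
    unfolding killed_prob_def abs_mult by (simp add: queue_kernel_bound[OF assms])
  also have "\<dots> = (2 + lam / \<mu>) * exp (- \<xi> * y)"
    by (simp add: mult_ac exp_add[symmetric]) (simp add: algebra_simps)
  also have "\<dots> \<le> (2 + lam / \<mu>) * 1" using xi assms lam mu by (intro mult_left_mono) auto
  finally show ?thesis by simp
qed

lemma continuous_on_killed_prob: "continuous_on S (killed_prob i n)"
  using killed_prob_DERIV by (intro DERIV_continuous_on) (auto intro: DERIV_subset)

text \<open>The transition probabilities of the ordinary queue with catastrophes. The integral accounts for the last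
  catastrophe, which occurs at rate \<open>\<xi>\<close> and restarts the queue from state 0.\<close>

definition queue_prob :: "nat \<Rightarrow> nat \<Rightarrow> real \<Rightarrow> real" where
  "queue_prob i n y = killed_prob i n y + \<xi> * integral {0..y} (killed_prob 0 n)"

lemma killed_prob_integral_DERIV:
  assumes "0 < y"
  shows "((\<lambda>y. integral {0..y} (killed_prob 0 n)) has_real_derivative killed_prob 0 n y) (at y)"
proof -
  have "((\<lambda>y. integral {0..y} (killed_prob 0 n)) has_real_derivative killed_prob 0 n y) (at y within {0..y + 1})"
    by (rule integral_has_real_derivative[OF continuous_on_killed_prob]) (use assms in auto)
  then show ?thesis using assms at_within_Icc_at[of 0 y "y + 1"] by simp
qed

text \<open>The forward equation for the queue started in 0, integrated from 0 to \<open>y\<close>.\<close>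

lemma killed_prob_integral_gen:
  assumes "0 \<le> y"
  shows "killed_prob 0 n y = queue_gen lam \<mu> \<xi> (\<lambda>m. integral {0..y} (killed_prob 0 m)) n + catastrophe_source 1 n"
proof -
  have i: "killed_prob 0 m integrable_on {0..y}" for m
    by (rule integrable_continuous_real[OF continuous_on_killed_prob])
  have "((\<lambda>s. queue_gen lam \<mu> \<xi> (\<lambda>m. killed_prob 0 m s) n) has_integral killed_prob 0 n y - killed_prob 0 n 0) {0..y}"
    using assms killed_prob_DERIV
    by (intro fundamental_theorem_of_calculus)
      (auto simp: has_real_derivative_iff_has_vector_derivative[symmetric] intro: DERIV_subset)
  then have "killed_prob 0 n y - killed_prob 0 n 0 = integral {0..y} (\<lambda>s. queue_gen lam \<mu> \<xi> (\<lambda>m. killed_prob 0 m s) n)"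
    by (rule integral_unique[symmetric])
  also have "\<dots> = queue_gen lam \<mu> \<xi> (\<lambda>m. integral {0..y} (killed_prob 0 m)) n"
    unfolding queue_gen_def
    by (cases "n = 0")
      (simp_all add: Henstock_Kurzweil_Integration.integral_add Henstock_Kurzweil_Integration.integral_diff
         i integrable_add integrable_diff integrable_on_mult_right)
  finally show ?thesis by (simp add: killed_prob_at_0 catastrophe_source_def)
qed

lemma queue_prob_DERIV:
  assumes "0 < y"
  shows "(queue_prob i n has_real_derivative queue_gen lam \<mu> \<xi> (\<lambda>m. queue_prob i m y) n + catastrophe_source \<xi> n) (at y)"
proof -
  have "(queue_prob i n has_real_derivative queue_gen lam \<mu> \<xi> (\<lambda>m. killed_prob i m y) n + \<xi> * killed_prob 0 n y) (at y)"
    unfolding queue_prob_def[abs_def]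
    by (intro DERIV_add DERIV_cmult killed_prob_DERIV killed_prob_integral_DERIV assms)
  moreover have "queue_gen lam \<mu> \<xi> (\<lambda>m. killed_prob i m y) n + \<xi> * killed_prob 0 n y =
      queue_gen lam \<mu> \<xi> (\<lambda>m. queue_prob i m y) n + catastrophe_source \<xi> n"
    unfolding killed_prob_integral_gen[OF less_imp_le[OF assms], of n]
    by (simp add: queue_prob_def queue_gen_def catastrophe_source_def algebra_simps)
  ultimately show ?thesis by simp
qed

lemma continuous_on_queue_prob: "continuous_on {0..T} (queue_prob i n)"
  unfolding queue_prob_def[abs_def]
  by (intro continuous_intros continuous_on_killed_prob indefinite_integral_continuous_1
       integrable_continuous_real)

lemma queue_prob_integral_bound:
  assumes "0 \<le> y" shows "\<bar>integral {0..y} (killed_prob 0 n)\<bar> \<le> (2 + lam / \<mu>) * y"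
proof -
  have "norm (integral {0..y} (killed_prob 0 n)) \<le> (2 + lam / \<mu>) * (y - 0)"
    using assms killed_prob_bound by (intro integral_bound continuous_on_killed_prob) auto
  then show ?thesis by simp
qed

lemma queue_prob_bound:
  assumes "0 \<le> y" "y \<le> T"
  shows "\<bar>queue_prob i n y\<bar> \<le> (2 + lam / \<mu>) * (1 + \<xi> * T)"
proof -
  have "\<xi> * \<bar>integral {0..y} (killed_prob 0 n)\<bar> \<le> \<xi> * ((2 + lam / \<mu>) * T)"
    using xi queue_prob_integral_bound[OF assms(1), of n] mult_left_mono[OF assms(2), of "2 + lam / \<mu>"] lam mu
    by (intro mult_left_mono) auto
  moreover have "\<bar>queue_prob i n y\<bar> \<le> \<bar>killed_prob i n y\<bar> + \<xi> * \<bar>integral {0..y} (killed_prob 0 n)\<bar>"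
    unfolding queue_prob_def using xi by (intro order_trans[OF abs_triangle_ineq]) (simp add: abs_mult)
  ultimately show ?thesis using killed_prob_bound[OF assms(1), of i n] by (simp add: algebra_simps)
qed

lemma queue_prob_series:
  assumes y: "0 < y"
  shows "(\<lambda>k. queue_coef lam \<mu> \<xi> (\<lambda>n. if n = i then 1 else 0) k n * y ^ k / fact k) sums queue_prob i n y"
proof -
  have "(\<lambda>k. queue_coef lam \<mu> \<xi> (\<lambda>n. if n = i then 1 else 0) k n * y powr (1 * real k) * rGamma (1 * real k + 1)) sums queue_prob i n y"
  proof (rule caputo_queue_series[where T = y])
    show "queue_prob i n 0 = (if n = i then 1 else 0)" for n
      by (simp add: queue_prob_def killed_prob_at_0)
    show "continuous (at_right 0) (queue_prob i n)" for n
    proof -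
      have "continuous (at 0 within {0..1}) (queue_prob i n)"
        using continuous_on_queue_prob[of 1 i n] by (simp add: continuous_on_eq_continuous_within)
      then show ?thesis by (simp add: at_within_Icc_at_right)
    qed
    show "has_caputo_derivative 1 (queue_prob i n) (queue_gen lam \<mu> \<xi> (\<lambda>m. queue_prob i m t) n + catastrophe_source \<xi> n) t"
      if "0 < t" for n t
      using queue_prob_DERIV[OF that] by (simp add: has_caputo_derivative_def)
    show "\<bar>queue_prob i n t\<bar> \<le> (2 + lam / \<mu>) * (1 + \<xi> * y)" if "0 < t" "t \<le> y" for n t
      using queue_prob_bound[of t y i n] that by simp
  qed (use lam mu xi y in auto)
  moreover have "y powr (1 * real k) * rGamma (1 * real k + 1) = y ^ k / fact k" for k
    using y Gamma_fact[of k, where 'a = real] by (simp add: powr_realpow rGamma_inverse_Gamma divide_inverse add.commute)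
  ultimately show ?thesis by (simp add: mult.assoc)
qed


section \<open>The pieces of the explicit solution as Bessel series\<close>

lemma exp_bounded_killed_prob: "exp_bounded (killed_prob i n)"
  unfolding exp_bounded_def
proof (intro conjI exI allI impI)
  show "continuous_on {0<..} (killed_prob i n)" by (rule continuous_on_killed_prob)
  show "\<bar>killed_prob i n y\<bar> \<le> (2 + lam / \<mu>) * exp (0 * y)" if "0 < y" for y
    using killed_prob_bound[of y i n] that by simp
qed

lemma exp_bounded_killed_integral: "exp_bounded (\<lambda>y. integral {0..y} (killed_prob 0 n))"
  unfolding exp_bounded_def
proof (intro conjI exI allI impI)
  show "continuous_on {0<..} (\<lambda>y. integral {0..y} (killed_prob 0 n))"
    by (rule DERIV_continuous_on) (auto intro: DERIV_subset[OF killed_prob_integral_DERIV])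
  show "\<bar>integral {0..y} (killed_prob 0 n)\<bar> \<le> (2 + lam / \<mu>) * exp (1 * y)" if "0 < y" for y
  proof -
    have "y \<le> exp y" using exp_ge_add_one_self[of y] by linarith
    then have "(2 + lam / \<mu>) * y \<le> (2 + lam / \<mu>) * exp y"
      using lam mu by (intro mult_left_mono) auto
    then show ?thesis using queue_prob_integral_bound[of y n] that by simp
  qed
qed

text \<open>The two summands of \<open>killed_prob\<close>: the free walk, and the correction at the boundary 0.\<close>

definition free_prob :: "nat \<Rightarrow> nat \<Rightarrow> real \<Rightarrow> real" where
  "free_prob i n y = exp (- (lam + \<mu> + \<xi>) * y) * walk_egf (int n - int i) y"

definition boundary_prob :: "nat \<Rightarrow> nat \<Rightarrow> real \<Rightarrow> real" where
  "boundary_prob i n y = exp (- (lam + \<mu> + \<xi>) * y) *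
     ((lam / \<mu>) ^ n * (walk_tail (int n + int i + 1) y - lam / \<mu> * walk_tail (int n + int i + 2) y))"

lemma killed_prob_split: "killed_prob i n y = boundary_prob i n y + free_prob i n y"
  by (simp add: killed_prob_def queue_kernel_def boundary_prob_def free_prob_def algebra_simps)

lemma exp_bounded_free_prob: "exp_bounded (free_prob i n)"
  unfolding exp_bounded_def
proof (intro conjI exI allI impI)
  have "continuous_on {0<..} (walk_egf k)" for k
    by (rule DERIV_continuous_on) (auto intro: DERIV_subset[OF walk_egf_DERIV])
  then show "continuous_on {0<..} (free_prob i n)"
    unfolding free_prob_def[abs_def] by (intro continuous_intros)
  show "\<bar>free_prob i n y\<bar> \<le> 1 * exp ((- \<xi>) * y)" if "0 < y" for y
  proof -
    have "\<bar>walk_egf (int n - int i) y\<bar> \<le> exp ((lam + \<mu>) * y)"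
      using walk_egf_sum_le[of "{int n - int i}" y] walk_egf_nonneg[of y "int n - int i"] that by simp
    then have "\<bar>free_prob i n y\<bar> \<le> exp (- (lam + \<mu> + \<xi>) * y) * exp ((lam + \<mu>) * y)"
      unfolding free_prob_def abs_mult by simp
    also have "\<dots> = 1 * exp ((- \<xi>) * y)" unfolding exp_add[symmetric] by (simp add: algebra_simps)
    finally show ?thesis .
  qed
qed

lemma exp_bounded_boundary_prob: "exp_bounded (boundary_prob i n)"
proof -
  have "boundary_prob i n = (\<lambda>y. killed_prob i n y - free_prob i n y)"
    by (simp add: fun_eq_iff killed_prob_split)
  then show ?thesis by (simp add: exp_bounded_diff exp_bounded_killed_prob exp_bounded_free_prob)
qed

lemma M_integral_queue_prob:
  assumes "0 < \<alpha>" "\<alpha> \<le> 1" "0 < t"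
  shows "M_integral \<alpha> t (queue_prob i n) = M_integral \<alpha> t (killed_prob i n)
      + \<xi> * M_integral \<alpha> t (\<lambda>y. integral {0..y} (killed_prob 0 n))"
    and "M_integral \<alpha> t (killed_prob i n) = M_integral \<alpha> t (boundary_prob i n) + M_integral \<alpha> t (free_prob i n)"
proof -
  show "M_integral \<alpha> t (queue_prob i n) = M_integral \<alpha> t (killed_prob i n)
      + \<xi> * M_integral \<alpha> t (\<lambda>y. integral {0..y} (killed_prob 0 n))"
    unfolding queue_prob_def[abs_def]
    by (subst M_integral_add[OF assms])
       (auto intro: exp_bounded_killed_prob exp_bounded_cmult exp_bounded_killed_integral simp: M_integral_cmult)
  show "M_integral \<alpha> t (killed_prob i n) = M_integral \<alpha> t (boundary_prob i n) + M_integral \<alpha> t (free_prob i n)"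
    unfolding M_integral_add[OF assms exp_bounded_boundary_prob exp_bounded_free_prob, symmetric]
      killed_prob_split[symmetric] ..
qed

text \<open>If the start or the end point is 0, the free term joins the tails; this is why the formula for state 0 and all catastrophe terms
  of the theorem involve a single series.\<close>

lemma queue_kernel_from_0: "queue_kernel 0 n y = (lam / \<mu>) ^ n * (walk_tail (int n) y - lam / \<mu> * walk_tail (int n + 2) y)"
  using walk_egf_symmetric[of "int n" y] walk_tail_Suc[of "int n" y]
  by (simp add: queue_kernel_def algebra_simps)

lemma queue_kernel_to_0: "queue_kernel i 0 y = walk_tail (int i) y - lam / \<mu> * walk_tail (int i + 2) y"
  using walk_tail_Suc[of "int i" y] by (simp add: queue_kernel_def)

text \<open>The recurrence of the walk weights turns the factors \<open>n\<close> in \<open>n I\<^sub>n / \<rho>\<^sup>n\<close> into differences of two tails, at the price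
  of a factor \<open>y\<close> that cancels the \<open>1/y\<close> in \<open>\<beta>\<close>.\<close>

lemma bessel_weighted_sums:
  assumes y: "0 < y"
  shows "(\<lambda>k. (real (n + k) + 1) * bessel_I (real (n + k) + 1) (2 * sqrt (lam * \<mu>) * y) / sqrt (lam / \<mu>) ^ (n + k + 1)) sums
      (y * (\<mu> * (walk_tail (int n) y - lam / \<mu> * walk_tail (int n + 2) y)))"
proof -
  have eq1: "real_of_int (int n + 1 + int k) * walk_egf (- (int n + 1 + int k)) y =
     (real (n + k) + 1) * bessel_I (real (n + k) + 1) (2 * sqrt (lam * \<mu>) * y) / sqrt (lam / \<mu>) ^ (n + k + 1)" for k
  proof -
    have e: "int n + 1 + int k = int (n + k + 1)" "real_of_int (int (n + k + 1)) = real (n + k) + 1"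
      "real (n + k + 1) = real (n + k) + 1" by simp_all
    show ?thesis
      using bessel_I_div_walk[OF y, of "n + k + 1"] unfolding e by (simp only: times_divide_eq_right[symmetric])
  qed
  have eq2: "y * (\<mu> * walk_tail (int n + 1 - 1) y - lam * walk_tail (int n + 1 + 1) y) =
      y * (\<mu> * (walk_tail (int n) y - lam / \<mu> * walk_tail (int n + 2) y))"
    using mu by (simp add: algebra_simps)
  show ?thesis using walk_tail_index[of "int n + 1" y] unfolding eq1 eq2 .
qed

lemma killed_to_0_bessel:
  assumes y: "0 < y"
  shows "queue_beta lam \<mu> \<xi> y * (\<Sum>k. (real (i + k) + 1) * bessel_I (real (i + k) + 1) (2 * sqrt (lam * \<mu>) * y)
             / sqrt (lam / \<mu>) ^ (i + k + 1)) = \<mu> * killed_prob i 0 y"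
  unfolding sums_unique[OF bessel_weighted_sums[OF y], symmetric] killed_prob_def queue_kernel_to_0 queue_beta_def
  using y by (simp add: field_simps)

lemma killed_from_0_bessel:
  assumes y: "0 < y"
  shows "queue_beta lam \<mu> \<xi> y * (\<Sum>k. real (n + k + 1) * bessel_I (real (n + k + 1)) (2 * sqrt (lam * \<mu>) * y)
             / sqrt (lam / \<mu>) ^ (k + 1)) = \<mu> / sqrt (lam / \<mu>) ^ n * killed_prob 0 n y"
proof -
  let ?\<rho> = "sqrt (lam / \<mu>)"
  have \<rho>: "?\<rho> \<noteq> 0" using lam mu by simp
  have \<rho>2: "(lam / \<mu>) ^ n = ?\<rho> ^ n * ?\<rho> ^ n"
    using lam mu by (simp add: power_mult_distrib[symmetric])
  have "(\<lambda>k. ?\<rho> ^ n * ((real (n + k) + 1) * bessel_I (real (n + k) + 1) (2 * sqrt (lam * \<mu>) * y) / ?\<rho> ^ (n + k + 1))) sums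
      (?\<rho> ^ n * (y * (\<mu> * (walk_tail (int n) y - lam / \<mu> * walk_tail (int n + 2) y))))"
    by (rule sums_mult[OF bessel_weighted_sums[OF y]])
  moreover have "?\<rho> ^ n * ((real (n + k) + 1) * bessel_I (real (n + k) + 1) (2 * sqrt (lam * \<mu>) * y) / ?\<rho> ^ (n + k + 1)) =
     real (n + k + 1) * bessel_I (real (n + k + 1)) (2 * sqrt (lam * \<mu>) * y) / ?\<rho> ^ (k + 1)" for k
  proof -
    have "?\<rho> ^ (n + k + 1) = ?\<rho> ^ n * ?\<rho> ^ (k + 1)" by (simp add: power_add)
    moreover have "real (n + k + 1) = real (n + k) + 1" by simp
    moreover have "p * (z / (p * q)) = z / q" if "p \<noteq> 0" for p q z :: real using that by simp
    ultimately show ?thesis using \<rho> by (simp only: power_not_zero not_False_eq_True)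
  qed
  ultimately have "(\<Sum>k. real (n + k + 1) * bessel_I (real (n + k + 1)) (2 * sqrt (lam * \<mu>) * y) / ?\<rho> ^ (k + 1))
     = ?\<rho> ^ n * (y * (\<mu> * (walk_tail (int n) y - lam / \<mu> * walk_tail (int n + 2) y)))"
    by (simp only: sums_iff)
  then show ?thesis
    unfolding killed_prob_def queue_kernel_from_0 queue_beta_def \<rho>2 using y \<rho> by (simp only:) (simp add: field_simps)
qed

lemma killed_integral_LBINT:
  assumes y: "0 < y" and f: "\<And>u. 0 < u \<Longrightarrow> u < y \<Longrightarrow> f u = c * killed_prob 0 n u"
  shows "(LBINT u:{0<..<y}. f u) = c * integral {0..y} (killed_prob 0 n)"
proof -
  have "set_integrable lborel {0..y} (killed_prob 0 n)"
    by (rule set_integrable_Icc_continuous[OF continuous_on_killed_prob])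
  then have i: "set_integrable lborel {0<..<y} (killed_prob 0 n)"
    by (rule set_integrable_subset) auto
  have "(LBINT u:{0<..<y}. f u) = (LBINT u:{0<..<y}. c * killed_prob 0 n u)"
    using f by (intro set_lebesgue_integral_cong) auto
  also have "\<dots> = c * (LBINT u:{0<..<y}. killed_prob 0 n u)" by simp
  also have "(LBINT u:{0<..<y}. killed_prob 0 n u) = integral {0..y} (killed_prob 0 n)"
    using set_borel_integral_eq_integral(2)[OF i] by (simp add: integral_open_interval_real)
  finally show ?thesis .
qed

lemma boundary_prob_bessel:
  assumes y: "0 < y"
  shows "y * queue_beta lam \<mu> \<xi> y *
         (\<Sum>m. bessel_I (real (m + n + i + 1)) (2 * sqrt (lam * \<mu>) * y)
                 / sqrt (lam / \<mu>) powi (int m - int n + int i + 1)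
             - bessel_I (real (m + n + i + 2)) (2 * sqrt (lam * \<mu>) * y)
                 / sqrt (lam / \<mu>) powi (int m - int n + int i)) = boundary_prob i n y"
proof -
  let ?\<rho> = "sqrt (lam / \<mu>)" and ?r = "lam / \<mu>"
  have \<rho>: "?\<rho> \<noteq> 0" using lam mu by simp
  have r2: "?\<rho> ^ (2 * p) = ?r ^ p" for p
    using lam mu by (simp add: power_mult)
  have pw: "b / ?\<rho> powi (int N - int (2 * p)) = ?r ^ p * (b / ?\<rho> ^ N)" for b N p
  proof -
    have "?\<rho> powi (int N - int (2 * p)) = ?\<rho> ^ N / ?r ^ p"
      unfolding power_int_diff[OF disjI1[OF \<rho>]] power_int_of_nat r2 ..
    then show ?thesis by simp
  qed
  have t: "bessel_I (real (m + n + i + 1)) (2 * sqrt (lam * \<mu>) * y) / ?\<rho> powi (int m - int n + int i + 1)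
             - bessel_I (real (m + n + i + 2)) (2 * sqrt (lam * \<mu>) * y) / ?\<rho> powi (int m - int n + int i)
      = ?r ^ n * walk_egf (- (int n + int i + 1 + int m)) y - ?r ^ Suc n * walk_egf (- (int n + int i + 2 + int m)) y" for m
  proof -
    have e: "int m - int n + int i + 1 = int (m + n + i + 1) - int (2 * n)"
      "int m - int n + int i = int (m + n + i + 2) - int (2 * Suc n)"
      "int n + int i + 1 + int m = int (m + n + i + 1)" "int n + int i + 2 + int m = int (m + n + i + 2)" by simp_all
    show ?thesis unfolding e(1) unfolding e(2-4) pw bessel_I_div_walk[OF y] ..
  qed
  have "(\<lambda>m. ?r ^ n * walk_egf (- (int n + int i + 1 + int m)) y - ?r ^ Suc n * walk_egf (- (int n + int i + 2 + int m)) y) sums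
     (?r ^ n * walk_tail (int n + int i + 1) y - ?r ^ Suc n * walk_tail (int n + int i + 2) y)"
    by (intro sums_diff sums_mult walk_tail_sums)
  then have sum: "(\<Sum>m. ?r ^ n * walk_egf (- (int n + int i + 1 + int m)) y - ?r ^ Suc n * walk_egf (- (int n + int i + 2 + int m)) y) =
     ?r ^ n * (walk_tail (int n + int i + 1) y - ?r * walk_tail (int n + int i + 2) y)"
    by (simp only: sums_iff power_Suc right_diff_distrib mult_ac)
  have cancel: "y * (inverse y * z) = z" for z using y by simp
  show ?thesis unfolding t sum boundary_prob_def queue_beta_def cancel ..
qed

lemma free_prob_bessel:
  assumes y: "0 < y"
  shows "sqrt (lam / \<mu>) powi (int n - int i) * bessel_I (real n - real i) (2 * sqrt (lam * \<mu>) * y) * exp (- (lam + \<mu> + \<xi>) * y)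
     = free_prob i n y"
  using bessel_I_walk[OF y, of "int n - int i"] by (simp add: free_prob_def)

end
end

section \<open>The subordination theorem\<close>

text \<open>Both sides have the same expansion in powers of \<open>t\<^sup>\<alpha>\<close>.\<close>

lemma transition_prob_eq_M_integral:
  fixes M :: "'a measure" and X :: "real \<Rightarrow> 'a \<Rightarrow> nat"
  assumes par: "0 < lam" "0 < \<mu>" "0 \<le> \<xi>" "0 < \<alpha>" "\<alpha> \<le> 1"
    and queue: "fractional_MM1_catastrophes \<alpha> lam \<mu> \<xi> M X"
    and t: "0 < t" and i: "\<P>(\<omega> in M. X 0 \<omega> = i) > 0"
  shows "transition_prob M X i n t = M_integral \<alpha> t (queue_prob lam \<mu> \<xi> i n)"
proof -
  define P where "P = transition_prob M X i"
  define q where "q = (\<lambda>n. if n = i then 1 else 0 :: real)"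
  interpret prob_space M using queue by (simp add: fractional_MM1_catastrophes_def)
  have P: "P n 0 = q n" "continuous (at_right 0) (P n)"
    "0 < s \<Longrightarrow> has_caputo_derivative \<alpha> (P 0) (- (lam + \<xi>) * P 0 s + \<mu> * P 1 s + \<xi>) s"
    "0 < s \<Longrightarrow> 1 \<le> n \<Longrightarrow> has_caputo_derivative \<alpha> (P n) (- (lam + \<mu> + \<xi>) * P n s + lam * P (n - 1) s + \<mu> * P (n + 1) s) s" for n s
    using queue i by (auto simp: fractional_MM1_catastrophes_def Let_def P_def q_def)
  have cap: "has_caputo_derivative \<alpha> (P n) (queue_gen lam \<mu> \<xi> (\<lambda>m. P m s) n + catastrophe_source \<xi> n) s" if "0 < s" for n s
    using P(3)[OF that] P(4)[OF that, of n] by (cases "n = 0") (simp_all add: queue_gen_def catastrophe_source_def)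
  have bound: "\<bar>P n s\<bar> \<le> 1" for n s
  proof -
    have X0: "X 0 \<in> measurable M (count_space UNIV)"
      using queue by (simp add: fractional_MM1_catastrophes_def)
    have "{\<omega> \<in> space M. X 0 \<omega> = i} = X 0 -` {i} \<inter> space M" by auto
    also have "\<dots> \<in> events" by (rule measurable_sets[OF X0]) simp
    finally have "\<P>(\<omega> in M. X s \<omega> = n \<and> X 0 \<omega> = i) \<le> \<P>(\<omega> in M. X 0 \<omega> = i)"
      by (intro finite_measure_mono) auto
    then show ?thesis using i by (simp add: P_def transition_prob_def cond_prob_def)
  qed
  have "(\<lambda>k. queue_coef lam \<mu> \<xi> q k n * t powr (\<alpha> * real k) * rGamma (\<alpha> * real k + 1)) sums P n t"
    by (rule caputo_queue_series[where T = t and B = 1]) (use par P cap bound t in auto)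
  moreover have "(\<lambda>k. queue_coef lam \<mu> \<xi> q k n * t powr (\<alpha> * real k) * rGamma (\<alpha> * real k + 1)) sums
      M_integral \<alpha> t (queue_prob lam \<mu> \<xi> i n)"
  proof (rule M_integral_series[where K = "2 * (lam + \<mu> + \<xi>) + \<xi>"])
    show "\<bar>queue_coef lam \<mu> \<xi> q k n\<bar> \<le> (2 * (lam + \<mu> + \<xi>) + \<xi>) ^ k" for k
      using par by (intro queue_coef_bound) (auto simp: q_def)
    show "(\<lambda>k. queue_coef lam \<mu> \<xi> q k n * y ^ k / fact k) sums queue_prob lam \<mu> \<xi> i n y" if "0 < y" for y
      unfolding q_def by (rule queue_prob_series) (use par that in auto)
  qed (use par t in auto)
  ultimately show ?thesis unfolding P_def by (rule sums_unique2)
qed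

theorem theorem2p2:
  fixes \<alpha> lam \<mu> \<xi> t :: real and i :: nat
    and M :: "'a measure" and X :: "real \<Rightarrow> 'a \<Rightarrow> nat"
  defines "\<rho> \<equiv> sqrt (lam / \<mu>)"
    and "\<beta> \<equiv> queue_beta lam \<mu> \<xi>"
    and "P \<equiv> transition_prob M X"
  assumes "0 < lam" "0 < \<mu>" "0 \<le> \<xi>" "0 < \<alpha>" "\<alpha> \<le> 1"
    and "fractional_MM1_catastrophes \<alpha> lam \<mu> \<xi> M X"
    and "0 < t"
    and "\<P>(\<omega> in M. X 0 \<omega> = i) > 0"
  shows "P i 0 t =
       1 / \<mu> * M_integral \<alpha> t (\<lambda>y. \<beta> y *
         (\<Sum>k. (real (i + k) + 1) * bessel_I (real (i + k) + 1) (2 * sqrt (lam * \<mu>) * y)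
               / \<rho> ^ (i + k + 1)))
     + \<xi> / \<mu> * M_integral \<alpha> t (\<lambda>y. LBINT u:{0<..<y}. \<beta> u *
         (\<Sum>k. real (k + 1) * bessel_I (real (k + 1)) (2 * sqrt (lam * \<mu>) * u) / \<rho> ^ (k + 1)))
   \<and> (\<forall>n>0. P i n t =
       \<xi> * \<rho> ^ (n + 1) / sqrt (lam * \<mu>) * M_integral \<alpha> t (\<lambda>y. LBINT u:{0<..<y}. \<beta> u *
         (\<Sum>k. real (n + k + 1) * bessel_I (real (n + k + 1)) (2 * sqrt (lam * \<mu>) * u)
               / \<rho> ^ (k + 1)))
     + M_integral \<alpha> t (\<lambda>y. y * \<beta> y *
         (\<Sum>m. bessel_I (real (m + n + i + 1)) (2 * sqrt (lam * \<mu>) * y)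
                 / \<rho> powi (int m - int n + int i + 1)
             - bessel_I (real (m + n + i + 2)) (2 * sqrt (lam * \<mu>) * y)
                 / \<rho> powi (int m - int n + int i)))
     + M_integral \<alpha> t (\<lambda>y. \<rho> powi (int n - int i)
         * bessel_I (real n - real i) (2 * sqrt (lam * \<mu>) * y) * exp (- (lam + \<mu> + \<xi>) * y)))"
proof (intro conjI allI impI)
  note par = assms(4-6)
  note split = M_integral_queue_prob[OF par assms(7,8,10)]
  have prob: "P i n t = M_integral \<alpha> t (queue_prob lam \<mu> \<xi> i n)" for n
    unfolding P_def by (rule transition_prob_eq_M_integral) fact+
  define J where "J = (\<lambda>n y. integral {0..y} (killed_prob lam \<mu> \<xi> 0 n))"
  have cat: "M_integral \<alpha> t (\<lambda>y. LBINT u:{0<..<y}. \<beta> u *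
         (\<Sum>k. real (n + k + 1) * bessel_I (real (n + k + 1)) (2 * sqrt (lam * \<mu>) * u) / \<rho> ^ (k + 1)))
     = \<mu> / \<rho> ^ n * M_integral \<alpha> t (J n)" for n
    unfolding M_integral_cmult[symmetric] J_def \<rho>_def \<beta>_def
    by (intro M_integral_cong killed_integral_LBINT killed_from_0_bessel par assms(10))
  have \<rho>0: "\<rho> \<noteq> 0" using par by (simp add: \<rho>_def)
  have to_0: "M_integral \<alpha> t (\<lambda>y. \<beta> y *
         (\<Sum>k. (real (i + k) + 1) * bessel_I (real (i + k) + 1) (2 * sqrt (lam * \<mu>) * y) / \<rho> ^ (i + k + 1)))
     = \<mu> * M_integral \<alpha> t (killed_prob lam \<mu> \<xi> i 0)"
    unfolding M_integral_cmult[symmetric] \<rho>_def \<beta>_def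
    by (intro M_integral_cong killed_to_0_bessel par assms(10))
  show "P i 0 t =
       1 / \<mu> * M_integral \<alpha> t (\<lambda>y. \<beta> y *
         (\<Sum>k. (real (i + k) + 1) * bessel_I (real (i + k) + 1) (2 * sqrt (lam * \<mu>) * y)
               / \<rho> ^ (i + k + 1)))
     + \<xi> / \<mu> * M_integral \<alpha> t (\<lambda>y. LBINT u:{0<..<y}. \<beta> u *
         (\<Sum>k. real (k + 1) * bessel_I (real (k + 1)) (2 * sqrt (lam * \<mu>) * u) / \<rho> ^ (k + 1)))"
    unfolding prob to_0 cat[of 0, unfolded add_0] split(1) J_def using par by simp
  fix n :: nat assume "0 < n"
  have boundary: "M_integral \<alpha> t (\<lambda>y. y * \<beta> y *
         (\<Sum>m. bessel_I (real (m + n + i + 1)) (2 * sqrt (lam * \<mu>) * y)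
                 / \<rho> powi (int m - int n + int i + 1)
             - bessel_I (real (m + n + i + 2)) (2 * sqrt (lam * \<mu>) * y)
                 / \<rho> powi (int m - int n + int i))) = M_integral \<alpha> t (boundary_prob lam \<mu> \<xi> i n)"
    unfolding \<rho>_def \<beta>_def by (intro M_integral_cong boundary_prob_bessel par assms(10))
  have free: "M_integral \<alpha> t (\<lambda>y. \<rho> powi (int n - int i)
         * bessel_I (real n - real i) (2 * sqrt (lam * \<mu>) * y) * exp (- (lam + \<mu> + \<xi>) * y))
       = M_integral \<alpha> t (free_prob lam \<mu> \<xi> i n)"
    unfolding \<rho>_def by (intro M_integral_cong free_prob_bessel par assms(10))
  have "sqrt (lam * \<mu>) = \<mu> * \<rho>"
    using par by (simp add: \<rho>_def real_sqrt_mult real_sqrt_divide field_simps)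
  then have coef: "\<xi> * \<rho> ^ (n + 1) / sqrt (lam * \<mu>) * (\<mu> / \<rho> ^ n * z) = \<xi> * z" for z
    using par \<rho>0 by (simp add: field_simps)
  show "P i n t =
       \<xi> * \<rho> ^ (n + 1) / sqrt (lam * \<mu>) * M_integral \<alpha> t (\<lambda>y. LBINT u:{0<..<y}. \<beta> u *
         (\<Sum>k. real (n + k + 1) * bessel_I (real (n + k + 1)) (2 * sqrt (lam * \<mu>) * u)
               / \<rho> ^ (k + 1)))
     + M_integral \<alpha> t (\<lambda>y. y * \<beta> y *
         (\<Sum>m. bessel_I (real (m + n + i + 1)) (2 * sqrt (lam * \<mu>) * y)
                 / \<rho> powi (int m - int n + int i + 1)
             - bessel_I (real (m + n + i + 2)) (2 * sqrt (lam * \<mu>) * y)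
                 / \<rho> powi (int m - int n + int i)))
     + M_integral \<alpha> t (\<lambda>y. \<rho> powi (int n - int i)
         * bessel_I (real n - real i) (2 * sqrt (lam * \<mu>) * y) * exp (- (lam + \<mu> + \<xi>) * y))"
    unfolding prob cat boundary free coef split J_def by simp
qed

end
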